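(* Let $p$ be a prime number, $\Gamma$ a profinite group isomorphic to $\mathbb{Z}_p$, $X$ a connected graph, $\alpha: \mathbb{E}_X \to \Gamma$ a voltage assignment, and $\mathcal{I} = (I_v)_{v\in V_X}$ a family of closed subgroups of $\Gamma$ indexed by the vertices. Let $X_\infty/X$ be the ramified $\mathbb{Z}_p$-covering constructed from the derived graphs $X_n$ of $(X,\alpha,\mathcal{I})$, and assume that each $X_n$ is connected. Put $V_{X,\mathcal{I}} = \{v \in V_X \mid I_v \text{ is trivial}\}$. Then $$\lambda(X_\infty/X) \equiv -1 + \sum_{v \in V_X \setminus V_{X,\mathcal{I}}} [\Gamma : I_v] \pmod 2.$$
   Context: Graphs (Serre's formalism): a graph $X$ consists of finite sets $V_X$ (vertices) and $\mathbb{E}_X$ (edges, oriented), an involution $e \mapsto \overline{e}$ of $\mathbb{E}_X$ without fixed elements, and maps $s,t:\mathbb{E}_X \to V_X$ with $s(\overline{e}) = t(e)$, $t(\overline{e}) = s(e)$. So multi-edges and loops are allowed, and each pair $\{e,\overline{e}\}$ is one undirected edge. $\kappa_X$ denotes the number of spanning trees of $X$ (as an undirected multigraph, undirected edges being the pairs $\{e,\overline e\}$). $\Gamma$ is written multiplicatively and $\Gamma_n = \Gamma/\Gamma^{p^n}$ for $n\ge 0$. A voltage assignment is a map $\alpha: \mathbb{E}_X \to \Gamma$ with $\alpha(\overline{e}) = \alpha(e)^{-1}$ for all $e$. Let $I_{v,n}$ be the image of $I_v$ in $\Gamma_n$. The derived graph $X_n$ has $V_{X_n} = \coprod_{v \in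 V_X} (\Gamma_n/I_{v,n} \times \{v\})$, $\mathbb{E}_{X_n} = \Gamma_n \times \mathbb{E}_X$, with $\overline{(\gamma,e)} = (\gamma\cdot\alpha(e),\overline{e})$, $s((\gamma,e)) = (\gamma I_{s(e),n},s(e))$, $t((\gamma,e)) = (\gamma\cdot\alpha(e) I_{t(e),n},t(e))$. $X_\infty/X$ denotes the tower $X = X_0 \leftarrow X_1 \leftarrow \cdots$. Iwasawa invariants: when all $X_n$ are connected it is known that there are unique non-negative integers $\lambda(X_\infty/X)$, $\mu(X_\infty/X)$ and an integer $\nu$ such that $\operatorname{ord}_p(\kappa_{X_n}) = \lambda(X_\infty/X)\, n + \mu(X_\infty/X)\, p^n + \nu$ for all sufficiently large $n$, where $\operatorname{ord}_p$ is the $p$-adic valuation with $\operatorname{ord}_p(p)=1$. *)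

theory Defs
  imports
    "HOL-Analysis.Analysis"
    "HOL-Number_Theory.Cong"
    "HOL-Algebra.Coset"
    "Graph_Theory.Graph_Theory"
begin

text \<open>
  The \<open>p\<close>-adic integers as the inverse limit of the rings \<open>\<int>/p\<^sup>n\<close>: an element is the sequence of
  its least non-negative residues modulo \<open>p\<^sup>0, p\<^sup>1, p\<^sup>2, \<dots>\<close>.  The topology is the one induced by
  the product of the discrete topologies.
\<close>

definition padic_int :: "nat \<Rightarrow> (nat \<Rightarrow> int) monoid" where
  "padic_int p =
    \<lparr>carrier = {x. \<forall>n. x n \<in> {0..<int p ^ n} \<and> x (Suc n) mod int p ^ n = x n},
     mult = (\<lambda>x y n. (x n + y n) mod int p ^ n),
     one = (\<lambda>n. 0)\<rparr>"

definition padic_topology :: "nat \<Rightarrow> (nat \<Rightarrow> int) topology" where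
  "padic_topology p =
    subtopology (product_topology (\<lambda>n. discrete_topology UNIV) UNIV) (carrier (padic_int p))"

text \<open>
  A topological group isomorphic to \<open>\<int>\<^sub>p\<close>.  Continuity of the group operations and profiniteness
  are transported along the isomorphism, so they are not assumed separately.
\<close>

locale Zp_group = group \<Gamma> for p :: nat and \<Gamma> :: "'g monoid" (structure) +
  fixes T :: "'g topology"
  assumes topspace_eq: "topspace T = carrier \<Gamma>"
    and iso_padic: "\<exists>\<phi> \<in> iso \<Gamma> (padic_int p). homeomorphic_map T (padic_topology p) \<phi>"

text \<open>
  Serre's graphs: \<open>tail\<close> and \<open>head\<close> are the maps \<open>s\<close> and \<open>t\<close>, and \<open>bar\<close> is the involution on the
  arcs.  The locale \<^locale>\<open>bidirected_digraph\<close> makes \<open>bar\<close> the identity outside the arcs, which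
  is only a convention for irrelevant values.
\<close>

locale serre_graph = fin_digraph X + bidirected_digraph X bar
  for X :: "('v, 'e) pre_digraph" and bar :: "'e \<Rightarrow> 'e"

abbreviation connected_graph :: "('v, 'e) pre_digraph \<Rightarrow> bool" where
  "connected_graph \<equiv> Digraph_Component.connected"

definition undirected_edges :: "('v, 'e) pre_digraph \<Rightarrow> ('e \<Rightarrow> 'e) \<Rightarrow> 'e set set" where
  "undirected_edges X bar = (\<lambda>e. {e, bar e}) ` arcs X"

text \<open>
  \<^const>\<open>pre_digraph.cycle\<close> concerns directed graphs, so going along an arc and straight back
  counts as a cycle there.  In the undirected multigraph a circuit uses each undirected edge at most
  once; loops and pairs of parallel edges are circuits.
\<close>

definition circuit :: "('v, 'e) pre_digraph \<Rightarrow> ('e \<Rightarrow> 'e) \<Rightarrow> 'e list \<Rightarrow> bool" where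
  "circuit X bar c \<longleftrightarrow> pre_digraph.cycle X c \<and> (\<forall>e \<in> set c. bar e \<notin> set c)"

definition spanning_trees :: "('v, 'e) pre_digraph \<Rightarrow> ('e \<Rightarrow> 'e) \<Rightarrow> 'e set set set" where
  "spanning_trees X bar =
    {S. S \<subseteq> undirected_edges X bar \<and>
        connected_graph (X\<lparr>arcs := \<Union>S\<rparr>) \<and> (\<nexists>c. circuit (X\<lparr>arcs := \<Union>S\<rparr>) bar c)}"

definition kappa :: "('v, 'e) pre_digraph \<Rightarrow> ('e \<Rightarrow> 'e) \<Rightarrow> nat" where
  "kappa X bar = card (spanning_trees X bar)"

definition voltage_assignment ::
  "'g monoid \<Rightarrow> ('v, 'e) pre_digraph \<Rightarrow> ('e \<Rightarrow> 'e) \<Rightarrow> ('e \<Rightarrow> 'g) \<Rightarrow> bool" where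
  "voltage_assignment \<Gamma> X bar \<alpha> \<longleftrightarrow>
    (\<forall>e \<in> arcs X. \<alpha> e \<in> carrier \<Gamma> \<and> \<alpha> (bar e) = inv\<^bsub>\<Gamma>\<^esub> (\<alpha> e))"

definition power_subgroup :: "nat \<Rightarrow> 'g monoid \<Rightarrow> nat \<Rightarrow> 'g set" where
  "power_subgroup p \<Gamma> n = (\<lambda>\<gamma>. \<gamma> [^]\<^bsub>\<Gamma>\<^esub> (p ^ n)) ` carrier \<Gamma>"

definition level_group :: "nat \<Rightarrow> 'g monoid \<Rightarrow> nat \<Rightarrow> 'g set monoid" where
  "level_group p \<Gamma> n = \<Gamma> Mod power_subgroup p \<Gamma> n"

definition level_proj :: "nat \<Rightarrow> 'g monoid \<Rightarrow> nat \<Rightarrow> 'g \<Rightarrow> 'g set" where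
  "level_proj p \<Gamma> n \<gamma> = power_subgroup p \<Gamma> n #>\<^bsub>\<Gamma>\<^esub> \<gamma>"

text \<open>
  The derived graph \<open>X\<^sub>n\<close> and its involution.  All groups are abelian, so the library's right cosets
  \<open>I #> \<gamma>\<close> are the cosets \<open>\<gamma>I\<close>.
\<close>

definition derived_graph ::
  "nat \<Rightarrow> 'g monoid \<Rightarrow> ('v, 'e) pre_digraph \<Rightarrow> ('e \<Rightarrow> 'g) \<Rightarrow> ('v \<Rightarrow> 'g set) \<Rightarrow> nat
    \<Rightarrow> ('g set set \<times> 'v, 'g set \<times> 'e) pre_digraph" where
  "derived_graph p \<Gamma> X \<alpha> I n =
    (let \<Gamma>n = level_group p \<Gamma> n;
         In = (\<lambda>v. level_proj p \<Gamma> n ` I v)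
     in \<lparr>verts = {(A, v). v \<in> verts X \<and> A \<in> carrier (\<Gamma>n Mod In v)},
         arcs = carrier \<Gamma>n \<times> arcs X,
         tail = (\<lambda>(\<gamma>, e). (In (tail X e) #>\<^bsub>\<Gamma>n\<^esub> \<gamma>, tail X e)),
         head = (\<lambda>(\<gamma>, e). (In (head X e) #>\<^bsub>\<Gamma>n\<^esub> (\<gamma> \<otimes>\<^bsub>\<Gamma>n\<^esub> level_proj p \<Gamma> n (\<alpha> e)), head X e))\<rparr>)"

definition derived_bar ::
  "nat \<Rightarrow> 'g monoid \<Rightarrow> ('v, 'e) pre_digraph \<Rightarrow> ('e \<Rightarrow> 'e) \<Rightarrow> ('e \<Rightarrow> 'g) \<Rightarrow> nat
    \<Rightarrow> 'g set \<times> 'e \<Rightarrow> 'g set \<times> 'e" where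
  "derived_bar p \<Gamma> X bar \<alpha> n =
    (\<lambda>(\<gamma>, e). if \<gamma> \<in> carrier (level_group p \<Gamma> n) \<and> e \<in> arcs X
      then (\<gamma> \<otimes>\<^bsub>level_group p \<Gamma> n\<^esub> level_proj p \<Gamma> n (\<alpha> e), bar e) else (\<gamma>, e))"

definition iwasawa_invariants :: "nat \<Rightarrow> (nat \<Rightarrow> nat) \<Rightarrow> nat \<Rightarrow> nat \<Rightarrow> int \<Rightarrow> bool" where
  "iwasawa_invariants p k l m \<nu> \<longleftrightarrow>
    (\<forall>\<^sub>F n in sequentially. int (multiplicity p (k n)) = int l * int n + int m * int p ^ n + \<nu>)"

text \<open>
  When all \<open>X\<^sub>n\<close> are connected, the three invariants exist and are unique, so the description below
  picks out a definite number; outside that situation it has no meaning.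
\<close>

definition iwasawa_lambda ::
  "nat \<Rightarrow> 'g monoid \<Rightarrow> ('v, 'e) pre_digraph \<Rightarrow> ('e \<Rightarrow> 'e) \<Rightarrow> ('e \<Rightarrow> 'g) \<Rightarrow> ('v \<Rightarrow> 'g set) \<Rightarrow> nat" where
  "iwasawa_lambda p \<Gamma> X bar \<alpha> I =
    (THE l. \<exists>m \<nu>. iwasawa_invariants p
       (\<lambda>n. kappa (derived_graph p \<Gamma> X \<alpha> I n) (derived_bar p \<Gamma> X bar \<alpha> n)) l m \<nu>)"

definition trivial_verts :: "'g monoid \<Rightarrow> ('v, 'e) pre_digraph \<Rightarrow> ('v \<Rightarrow> 'g set) \<Rightarrow> 'v set" where
  "trivial_verts \<Gamma> X I = {v \<in> verts X. I v = {\<one>\<^bsub>\<Gamma>\<^esub>}}"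

end

theory Submission
  imports Defs "Jordan_Normal_Form.Char_Poly" "HOL-Number_Theory.Residues"
begin

text \<open>
  The matrix-tree theorem expresses \<open>\<kappa>\<close> of \<open>X\<^sub>n\<close> as a determinant of the Laplacian, an operator on the
  functions on the vertices of \<open>X\<^sub>n\<close> that commutes with \<open>\<Gamma>\<^sub>n\<close>.  Passing from level \<open>n\<close> to level
  \<open>n + 1\<close>, the functions pulled back from \<open>X\<^sub>n\<close> form an invariant subspace, and the quotient splits
  according to the characters of exact order \<open>p\<^bsup>n+1\<^esup>\<close>.  For large \<open>n\<close> the vertices above a ramified
  vertex \<open>v\<close> no longer change: there are \<open>[\<Gamma> : I\<^sub>v]\<close> of them at every level, and \<open>p\<close> times as many arcs
  leave each of them at level \<open>n + 1\<close> as at level \<open>n\<close>.  Hence, with \<open>R = \<Sum> [\<Gamma> : I\<^sub>v]\<close> over the ramified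
  vertices,

    \<open>p \<kappa>(X\<^bsub>n+1\<^esub>) = p\<^sup>R \<kappa>(X\<^sub>n) \<Prod>\<^bsub>\<zeta>\<^esub> f(\<zeta>)\<close>,

  where \<open>\<zeta>\<close> runs over the primitive \<open>p\<^bsup>n+1\<^esup>\<close>-th roots of unity and \<open>f(\<zeta>)\<close> is the determinant of the
  Laplacian of \<open>X\<close> twisted by \<open>\<zeta>\<close> and restricted to the unramified vertices (\<open>det_level_step\<close>,
  \<open>kappa_step\<close>).  The product has valuation \<open>\<mu> (p\<^bsup>n+1\<^esup> - p\<^sup>n) + l\<close> with \<open>l\<close> the \<open>\<lambda>\<close>-invariant of \<open>f\<close>, so
  summing over \<open>n\<close> gives \<open>\<lambda> = R - 1 + l\<close>, and the claim is that \<open>l\<close> is even.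

  Replacing a character by its inverse transposes the twisted Laplacian, because the involution
  inverts the voltages; so \<open>f(1/\<zeta>) = f(\<zeta>)\<close>.  An element of the Iwasawa algebra with this symmetry is
  a power series in \<open>\<zeta> + 1/\<zeta> - 2 = (\<zeta> - 1)\<^sup>2/\<zeta>\<close>.  The number \<open>l\<close> is the order of vanishing of
  \<open>f / p\<^sup>\<mu>\<close> modulo \<open>p\<close> at \<open>\<zeta> = 1\<close>, and each factor \<open>(\<zeta> - 1)\<^sup>2/\<zeta>\<close> adds two to it.  The argument is the
  same for \<open>p = 2\<close>, where comparing leading coefficients of \<open>f(1/\<zeta>)\<close> and \<open>f(\<zeta>)\<close> modulo \<open>p\<close> would say
  nothing.

  The Iwasawa algebra is the inverse limit of the rings \<open>\<int>\<^sub>p[x] / (x\<^bsup>p^m\<^esup> - 1)\<close>, and \<open>f\<close> is given by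
  integer polynomials \<open>f\<^sub>m\<close>, one for each level, that take the same values at the \<open>p\<^sup>m\<close>-th roots of unity
  as \<open>f\<^bsub>m+1\<^esub>\<close>.  The invariants \<open>\<mu>\<close> and \<open>l\<close> can be read off at one sufficiently high level
  (\<open>coherent_symmetric_family\<close>).  The valuation of the product of \<open>f\<close> over primitive roots of unity is
  found without leaving \<open>\<int>\<close> and \<open>\<complex>\<close>: the product of an integer polynomial over all \<open>p\<^sup>m\<close>-th roots of
  unity is the determinant of an integer circulant matrix, and it is prime to \<open>p\<close> if the value of the
  polynomial at \<open>1\<close> is (\<open>prime_not_dvd_circulant_det\<close>, \<open>prod_primitive_roots_valuation\<close>).
\<close>

section \<open>Determinants over finite index sets\<close>

text \<open>
  Laplacians at all levels of a tower are compared inside one statement, so matrices are indexed by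
  finite sets of arbitrary type and not by a fixed index type.
\<close>

definition det_on :: "'a set \<Rightarrow> ('a \<Rightarrow> 'a \<Rightarrow> 'b) \<Rightarrow> 'b :: comm_ring_1" where
  "det_on S M = (\<Sum>\<pi> | \<pi> permutes S. of_int (sign \<pi>) * (\<Prod>i\<in>S. M i (\<pi> i)))"

lemma det_on_cong:
  assumes "\<And>i j. i \<in> S \<Longrightarrow> j \<in> S \<Longrightarrow> M i j = N i j"
  shows "det_on S M = det_on S N"
  unfolding det_on_def using assms
  by (intro sum.cong refl arg_cong2[of _ _ _ _ "(*)"] prod.cong) (auto simp: permutes_in_image)

lemma det_on_reindex:
  assumes "finite S" "bij_betw f S S'"
  shows "det_on S' M = det_on S (\<lambda>i j. M (f i) (f j))"
proof -
  have inj: "inj_on f S" and im: "f ` S = S'"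
    using assms(2) by (auto simp: bij_betw_def)
  define g where "g = inv_into S f"
  have gf: "g (f x) = x" if "x \<in> S" for x
    using that inj by (simp add: g_def)
  have fg: "f (g y) = y" if "y \<in> S'" for y
    using that im by (auto simp: g_def f_inv_into_f)
  have g: "bij_betw g S' S"
    unfolding g_def using assms(2) by (rule bij_betw_inv_into)
  show ?thesis unfolding det_on_def
  proof (rule sum.reindex_bij_witness[of _ "map_permutation S f" "map_permutation S' g"])
    fix \<pi> assume "\<pi> \<in> {\<pi>. \<pi> permutes S'}"
    then have \<pi>: "\<pi> permutes S'" by simp
    show "map_permutation S f (map_permutation S' g \<pi>) = \<pi>"
      by (rule map_permutation_compose_inv[OF g \<pi> fg])
    show "map_permutation S' g \<pi> \<in> {\<pi>. \<pi> permutes S}"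
      using map_permutation_permutes[OF g \<pi>] by simp
    have fin': "finite S'" using assms im by auto
    have injg: "inj_on g S'" using g by (auto simp: bij_betw_def)
    have "(\<Prod>i\<in>S. M (f i) (f (map_permutation S' g \<pi> i))) = (\<Prod>i\<in>S'. M i (\<pi> i))"
    proof (rule prod.reindex_bij_witness[of _ g f])
      fix i assume i: "i \<in> S"
      then have fi: "f i \<in> S'" using im by auto
      have "map_permutation S' g \<pi> i = g (\<pi> (f i))"
        using map_permutation_apply[OF injg fi, of \<pi>] gf[OF i] by simp
      then show "M (f i) (\<pi> (f i)) = M (f i) (f (map_permutation S' g \<pi> i))"
        using fi \<pi> by (simp add: fg permutes_in_image)
    qed (use im gf fg g in \<open>auto simp: bij_betw_def\<close>)
    then show "of_int (sign (map_permutation S' g \<pi>)) * (\<Prod>i\<in>S. M (f i) (f (map_permutation S' g \<pi> i)))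
      = of_int (sign \<pi>) * (\<Prod>i\<in>S'. M i (\<pi> i))"
      by (simp add: sign_map_permutation[OF injg \<pi> fin'])
  next
    fix \<pi> assume "\<pi> \<in> {\<pi>. \<pi> permutes S}"
    then have \<pi>: "\<pi> permutes S" by simp
    show "map_permutation S' g (map_permutation S f \<pi>) = \<pi>"
      by (rule map_permutation_compose_inv[OF assms(2) \<pi> gf])
    show "map_permutation S f \<pi> \<in> {\<pi>. \<pi> permutes S'}"
      using map_permutation_permutes[OF assms(2) \<pi>] by simp
  qed
qed

lemma det_on_eq_det:
  assumes "bij_betw f {0..<n} S"
  shows "det_on S M = Determinant.det (mat n n (\<lambda>(i, j). M (f i) (f j)))"
proof -
  have "det_on S M = det_on {0..<n} (\<lambda>i j. M (f i) (f j))"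
    using assms by (intro det_on_reindex) auto
  also have "\<dots> = Determinant.det (mat n n (\<lambda>(i, j). M (f i) (f j)))"
    unfolding det_on_def Determinant.det_def
    by (auto intro!: sum.cong prod.cong arg_cong2[of _ _ _ _ "(*)"] simp: sign_def
      dest: permutes_in_image)
  finally show ?thesis .
qed

lemma det_on_mult:
  assumes "finite S"
  shows "det_on S (\<lambda>i j. \<Sum>k\<in>S. A i k * B k j) = det_on S A * det_on S B"
proof -
  obtain n and f :: "nat \<Rightarrow> 'a" where f: "bij_betw f {0..<n} S"
    using ex_bij_betw_nat_finite[OF assms] by blast
  have "mat n n (\<lambda>(i, j). \<Sum>k\<in>S. A (f i) k * B k (f j)) =
        mat n n (\<lambda>(i, j). A (f i) (f j)) * mat n n (\<lambda>(i, j). B (f i) (f j))"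
    by (rule eq_matI) (auto simp: scalar_prod_def sum.reindex_bij_betw[OF f, symmetric])
  then show ?thesis
    by (simp add: det_on_eq_det[OF f] det_mult[of _ n])
qed

lemma det_on_transpose:
  assumes "finite S"
  shows "det_on S (\<lambda>i j. M j i) = det_on S M"
proof -
  obtain n and f :: "nat \<Rightarrow> 'a" where f: "bij_betw f {0..<n} S"
    using ex_bij_betw_nat_finite[OF assms] by blast
  have "mat n n (\<lambda>(i, j). M (f j) (f i)) = transpose_mat (mat n n (\<lambda>(i, j). M (f i) (f j)))"
    by (rule eq_matI) auto
  then show ?thesis
    by (simp add: det_on_eq_det[OF f] det_transpose[of _ n])
qed

lemma det_on_block:
  fixes M :: "'a \<Rightarrow> 'a \<Rightarrow> 'b::idom"
  assumes fin: "finite A" "finite B" and disj: "A \<inter> B = {}"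
    and zero: "\<And>i j. i \<in> B \<Longrightarrow> j \<in> A \<Longrightarrow> M i j = 0"
  shows "det_on (A \<union> B) M = det_on A M * det_on B M"
proof -
  obtain m and f :: "nat \<Rightarrow> 'a" where f: "bij_betw f {0..<m} A"
    using ex_bij_betw_nat_finite[OF fin(1)] by blast
  obtain n and g :: "nat \<Rightarrow> 'a" where g: "bij_betw g {0..<n} B"
    using ex_bij_betw_nat_finite[OF fin(2)] by blast
  define h where "h i = (if i < m then f i else g (i - m))" for i
  have hA: "bij_betw h {0..<m} A"
    by (rule bij_betw_cong[THEN iffD1, OF _ f]) (auto simp: h_def)
  have "bij_betw (\<lambda>i. i - m) {m..<m+n} {0..<n}"
    by (rule bij_betwI[where g = "\<lambda>i. i + m"]) auto
  then have "bij_betw (g \<circ> (\<lambda>i. i - m)) {m..<m+n} B"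
    using g by (rule bij_betw_trans)
  then have hB: "bij_betw h {m..<m+n} B"
    by (rule bij_betw_cong[THEN iffD1, rotated]) (auto simp: h_def)
  have h: "bij_betw h {0..<m+n} (A \<union> B)"
    using bij_betw_combine[OF hA hB disj] by (simp add: ivl_disj_un_two)
  let ?A1 = "mat m m (\<lambda>(i, j). M (f i) (f j))"
  let ?A2 = "mat m n (\<lambda>(i, j). M (f i) (g j))"
  let ?A4 = "mat n n (\<lambda>(i, j). M (g i) (g j))"
  have "mat (m+n) (m+n) (\<lambda>(i, j). M (h i) (h j)) = four_block_mat ?A1 ?A2 (0\<^sub>m n m) ?A4"
    by (rule eq_matI) (use f g zero in \<open>auto simp: h_def bij_betw_def\<close>)
  then show ?thesis
    unfolding det_on_eq_det[OF h] det_on_eq_det[OF f] det_on_eq_det[OF g]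
    by (simp add: det_four_block_mat_lower_left_zero[of _ m _ n])
qed

lemma det_on_identity:
  assumes "finite S"
  shows "det_on S (\<lambda>i j. if i = j then 1 else 0) = 1"
proof -
  obtain n and f :: "nat \<Rightarrow> 'a" where f: "bij_betw f {0..<n} S"
    using ex_bij_betw_nat_finite[OF assms] by blast
  have "mat n n (\<lambda>(i, j). if f i = f j then 1 else 0) = 1\<^sub>m n"
    by (rule eq_matI) (use f in \<open>auto simp: bij_betw_def inj_on_def\<close>)
  then show ?thesis
    unfolding det_on_eq_det[OF f] by (metis det_one)
qed

lemma det_on_singleton [simp]: "det_on {x} M = M x x"
  by (simp add: det_on_def)

lemma det_on_empty [simp]: "det_on {} M = 1"
  by (simp add: det_on_def)

lemma det_on_scale_rows:
  "det_on S (\<lambda>i j. c i * M i j) = (\<Prod>i\<in>S. c i) * det_on S M"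
  unfolding det_on_def by (simp add: prod.distrib sum_distrib_left mult_ac)

lemma det_on_zero_column:
  assumes "finite S" "z \<in> S" "\<And>i. i \<in> S \<Longrightarrow> M i z = 0"
  shows "det_on S M = 0"
  unfolding det_on_def
proof (intro sum.neutral ballI)
  fix \<pi> assume "\<pi> \<in> {\<pi>. \<pi> permutes S}"
  then have \<pi>: "\<pi> permutes S" by simp
  then obtain i where "i \<in> S" "\<pi> i = z"
    using assms(2) by (metis permutes_image imageE)
  then have "(\<Prod>i\<in>S. M i (\<pi> i)) = 0"
    using assms by (intro prod_zero) auto
  then show "of_int (sign \<pi>) * (\<Prod>i\<in>S. M i (\<pi> i)) = 0" by simp
qed

lemma det_on_replace_column_identity:
  fixes x :: "'a \<Rightarrow> 'b::idom"
  assumes "finite S" "z \<in> S"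
  shows "det_on S (\<lambda>i j. if j = z then x i else if i = j then 1 else 0) = x z"
proof -
  have "det_on ((S - {z}) \<union> {z}) (\<lambda>i j. if j = z then x i else if i = j then 1 else 0)
     = det_on (S - {z}) (\<lambda>i j. if j = z then x i else if i = j then 1 else 0) * x z"
    using assms by (subst det_on_block) auto
  also have "det_on (S - {z}) (\<lambda>i j. if j = z then x i else if i = j then 1 else 0) = 1"
    using det_on_identity[of "S - {z}"] assms
    by (subst det_on_cong[where N = "\<lambda>i j. if i = j then 1 else 0"]) auto
  finally show ?thesis using assms by (simp add: insert_absorb)
qed

text \<open>
  Replacing the column \<open>z\<close> of the identity matrix by \<open>x\<close> gives a matrix of determinant \<open>x z\<close>, and
  multiplying \<open>M\<close> by it turns the column \<open>z\<close> of \<open>M\<close> into zero.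
\<close>

lemma det_on_kernel:
  fixes M :: "'a \<Rightarrow> 'a \<Rightarrow> 'b::idom"
  assumes "finite S" "z \<in> S" "x z \<noteq> 0" "\<And>i. i \<in> S \<Longrightarrow> (\<Sum>j\<in>S. M i j * x j) = 0"
  shows "det_on S M = 0"
proof -
  let ?E = "\<lambda>i j. if j = z then x i else if i = j then 1 else (0::'b)"
  have "det_on S M * det_on S ?E = det_on S (\<lambda>i j. \<Sum>k\<in>S. M i k * ?E k j)"
    by (rule det_on_mult[symmetric]) fact
  also have "\<dots> = 0"
    by (rule det_on_zero_column[OF assms(1,2)]) (use assms(4) in simp)
  finally show ?thesis
    using assms by (simp add: det_on_replace_column_identity)
qed

lemma det_on_add_rows:
  fixes M :: "'a \<Rightarrow> 'a \<Rightarrow> 'b::idom"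
  assumes "finite S" "r \<in> S"
  shows "det_on S (\<lambda>i j. if i = r then (\<Sum>k\<in>S. M k j) else M i j) = det_on S M"
proof -
  let ?E = "\<lambda>i j. if i = r then 1 else if j = i then 1 else (0::'b)"
  have "det_on S ?E * det_on S M = det_on S (\<lambda>i j. \<Sum>k\<in>S. ?E i k * M k j)"
    by (rule det_on_mult[symmetric]) fact
  also have "\<dots> = det_on S (\<lambda>i j. if i = r then (\<Sum>k\<in>S. M k j) else M i j)"
    using assms by (intro det_on_cong) (auto simp: if_distrib[of "\<lambda>x. x * _"] cong: if_cong)
  also have "det_on S ?E = 1"
    by (rule trans[OF det_on_transpose[OF assms(1), symmetric]
          det_on_replace_column_identity[OF assms, of "\<lambda>_. 1"]])
  finally show ?thesis by simp
qed

lemma det_on_of_int: "of_int (det_on S M) = det_on S (\<lambda>i j. of_int (M i j))"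
  by (simp add: det_on_def)

lemma det_on_mod_cong:
  fixes M :: "'a \<Rightarrow> 'a \<Rightarrow> int"
  assumes "\<And>i j. i \<in> S \<Longrightarrow> j \<in> S \<Longrightarrow> [M i j = N i j] (mod q)"
  shows "[det_on S M = det_on S N] (mod q)"
  unfolding det_on_def
  by (intro cong_sum cong_mult cong_refl cong_prod) (use assms in \<open>auto simp: permutes_in_image\<close>)

text \<open>
  The columns of \<open>K\<close> are a basis in which the operator \<open>M\<close> has the matrix \<open>D\<close>.  The index sets may
  have different types, which allows a basis of characters or of mixed origin to be indexed by what its
  members are.
\<close>

lemma det_on_intertwine:
  fixes K :: "'a \<Rightarrow> 'c \<Rightarrow> 'b::idom"
  assumes fin: "finite I" "finite J" and card: "card I = card J"
    and left_inverse: "\<And>i j. i \<in> J \<Longrightarrow> j \<in> J \<Longrightarrow> (\<Sum>k\<in>I. K' i k * K k j) = (if i = j then 1 else 0)"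
    and intertwine: "\<And>i j. i \<in> I \<Longrightarrow> j \<in> J \<Longrightarrow> (\<Sum>k\<in>I. M i k * K k j) = (\<Sum>k\<in>J. K i k * D k j)"
  shows "det_on I M = det_on J D"
proof -
  obtain g where g: "bij_betw g J I"
    using finite_same_card_bij[OF fin(2,1)] card by metis
  note sumI = sum.reindex_bij_betw[OF g, symmetric]
  have gI: "g i \<in> I" if "i \<in> J" for i using g that by (auto simp: bij_betw_def)
  let ?K = "\<lambda>i j. K (g i) j" and ?M = "\<lambda>i j. M (g i) (g j)" and ?K' = "\<lambda>i j. K' i (g j)"
  have 1: "det_on J ?K' * det_on J ?K = 1"
  proof -
    have "det_on J (\<lambda>i j. \<Sum>k\<in>J. ?K' i k * ?K k j) = det_on J (\<lambda>i j. if i = j then 1 else 0)"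
      using left_inverse by (intro det_on_cong) (simp add: sumI)
    then show ?thesis
      by (simp add: det_on_mult[OF fin(2)] det_on_identity[OF fin(2)])
  qed
  have "det_on J ?M * det_on J ?K = det_on J ?K * det_on J D"
    unfolding det_on_mult[OF fin(2), symmetric]
    using intertwine gI by (intro det_on_cong) (simp add: sumI)
  then have "det_on J ?M = det_on J D"
    using 1 by (auto simp: mult.commute)
  then show ?thesis
    by (simp add: det_on_reindex[OF fin(2) g])
qed

lemma det_on_block_diagonal:
  fixes M :: "'z \<Rightarrow> 'a \<Rightarrow> 'a \<Rightarrow> 'b::idom"
  assumes "finite Z" "finite U"
  shows "det_on (Z \<times> U) (\<lambda>x y. if fst x = fst y then M (fst x) (snd x) (snd y) else 0)
       = (\<Prod>\<zeta>\<in>Z. det_on U (M \<zeta>))"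
  using assms(1)
proof (induction Z rule: finite_induct)
  case (insert z Z)
  let ?D = "\<lambda>x y. if fst x = fst y then M (fst x) (snd x) (snd y) else 0"
  have "insert z Z \<times> U = {z} \<times> U \<union> Z \<times> U" by auto
  moreover have "det_on ({z} \<times> U \<union> Z \<times> U) ?D = det_on ({z} \<times> U) ?D * det_on (Z \<times> U) ?D"
    using insert assms(2) by (intro det_on_block) auto
  moreover have "det_on ({z} \<times> U) ?D = det_on U (M z)"
    using assms(2) by (subst det_on_reindex[of U "\<lambda>u. (z, u)"]) (auto simp: bij_betw_def inj_on_def)
  ultimately show ?case using insert by simp
qed simp

section \<open>The matrix-tree theorem\<close>

lemma finite_has_greatest:
  fixes f :: "'a \<Rightarrow> nat"
  assumes "finite A" "A \<noteq> {}"
  obtains a where "a \<in> A" "\<And>b. b \<in> A \<Longrightarrow> f b \<le> f a"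
proof -
  have "Max (f ` A) \<in> f ` A" using assms by (intro Max_in) auto
  then obtain a where a: "a \<in> A" "Max (f ` A) = f a" by auto
  have "f b \<le> f a" if "b \<in> A" for b
    using that assms(1) Max_ge[of "f ` A" "f b"] a(2) by auto
  with a(1) show thesis by (rule that)
qed

lemma funpow_reach_step:
  assumes "x \<noteq> r" and ex: "\<exists>k. (h ^^ k) x = r"
  shows "(LEAST k. (h ^^ k) (h x) = r) < (LEAST k. (h ^^ k) x = r)"
proof -
  let ?d = "LEAST k. (h ^^ k) x = r"
  have d: "(h ^^ ?d) x = r" using ex by (rule LeastI_ex)
  then obtain k where k: "?d = Suc k" using assms(1) by (cases ?d) auto
  have "(h ^^ k) (h x) = r" using d unfolding k by (simp add: funpow_swap1)
  then have "(LEAST k. (h ^^ k) (h x) = r) \<le> k" by (rule Least_le)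
  then show ?thesis using k by simp
qed

text \<open>
  A permutation contributes to the determinant only if it sends each point \<open>x\<close> that it moves to \<open>h x\<close>.
  If all points reach \<open>r\<close>, then \<open>h\<close> decreases the number of steps to \<open>r\<close>, so a moved point for which
  this number is minimal would be sent to a moved point with a smaller number; only the identity
  remains.  Otherwise the indicator function of the points that never reach \<open>r\<close> lies in the kernel.
\<close>

lemma det_on_functional_graph:
  fixes h :: "'a \<Rightarrow> 'a"
  assumes fin: "finite S" and r: "r \<notin> S" "h r = r" and h: "\<And>x. x \<in> S \<Longrightarrow> h x \<in> insert r S"
  shows "det_on S (\<lambda>x y. of_bool (x = y) - of_bool (h x = y)) =
         (of_bool (\<forall>x\<in>S. \<exists>k. (h ^^ k) x = r) :: int)"
proof (cases "\<forall>x\<in>S. \<exists>k. (h ^^ k) x = r")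
  case True
  define d where "d x = (LEAST k. (h ^^ k) x = r)" for x
  have d: "d (h x) < d x" if "x \<in> S" for x
    unfolding d_def using True that r by (intro funpow_reach_step) auto
  have "det_on S (\<lambda>x y. of_bool (x = y) - of_bool (h x = y)) =
    (\<Sum>\<pi> | \<pi> permutes S. if \<pi> = id then 1 else (0::int))"
    unfolding det_on_def
  proof (intro sum.cong refl)
    fix \<pi> assume "\<pi> \<in> {\<pi>. \<pi> permutes S}"
    then have \<pi>: "\<pi> permutes S" by simp
    show "of_int (sign \<pi>) * (\<Prod>i\<in>S. of_bool (i = \<pi> i) - of_bool (h i = \<pi> i)) =
      (if \<pi> = id then 1 else (0::int))"
    proof (cases "\<pi> = id")
      case True
      have "(\<Prod>i\<in>S. of_bool (i = \<pi> i) - of_bool (h i = \<pi> i)) = (1::int)"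
        using d True by (intro prod.neutral) force
      then show ?thesis using True by (simp add: sign_id)
    next
      case False
      define B where "B = {i \<in> S. \<pi> i \<noteq> i}"
      have "B \<noteq> {}" "finite B"
        using False \<pi> fin by (auto simp: B_def permutes_def fun_eq_iff)
      then obtain i where i: "i \<in> B" "\<And>j. j \<in> B \<Longrightarrow> d i \<le> d j"
        using arg_min_if_finite(1)[of B d] arg_min_least[of B _ d] by metis
      have "\<pi> i \<in> B"
        using i(1) \<pi> by (auto simp: B_def permutes_in_image dest: permutes_inj[THEN injD])
      then have "\<not> d (\<pi> i) < d i" using i(2) by (simp add: not_less)
      then have "h i \<noteq> \<pi> i" using d[of i] i(1) by (metis B_def mem_Collect_eq)
      then have "(\<Prod>i\<in>S. of_bool (i = \<pi> i) - of_bool (h i = \<pi> i)) = (0::int)"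
        using i(1) fin by (intro prod_zero bexI[of _ i]) (auto simp: B_def)
      then show ?thesis using False by simp
    qed
  qed
  also have "\<dots> = 1"
    using fin by (simp add: sum.delta finite_permutations permutes_id)
  finally show ?thesis using True by simp
next
  case False
  then obtain z where z: "z \<in> S" "\<not> (\<exists>k. (h ^^ k) z = r)" by auto
  define x where "x v = (of_bool (\<not> (\<exists>k. (h ^^ k) v = r)) :: int)" for v
  have xr: "x r = 0" by (auto simp: x_def intro: exI[of _ 0])
  have xh: "x (h v) = x v" for v
  proof -
    have "(\<exists>k. (h ^^ k) (h v) = r) \<longleftrightarrow> (\<exists>k. (h ^^ k) v = r)"
    proof
      assume "\<exists>k. (h ^^ k) (h v) = r"
      then obtain k where "(h ^^ k) (h v) = r" by blast
      then have "(h ^^ Suc k) v = r" by (simp add: funpow_swap1)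
      then show "\<exists>k. (h ^^ k) v = r" by blast
    next
      assume "\<exists>k. (h ^^ k) v = r"
      then obtain k where "(h ^^ k) v = r" by blast
      then have "(h ^^ k) (h v) = r" using r(2) by (simp add: funpow_swap1[symmetric])
      then show "\<exists>k. (h ^^ k) (h v) = r" by blast
    qed
    then show ?thesis by (simp add: x_def)
  qed
  have "det_on S (\<lambda>x y. of_bool (x = y) - of_bool (h x = y)) = (0::int)"
  proof (rule det_on_kernel[OF fin z(1)])
    show "x z \<noteq> 0" using z(2) by (simp add: x_def)
    fix i assume i: "i \<in> S"
    have "(\<Sum>j\<in>S. (of_bool (i = j) - of_bool (h i = j)) * x j) =
      (\<Sum>j\<in>S. if j = i then x j else 0) - (\<Sum>j\<in>S. if j = h i then x j else 0)"
      unfolding sum_subtractf[symmetric] by (intro sum.cong) auto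
    also have "\<dots> = 0"
      using h[OF i] i fin xr xh r(1) by (auto simp: sum.delta)
    finally show "(\<Sum>j\<in>S. (of_bool (i = j) - of_bool (h i = j)) * x j) = 0" .
  qed
  then show ?thesis using False by simp
qed

definition laplacian :: "('v, 'e) pre_digraph \<Rightarrow> 'v \<Rightarrow> 'v \<Rightarrow> int" where
  "laplacian G x y = (\<Sum>e\<in>out_arcs G x. of_bool (x = y) - of_bool (head G e = y))"

definition follow :: "('v, 'e) pre_digraph \<Rightarrow> 'v \<Rightarrow> ('v \<Rightarrow> 'e) \<Rightarrow> 'v \<Rightarrow> 'v" where
  "follow G r F v = (if v = r then r else head G (F v))"

text \<open>
  Spanning trees oriented towards the root \<open>r\<close>, each encoded by the function that assigns to a vertex
  other than \<open>r\<close> the first arc on its path to \<open>r\<close>.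
\<close>

definition arborescences :: "('v, 'e) pre_digraph \<Rightarrow> 'v \<Rightarrow> ('v \<Rightarrow> 'e) set" where
  "arborescences G r = {F \<in> (\<Pi>\<^sub>E v\<in>verts G - {r}. out_arcs G v).
     \<forall>v\<in>verts G. \<exists>k. (follow G r F ^^ k) v = r}"

definition height :: "('v, 'e) pre_digraph \<Rightarrow> 'v \<Rightarrow> ('v \<Rightarrow> 'e) \<Rightarrow> 'v \<Rightarrow> nat" where
  "height G r F v = (LEAST k. (follow G r F ^^ k) v = r)"

text \<open>
  Each row of the Laplacian is a sum over the arcs that leave a vertex.  Expanding all rows
  multilinearly gives a sum over the choices of one leaving arc at every vertex other than \<open>r\<close>, in
  which the choices that lead every vertex to \<open>r\<close> contribute \<open>1\<close> and the others \<open>0\<close>.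
\<close>

lemma (in fin_digraph) det_reduced_laplacian:
  assumes r: "r \<in> verts G"
  shows "det_on (verts G - {r}) (laplacian G) = int (card (arborescences G r))"
proof -
  let ?S = "verts G - {r}"
  let ?P = "\<Pi>\<^sub>E v\<in>?S. out_arcs G v"
  have fin: "finite (out_arcs G v)" for v by (rule finite_out_arcs)
  have finP: "finite ?P" using fin by (intro finite_PiE) auto
  have "det_on ?S (laplacian G) = (\<Sum>\<pi> | \<pi> permutes ?S. of_int (sign \<pi>) *
     (\<Sum>F\<in>?P. \<Prod>i\<in>?S. of_bool (i = \<pi> i) - of_bool (head G (F i) = \<pi> i)))"
    unfolding det_on_def laplacian_def using fin by (subst prod_sum_PiE) auto
  also have "\<dots> = (\<Sum>F\<in>?P. det_on ?S (\<lambda>x y. of_bool (x = y) - of_bool (head G (F x) = y)))"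
    unfolding det_on_def sum_distrib_left by (rule sum.swap)
  also have "\<dots> = (\<Sum>F\<in>?P. of_bool (\<forall>v\<in>verts G. \<exists>k. (follow G r F ^^ k) v = r))"
  proof (intro sum.cong refl)
    fix F assume F: "F \<in> ?P"
    have "det_on ?S (\<lambda>x y. of_bool (x = y) - of_bool (head G (F x) = y)) =
      det_on ?S (\<lambda>x y. of_bool (x = y) - of_bool (follow G r F x = y))"
      by (intro det_on_cong) (auto simp: follow_def)
    also have "\<dots> = (of_bool (\<forall>v\<in>?S. \<exists>k. (follow G r F ^^ k) v = r) :: int)"
      using F by (intro det_on_functional_graph) (fastforce simp: follow_def PiE_def Pi_def)+
    also have "(\<forall>v\<in>?S. \<exists>k. (follow G r F ^^ k) v = r) \<longleftrightarrow> (\<forall>v\<in>verts G. \<exists>k. (follow G r F ^^ k) v = r)"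
      by (metis DiffI funpow_0 singletonD DiffD1)
    finally show "det_on ?S (\<lambda>x y. of_bool (x = y) - of_bool (head G (F x) = y)) =
      (of_bool (\<forall>v\<in>verts G. \<exists>k. (follow G r F ^^ k) v = r) :: int)" .
  qed
  also have "\<dots> = int (card (arborescences G r))"
    using finP unfolding arborescences_def
    by (simp add: of_bool_def sum.If_cases Int_def)
  finally show ?thesis .
qed

lemma arborescence_apply:
  assumes "F \<in> arborescences G r" "v \<in> verts G" "v \<noteq> r"
  shows "F v \<in> arcs G" "tail G (F v) = v" "height G r F (head G (F v)) < height G r F v"
proof -
  show "F v \<in> arcs G" "tail G (F v) = v"
    using assms by (auto simp: arborescences_def PiE_def Pi_def out_arcs_def)
  have "\<exists>k. (follow G r F ^^ k) v = r" using assms by (auto simp: arborescences_def)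
  from funpow_reach_step[OF assms(3) this]
  show "height G r F (head G (F v)) < height G r F v"
    using assms(3) by (simp add: height_def follow_def)
qed

context serre_graph
begin

lemma connected_iff_reach_root:
  assumes A: "A \<subseteq> arcs X" "bar ` A \<subseteq> A" and r: "r \<in> verts X"
  shows "connected_graph (X\<lparr>arcs := A\<rparr>) \<longleftrightarrow>
    (\<forall>v\<in>verts X. (v, r) \<in> {(tail X e, head X e) | e. e \<in> A}\<^sup>*)"
proof -
  let ?R = "{(tail X e, head X e) | e. e \<in> A}"
  let ?M = "with_proj (mk_symmetric (X\<lparr>arcs := A\<rparr>))"
  interpret M: wf_digraph ?M
    using A by unfold_locales (auto simp: mk_symmetric_def)
  have tb: "tail X (bar e) = head X e" "head X (bar e) = tail X e" "bar e \<in> A" if "e \<in> A" for e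
    using A that by auto
  have "parcs (mk_symmetric (X\<lparr>arcs := A\<rparr>)) = ?R"
    unfolding mk_symmetric_def using tb by (auto) metis
  then have ends: "arcs_ends ?M = ?R"
    by (auto simp: arcs_ends_conv)
  have sym: "sym ?R"
    unfolding sym_def using tb by (auto) metis
  have vM: "verts ?M = verts X" by (simp add: mk_symmetric_def)
  have "connected_graph (X\<lparr>arcs := A\<rparr>) \<longleftrightarrow> (\<forall>u\<in>verts X. \<forall>v\<in>verts X. (u, v) \<in> ?R\<^sup>*)"
    unfolding Digraph_Component.connected_def strongly_connected_def M.reachable_conv ends vM
    using r by auto
  also have "\<dots> \<longleftrightarrow> (\<forall>v\<in>verts X. (v, r) \<in> ?R\<^sup>*)"
    using r sym_rtrancl[OF sym] by (meson rtrancl_trans symD)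
  finally show ?thesis .
qed

text \<open>
  Every vertex other than \<open>r\<close> can choose an arc that decreases its distance to \<open>r\<close>.
\<close>

lemma arborescence_within:
  assumes A: "A \<subseteq> arcs X" "bar ` A \<subseteq> A" and r: "r \<in> verts X"
    and conn: "connected_graph (X\<lparr>arcs := A\<rparr>)"
  shows "\<exists>F\<in>arborescences X r. F ` (verts X - {r}) \<subseteq> A"
proof -
  let ?R = "{(tail X e, head X e) | e. e \<in> A}"
  define d where "d v = (LEAST n. (v, r) \<in> ?R ^^ n)" for v
  have reach: "(v, r) \<in> ?R\<^sup>*" if "v \<in> verts X" for v
    using conn connected_iff_reach_root[OF A r] that by blast
  have step: "\<exists>e\<in>A. tail X e = v \<and> d (head X e) < d v" if v: "v \<in> verts X" "v \<noteq> r" for v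
  proof -
    have "\<exists>n. (v, r) \<in> ?R ^^ n" using reach[OF v(1)] by (simp add: rtrancl_power)
    then have dv: "(v, r) \<in> ?R ^^ d v" unfolding d_def by (rule LeastI_ex)
    then obtain k where k: "d v = Suc k" using v(2) by (cases "d v") auto
    obtain w where w: "(v, w) \<in> ?R" "(w, r) \<in> ?R ^^ k"
      using relpow_Suc_D2[OF dv[unfolded k]] by (elim exE conjE)
    from w(2) have "d w \<le> k" unfolding d_def by (rule Least_le)
    moreover obtain e where "e \<in> A" "tail X e = v" "head X e = w" using w(1) by blast
    ultimately show ?thesis using k by (intro bexI[of _ e]) simp_all
  qed
  define F where "F = (\<lambda>v\<in>verts X - {r}. SOME e. e \<in> A \<and> tail X e = v \<and> d (head X e) < d v)"
  have F: "F v \<in> A \<and> tail X (F v) = v \<and> d (head X (F v)) < d v" if v: "v \<in> verts X" "v \<noteq> r" for v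
    using someI_ex[of "\<lambda>e. e \<in> A \<and> tail X e = v \<and> d (head X e) < d v"] step[OF v] v
    by (auto simp: F_def)
  have "\<exists>k. (follow X r F ^^ k) v = r" if "v \<in> verts X" for v
    using that
  proof (induction "d v" arbitrary: v rule: less_induct)
    case less
    show ?case
    proof (cases "v = r")
      case True then show ?thesis by (intro exI[of _ 0]) simp
    next
      case False
      have "head X (F v) \<in> verts X" using F[OF less.prems False] A by auto
      with less.hyps[of "head X (F v)"] F[OF less.prems False]
      obtain k where "(follow X r F ^^ k) (head X (F v)) = r" by auto
      then have "(follow X r F ^^ Suc k) v = r"
        using False by (simp add: funpow_swap1 follow_def)
      then show ?thesis by blast
    qed
  qed
  moreover have "F \<in> (\<Pi>\<^sub>E v\<in>verts X - {r}. out_arcs X v)"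
  proof (rule PiE_I)
    fix v assume "v \<in> verts X - {r}"
    then show "F v \<in> out_arcs X v" using F[of v] A by auto
  qed (auto simp: F_def)
  ultimately have "F \<in> arborescences X r" by (simp add: arborescences_def)
  then show ?thesis using F by blast
qed

definition arborescence_edges :: "'v \<Rightarrow> ('v \<Rightarrow> 'e) \<Rightarrow> 'e set set" where
  "arborescence_edges r F = (\<lambda>v. {F v, bar (F v)}) ` (verts X - {r})"

lemma arborescence_edges_arcs:
  assumes "F \<in> arborescences X r"
  shows "arborescence_edges r F \<subseteq> undirected_edges X bar"
    "\<Union>(arborescence_edges r F) \<subseteq> arcs X"
    "bar ` \<Union>(arborescence_edges r F) \<subseteq> \<Union>(arborescence_edges r F)"
proof -
  have "F v \<in> arcs X \<and> bar (F v) \<in> arcs X" if "v \<in> verts X - {r}" for v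
    using arborescence_apply[OF assms] that by simp
  then show "arborescence_edges r F \<subseteq> undirected_edges X bar"
    "\<Union>(arborescence_edges r F) \<subseteq> arcs X"
    "bar ` \<Union>(arborescence_edges r F) \<subseteq> \<Union>(arborescence_edges r F)"
    by (auto simp: arborescence_edges_def undirected_edges_def)
qed

lemma arborescence_edges_cases:
  assumes "e \<in> \<Union>(arborescence_edges r F)"
  obtains w where "w \<in> verts X" "w \<noteq> r" "e = F w" | w where "w \<in> verts X" "w \<noteq> r" "e = bar (F w)"
  using assms by (auto simp: arborescence_edges_def)

lemma arborescence_connected:
  assumes F: "F \<in> arborescences X r" and r: "r \<in> verts X"
  shows "connected_graph (X\<lparr>arcs := \<Union>(arborescence_edges r F)\<rparr>)"
proof -
  let ?A = "\<Union>(arborescence_edges r F)"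
  let ?R = "{(tail X e, head X e) | e. e \<in> ?A}"
  have "(v, r) \<in> ?R\<^sup>*" if "v \<in> verts X" for v
    using that
  proof (induction "height X r F v" arbitrary: v rule: less_induct)
    case less
    show ?case
    proof (cases "v = r")
      case False
      note a = arborescence_apply[OF F less.prems False]
      have "head X (F v) \<in> verts X" using a by auto
      then have "(head X (F v), r) \<in> ?R\<^sup>*" using less.hyps a by blast
      moreover have "F v \<in> ?A" using less.prems False by (auto simp: arborescence_edges_def)
      then have "(v, head X (F v)) \<in> ?R" using a(2) by force
      ultimately show ?thesis by (rule converse_rtrancl_into_rtrancl[rotated])
    qed simp
  qed
  then show ?thesis
    using connected_iff_reach_root[OF arborescence_edges_arcs(2,3)[OF F] r] by blast
qed

lemma cas_neighbours:
  assumes "pre_digraph.cas G u p v" "e \<in> set p"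
  shows "head G e = v \<or> (\<exists>e'\<in>set p. tail G e' = head G e)"
    and "tail G e = u \<or> (\<exists>e'\<in>set p. head G e' = tail G e)"
  using assms
proof (induction p arbitrary: u)
  case (Cons a p)
  {
    case 1
    then show ?case using Cons.IH(1)[of "head G a"]
      by (cases p) (auto simp: pre_digraph.cas.simps)
  next
    case 2
    then show ?case using Cons.IH(2)[of "head G a"]
      by (auto simp: pre_digraph.cas.simps)
  }
qed auto

text \<open>
  Consider an arc of the circuit whose head \<open>v\<close> is as far from \<open>r\<close> as possible.  Both this arc and the
  next one connect \<open>v\<close> with a vertex of the circuit, and the only arc of the tree at \<open>v\<close> that does not
  lead to a vertex further away is \<open>F v\<close>; so the next arc is the reverse of the first.
\<close>

lemma arborescence_no_circuit:
  assumes F: "F \<in> arborescences X r"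
  shows "\<not> circuit (X\<lparr>arcs := \<Union>(arborescence_edges r F)\<rparr>) bar c"
proof
  let ?A = "\<Union>(arborescence_edges r F)"
  let ?G = "X\<lparr>arcs := ?A\<rparr>"
  assume c: "circuit ?G bar c"
  then obtain u where u: "pre_digraph.awalk ?G u c u" "c \<noteq> []"
    by (auto simp: circuit_def pre_digraph.cycle_def)
  then have cA: "set c \<subseteq> ?A" and cas: "pre_digraph.cas ?G u c u"
    by (auto simp: pre_digraph.awalk_def)
  have hdlast: "\<exists>e'\<in>set c. tail X e' = u" "\<exists>e'\<in>set c. head X e' = u"
  proof -
    show "\<exists>e'\<in>set c. tail X e' = u" using cas u(2)
      by (cases c) (auto simp: pre_digraph.cas.simps)
    have "pre_digraph.cas ?G w p u \<Longrightarrow> p \<noteq> [] \<Longrightarrow> \<exists>e'\<in>set p. head X e' = u" for w p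
      by (induction p arbitrary: w) (auto simp: pre_digraph.cas.simps, metis list.set_cases pre_digraph.cas.simps(1))
    then show "\<exists>e'\<in>set c. head X e' = u" using cas u(2) by blast
  qed
  have nxt: "\<exists>e'\<in>set c. tail X e' = head X e" and prv: "\<exists>e'\<in>set c. head X e' = tail X e"
    if "e \<in> set c" for e
    using cas_neighbours[OF cas that] hdlast by auto
  let ?d = "\<lambda>e. height X r F (head X e)"
  obtain e where e: "e \<in> set c" "\<And>e'. e' \<in> set c \<Longrightarrow> ?d e' \<le> ?d e"
    using finite_has_greatest[of "set c" ?d] u(2) by auto
  have "e \<in> ?A" using e cA by auto
  then show False
  proof (cases rule: arborescence_edges_cases)
    case (1 w)
    obtain e0 where "e0 \<in> set c" "head X e0 = w"
      using prv[OF e(1)] arborescence_apply[OF F 1(1,2)] 1(3) by auto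
    then show False using e(2)[of e0] arborescence_apply[OF F 1(1,2)] 1(3) by auto
  next
    case (2 v)
    note av = arborescence_apply[OF F 2(1,2)]
    have hv: "head X e = v" using 2(3) av by simp
    obtain e' where e': "e' \<in> set c" "tail X e' = v" using nxt[OF e(1)] hv by auto
    have "e' \<in> ?A" using e' cA by auto
    then show False
    proof (cases rule: arborescence_edges_cases)
      case (1 w)
      then have "e' = F v" using arborescence_apply[OF F 1(1,2)] e' by simp
      then have "bar e' \<in> set c" using 2(3) e(1) by simp
      then show False using c e'(1) by (auto simp: circuit_def)
    next
      case (2 w)
      note aw = arborescence_apply[OF F 2(1,2)]
      have "head X e' = w" "head X (F w) = v" using 2(3) aw e'(2) by auto
      then show False using aw(3) e(2)[OF e'(1)] hv by simp
    qed
  qed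
qed

text \<open>
  Among the vertices where two orientations of the same tree differ, take \<open>v\<close> with maximal height for
  \<open>F\<close>.  Then \<open>F' v\<close> is the reverse of some \<open>F w\<close> with \<open>w\<close> higher than \<open>v\<close>, where \<open>F\<close> and \<open>F'\<close> agree;
  so \<open>F'\<close> runs back and forth between \<open>v\<close> and \<open>w\<close> and never reaches the root.
\<close>

lemma inj_on_arborescence_edges: "inj_on (arborescence_edges r) (arborescences X r)"
proof (rule inj_onI, rule ccontr)
  fix F F' assume F: "F \<in> arborescences X r" and F': "F' \<in> arborescences X r"
    and eq: "arborescence_edges r F = arborescence_edges r F'" and ne: "F \<noteq> F'"
  define B where "B = {v \<in> verts X - {r}. F v \<noteq> F' v}"
  have "B \<noteq> {}"
  proof
    assume "B = {}"
    then have "F = F'"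
      using F F' by (intro extensionalityI[of _ "verts X - {r}"])
        (auto simp: B_def arborescences_def PiE_def)
    with ne show False by simp
  qed
  moreover have finB: "finite B" by (simp add: B_def)
  ultimately obtain v where v: "v \<in> B" "\<And>w. w \<in> B \<Longrightarrow> height X r F w \<le> height X r F v"
    using finite_has_greatest[of B "height X r F"] by blast
  then have vX: "v \<in> verts X" "v \<noteq> r" and vne: "F v \<noteq> F' v" by (auto simp: B_def)
  note a' = arborescence_apply[OF F' vX]
  have "F' v \<in> \<Union>(arborescence_edges r F)"
    unfolding eq using vX by (auto simp: arborescence_edges_def)
  then show False
  proof (cases rule: arborescence_edges_cases)
    case (1 w)
    then show False using arborescence_apply[OF F 1(1,2)] a' vne by auto
  next
    case (2 w)
    note aw = arborescence_apply[OF F 2(1,2)]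
    have hw: "head X (F w) = v" using a' aw 2(3) by simp
    then have "w \<notin> B" using v(2)[of w] aw(3) by auto
    then have "F' w = F w" using 2 by (auto simp: B_def)
    then show False
      using arborescence_apply(3)[OF F' 2(1,2)] a'(3) hw 2(3) aw(1,2) by simp
  qed
qed

text \<open>
  This makes a simple path, closed up by one more arc, a circuit of the undirected graph.
\<close>

lemma path_no_backtrack:
  assumes "pre_digraph.cas G u p v" "distinct (pre_digraph.awalk_verts G u p)"
    "e \<in> set p" "e' \<in> set p" "head G e = tail G e'" "tail G e = head G e'"
  shows False
  using assms
proof (induction p arbitrary: u)
  case (Cons a p)
  have hd: "head G f \<in> set (pre_digraph.awalk_verts G (head G a) p)" if "f \<in> set (a # p)" for f
  proof -
    have "head G f \<in> set (pre_digraph.awalk_verts G w q)" 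
      if "f \<in> set q" "pre_digraph.cas G w q v" for w q
      using that
    proof (induction q arbitrary: w)
      case (Cons b q)
      have "w' \<in> set (pre_digraph.awalk_verts G w' q)" if "pre_digraph.cas G w' q v" for w'
        using that by (cases q) (auto simp: pre_digraph.awalk_verts.simps pre_digraph.cas.simps)
      then show ?case using Cons by (auto simp: pre_digraph.awalk_verts.simps pre_digraph.cas.simps)
    qed simp
    moreover have "head G a \<in> set (pre_digraph.awalk_verts G (head G a) p)"
      using Cons.prems(1) by (cases p) (auto simp: pre_digraph.awalk_verts.simps pre_digraph.cas.simps)
    ultimately show ?thesis using that Cons.prems(1) by (auto simp: pre_digraph.cas.simps)
  qed
  have nohead: "head G f \<noteq> u" if "f \<in> set (a # p)" for f
    using hd[OF that] Cons.prems(1,2) by (auto simp: pre_digraph.awalk_verts.simps pre_digraph.cas.simps)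
  have "tail G a = u" using Cons.prems(1) by (simp add: pre_digraph.cas.simps)
  then have "e \<noteq> a" "e' \<noteq> a" using nohead Cons.prems(3-6) by metis+
  then show False using Cons by (auto simp: pre_digraph.awalk_verts.simps pre_digraph.cas.simps)
qed auto

text \<open>
  The tree contains an arborescence because it is connected.  An edge outside the arborescence together
  with the path of the arborescence between its ends would be a circuit.
\<close>

lemma spanning_tree_is_arborescence:
  assumes T: "T \<in> spanning_trees X bar" and r: "r \<in> verts X"
  shows "\<exists>F\<in>arborescences X r. arborescence_edges r F = T"
proof -
  have TU: "T \<subseteq> undirected_edges X bar" and conn: "connected_graph (X\<lparr>arcs := \<Union>T\<rparr>)"
    and acyc: "\<And>c. \<not> circuit (X\<lparr>arcs := \<Union>T\<rparr>) bar c"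
    using T by (auto simp: spanning_trees_def)
  have edge': "\<exists>e'\<in>arcs X. t = {e', bar e'}" if "t \<in> T" for t
    using that TU by (auto simp: undirected_edges_def)
  have edge: "t = {e, bar e} \<and> e \<in> arcs X" if te: "t \<in> T" "e \<in> t" for t e
  proof -
    obtain e' where "e' \<in> arcs X" "t = {e', bar e'}" using edge'[OF te(1)] by blast
    then show ?thesis using te(2) by auto
  qed
  have TA: "\<Union>T \<subseteq> arcs X" "bar ` \<Union>T \<subseteq> \<Union>T"
    using edge by blast+
  obtain F where F: "F \<in> arborescences X r" "F ` (verts X - {r}) \<subseteq> \<Union>T"
    using arborescence_within[OF TA r conn] by blast
  let ?E = "arborescence_edges r F"
  have sub: "?E \<subseteq> T"
  proof
    fix t assume "t \<in> ?E"
    then obtain v where v: "v \<in> verts X - {r}" "t = {F v, bar (F v)}"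
      by (auto simp: arborescence_edges_def)
    then obtain t' where "t' \<in> T" "F v \<in> t'" using F(2) by blast
    then show "t \<in> T" using edge v by blast
  qed
  have "T \<subseteq> ?E"
  proof (rule ccontr)
    assume "\<not> T \<subseteq> ?E"
    then obtain t where t: "t \<in> T" "t \<notin> ?E" by blast
    then obtain e where e: "e \<in> arcs X" "t = {e, bar e}" using TU by (auto simp: undirected_edges_def)
    let ?H = "X\<lparr>arcs := \<Union>?E\<rparr>"
    note EA = arborescence_edges_arcs[OF F(1)]
    interpret H: wf_digraph ?H
      using EA by unfold_locales auto
    have "(head X e, tail X e) \<in> {(tail X e, head X e) |e. e \<in> \<Union>?E}\<^sup>*"
      using connected_iff_reach_root[OF EA(2,3), of "tail X e"] arborescence_connected[OF F(1) r] e(1)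
      by simp
    moreover have "arcs_ends ?H = {(tail X e, head X e) |e. e \<in> \<Union>?E}"
      by (auto simp: arcs_ends_conv)
    ultimately have "head X e \<rightarrow>\<^sup>*\<^bsub>?H\<^esub> tail X e"
      using e(1) by (auto simp: H.reachable_conv)
    then obtain p where p: "H.apath (head X e) p (tail X e)"
      using H.reachable_awalk H.apath_awalk_to_apath by blast
    let ?c = "e # p"
    have pE: "set p \<subseteq> \<Union>?E" using p by (auto simp: H.apath_def H.awalk_def)
    have notE': "e' \<notin> \<Union>?E" if e't: "e' \<in> t" for e'
    proof
      assume "e' \<in> \<Union>?E"
      then obtain t' where t': "t' \<in> ?E" "e' \<in> t'" by blast
      then have "t' = {e', bar e'}" using edge sub by blast
      moreover have "t = {e', bar e'}" using edge[OF t(1) e't] by blast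
      ultimately show False using t' t(2) by simp
    qed
    have notE: "e \<notin> \<Union>?E" "bar e \<notin> \<Union>?E"
      using notE'[of e] notE'[of "bar e"] e(2) by auto
    let ?G = "X\<lparr>arcs := \<Union>T\<rparr>"
    have c1: "pre_digraph.cas ?G = H.cas" "pre_digraph.awalk_verts ?G = H.awalk_verts"
      by (rule compatible_cas compatible_awalk_verts; simp add: compatible_def)+
    have "pre_digraph.cycle ?G ?c"
      unfolding pre_digraph.cycle_def pre_digraph.awalk_def c1
      using p e t pE sub
      by (intro exI[of _ "tail X e"]) (auto simp: H.apath_def H.awalk_def)
    moreover have "bar e' \<notin> set ?c" if e': "e' \<in> set ?c" for e'
    proof
      assume b: "bar e' \<in> set ?c"
      show False
      proof (cases "e' = e")
        case True
        then show False using b notE pE e arev_neq[of e] by auto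
      next
        case False
        then have e'p: "e' \<in> set p" using e' by simp
        then have e'A: "e' \<in> arcs X" using pE EA by auto
        have "bar e' \<noteq> e" using e'p pE notE EA(3) arev_arev[of e'] by (metis subsetD)
        then have "bar e' \<in> set p" using b by simp
        then show False
          using path_no_backtrack[of ?H "head X e" p "tail X e" e' "bar e'"] p e'p e'A
          by (auto simp: H.apath_def H.awalk_def)
      qed
    qed
    ultimately have "circuit ?G bar ?c" by (simp add: circuit_def)
    then show False using acyc by blast
  qed
  then show ?thesis using sub F by blast
qed

theorem kappa_eq_card_arborescences:
  assumes r: "r \<in> verts X"
  shows "kappa X bar = card (arborescences X r)"
proof -
  have "arborescence_edges r F \<in> spanning_trees X bar" if "F \<in> arborescences X r" for F
    unfolding spanning_trees_def
  proof (intro CollectI conjI notI)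
    assume "\<exists>c. circuit (X\<lparr>arcs := \<Union>(arborescence_edges r F)\<rparr>) bar c"
    then show False using arborescence_no_circuit[OF that] by (elim exE) (rule notE)
  qed (rule arborescence_edges_arcs(1)[OF that] arborescence_connected[OF that r])+
  moreover have "T \<in> arborescence_edges r ` arborescences X r" if "T \<in> spanning_trees X bar" for T
    using spanning_tree_is_arborescence[OF that r] by (elim bexE) (rule image_eqI[OF sym])
  ultimately have "arborescence_edges r ` arborescences X r = spanning_trees X bar"
    by (intro equalityI subsetI) (erule imageE, simp)
  then show ?thesis
    unfolding kappa_def using card_image[OF inj_on_arborescence_edges, of r] by simp
qed

lemma kappa_pos:
  assumes "connected_graph X"
  shows "kappa X bar > 0"
proof -
  obtain r where r: "r \<in> verts X"
    using assms by (auto simp: Digraph_Component.connected_def strongly_connected_def mk_symmetric_def)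
  have "X\<lparr>arcs := arcs X\<rparr> = X" by simp
  then obtain F where F: "F \<in> arborescences X r"
    using arborescence_within[of "arcs X" r] r assms
    by (metis (no_types, lifting) arev_in_arcs image_subsetI subset_refl)
  have "finite (arborescences X r)"
    unfolding arborescences_def by (rule finite_subset[OF _ finite_PiE[of "verts X - {r}" "out_arcs X"]]) auto
  then show ?thesis
    using F kappa_eq_card_arborescences[OF r] by (auto simp: card_gt_0_iff)
qed

lemma laplacian_column_sum:
  assumes "y \<in> verts X"
  shows "(\<Sum>x\<in>verts X. laplacian X x y) = 0"
proof -
  have "(\<Sum>x\<in>verts X. laplacian X x y) =
    (\<Sum>x\<in>verts X. \<Sum>e\<in>{e\<in>arcs X. tail X e = x}. of_bool (tail X e = y) - of_bool (head X e = y))"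
    unfolding laplacian_def out_arcs_def
    by (rule sum.cong[OF refl], rule sum.cong[OF refl]) simp
  also have "\<dots> = (\<Sum>e\<in>arcs X. of_bool (tail X e = y) - of_bool (head X e = y))"
    by (rule sum.group) (simp_all add: image_subset_iff)
  also have "\<dots> = (\<Sum>e\<in>arcs X. of_bool (tail X e = y)) - (\<Sum>e\<in>arcs X. of_bool (head X e = y))"
    by (rule sum_subtractf)
  also have "(\<Sum>e\<in>arcs X. of_bool (head X e = y)) = (\<Sum>e\<in>arcs X. (of_bool (tail X e = y) :: int))"
    by (rule sum.reindex_bij_witness[of _ bar bar]) simp_all
  finally show ?thesis by simp
qed

text \<open>
  Perturbing the column \<open>r\<close> instead of deleting a row and a column leaves an operator on the whole
  space of functions, to which a change of basis can be applied.  The columns of the Laplacian sum to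
  zero, so adding all rows to the row \<open>r\<close> makes the matrix block triangular.
\<close>

theorem matrix_tree:
  fixes a :: "'v \<Rightarrow> int"
  assumes r: "r \<in> verts X"
  shows "det_on (verts X) (\<lambda>x y. laplacian X x y + a x * of_bool (y = r)) =
    int (kappa X bar) * (\<Sum>x\<in>verts X. a x)"
proof -
  let ?V = "verts X" and ?S = "verts X - {r}"
  let ?M = "\<lambda>x y. laplacian X x y + a x * of_bool (y = r)"
  let ?N = "\<lambda>x y. if x = r then (\<Sum>k\<in>?V. ?M k y) else ?M x y"
  have col: "?N r y = (if y = r then (\<Sum>x\<in>?V. a x) else 0)" if "y \<in> ?V" for y
    using laplacian_column_sum[OF that] by (simp add: sum.distrib)
  have "det_on ?V ?M = det_on ?V ?N"
    using r by (intro det_on_add_rows[symmetric]) auto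
  also have "\<dots> = det_on (?S \<union> {r}) ?N"
    using r by (simp add: insert_absorb)
  also have "\<dots> = det_on ?S ?N * det_on {r} ?N"
  proof (rule det_on_block)
    show "?N x y = 0" if "x \<in> {r}" "y \<in> ?S" for x y
      using col[of y] that by simp
  qed auto
  also have "det_on ?S ?N = det_on ?S (laplacian X)"
    by (rule det_on_cong) simp
  also have "det_on {r} ?N = (\<Sum>x\<in>?V. a x)"
    using col[OF r] by simp
  finally show ?thesis
    using det_reduced_laplacian[OF r] kappa_eq_card_arborescences[OF r] by simp
qed

end

section \<open>Integer polynomials on roots of unity\<close>

hide_const (open) Module.module.smult up_ring.monom up_ring.coeff
  \<comment> \<open>These names refer to the type of univariate polynomials from here on.\<close>

definition ceval :: "int poly \<Rightarrow> complex \<Rightarrow> complex" where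
  "ceval q z = poly (map_poly of_int q) z"

lemma ceval_simps [simp]:
  "ceval (q + q') z = ceval q z + ceval q' z"
  "ceval (q - q') z = ceval q z - ceval q' z"
  "ceval (q * q') z = ceval q z * ceval q' z"
  "ceval (q ^ n) z = ceval q z ^ n"
  "ceval (smult c q) z = of_int c * ceval q z"
  "ceval (monom c n) z = of_int c * z ^ n"
  "ceval (pcompose q q') z = ceval q (ceval q' z)"
  "ceval (sum F A) z = (\<Sum>a\<in>A. ceval (F a) z)"
  unfolding ceval_def
  by (simp_all add: of_int_poly_hom.hom_add of_int_poly_hom.hom_minus of_int_poly_hom.hom_mult
      of_int_poly_hom.hom_power of_int_hom.map_poly_hom_smult map_poly_monom poly_monom
      of_int_hom.map_poly_pcompose poly_pcompose of_int_poly_hom.hom_sum poly_sum)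

lemma ceval_one: "ceval q 1 = of_int (poly q 1)"
  unfolding ceval_def by (metis of_int_1 of_int_hom.poly_map_poly)

abbreviation unity_roots :: "nat \<Rightarrow> complex set" where
  "unity_roots N \<equiv> {z. z ^ N = 1}"

lemma power_mod_unity_root:
  fixes z :: complex
  assumes "z ^ N = 1"
  shows "z ^ (k mod N) = z ^ k"
  by (metis assms mod_mult_div_eq mult_1_right power_add power_mult power_one)

lemma sum_powers_unity_root:
  fixes z :: complex
  assumes "z ^ N = 1" "z \<noteq> 1"
  shows "(\<Sum>j<N. z ^ j) = 0"
  using assms by (simp add: sum_gp_strict)

lemma int_poly_eq_on_unity_roots:
  assumes N: "N > 0" and deg: "degree a < N" "degree b < N"
    and eq: "\<And>z. z \<in> unity_roots N \<Longrightarrow> ceval a z = ceval b z"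
  shows "a = b"
proof (rule ccontr)
  assume "a \<noteq> b"
  define d where "d = (map_poly of_int (a - b) :: complex poly)"
  have d0: "d \<noteq> 0" using \<open>a \<noteq> b\<close> by (simp add: d_def)
  have "degree d < N"
    using degree_diff_less[of a N b] deg by (simp add: d_def)
  moreover have "unity_roots N \<subseteq> {z. poly d z = 0}"
    using eq by (auto simp: d_def simp flip: ceval_def)
  then have "card (unity_roots N) \<le> card {z. poly d z = 0}"
    using poly_roots_finite[OF d0] by (intro card_mono)
  then have "N \<le> degree d"
    using card_roots_unity_eq[OF N] card_poly_roots_bound[OF d0] by simp
  ultimately show False by simp
qed

text \<open>
  The representative of degree less than \<open>N\<close> of the class of \<open>q\<close> in \<open>\<int>[x] / (x\<^sup>N - 1)\<close>.
\<close>

definition cyclic_reduction :: "nat \<Rightarrow> int poly \<Rightarrow> int poly" where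
  "cyclic_reduction N q = (\<Sum>k\<le>degree q. monom (coeff q k) (k mod N))"

lemma degree_cyclic_reduction:
  assumes "N > 0"
  shows "degree (cyclic_reduction N q) < N"
proof -
  have "degree (cyclic_reduction N q) \<le> N - 1"
    unfolding cyclic_reduction_def
  proof (rule degree_sum_le)
    fix k
    have "degree (monom (coeff q k) (k mod N)) \<le> k mod N" by (rule degree_monom_le)
    also have "k mod N \<le> N - 1" using assms mod_less_divisor[of N k] by linarith
    finally show "degree (monom (coeff q k) (k mod N)) \<le> N - 1" .
  qed simp
  then show ?thesis using assms by simp
qed

lemma ceval_cyclic_reduction:
  assumes "z ^ N = 1"
  shows "ceval (cyclic_reduction N q) z = ceval q z"
proof -
  note pow = power_mod_unity_root[OF assms]
  have "q = (\<Sum>k\<le>degree q. monom (coeff q k) k)"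
    by (simp add: poly_as_sum_of_monoms)
  then have "ceval q z = ceval (\<Sum>k\<le>degree q. monom (coeff q k) k) z" by simp
  then show ?thesis by (simp add: cyclic_reduction_def pow)
qed

lemma dvd_sub_cyclic_reduction:
  "monom 1 N - 1 dvd q - cyclic_reduction N q"
proof -
  have "monom 1 N - 1 dvd monom c k - monom c (k mod N)" for c :: int and k
  proof -
    have "monom c k - monom c (k mod N) = monom c (k mod N) * (monom 1 N ^ (k div N) - 1 ^ (k div N))"
      by (simp add: algebra_simps monom_power mult_monom)
    moreover have "monom 1 N - 1 dvd monom 1 N ^ (k div N) - (1 :: int poly) ^ (k div N)"
      by (metis dvd_triv_left power_diff_sumr2)
    ultimately show ?thesis by (metis dvd_mult)
  qed
  moreover have "q - cyclic_reduction N q =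
      (\<Sum>k\<le>degree q. monom (coeff q k) k - monom (coeff q k) (k mod N))"
    by (simp add: sum_subtractf cyclic_reduction_def poly_as_sum_of_monoms)
  ultimately show ?thesis by (metis (no_types, lifting) dvd_sum)
qed

lemma cyclic_reduction_eqI:
  assumes "N > 0" "degree a < N" "\<And>z. z \<in> unity_roots N \<Longrightarrow> ceval a z = ceval q z"
  shows "cyclic_reduction N q = a"
  using assms(2,3) by (intro int_poly_eq_on_unity_roots[OF assms(1)] degree_cyclic_reduction[OF assms(1)])
    (auto simp: ceval_cyclic_reduction)

lemma cyclic_reduction_diff:
  assumes "N > 0"
  shows "cyclic_reduction N (a - b) = cyclic_reduction N a - cyclic_reduction N b"
  using assms by (intro cyclic_reduction_eqI degree_diff_less degree_cyclic_reduction)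
    (auto simp: ceval_cyclic_reduction)

lemma cyclic_reduction_smult:
  assumes "N > 0"
  shows "cyclic_reduction N (smult c a) = smult c (cyclic_reduction N a)"
  using assms degree_cyclic_reduction[OF assms, of a] degree_smult_le[of c "cyclic_reduction N a"]
  by (intro cyclic_reduction_eqI) (auto simp: ceval_cyclic_reduction)

text \<open>
  The matrix is that of multiplication by \<open>q\<close> on \<open>\<int>[x] / (x\<^sup>N - 1)\<close> in the basis of monomials.
\<close>

definition circulant_det :: "nat \<Rightarrow> int poly \<Rightarrow> int" where
  "circulant_det N q = det_on {..<N} (\<lambda>i j. coeff (cyclic_reduction N q) ((j + N - i) mod N))"

lemma sum_shift_mod:
  fixes g :: "nat \<Rightarrow> 'a::comm_monoid_add"
  assumes "i < N"
  shows "(\<Sum>j<N. g ((j + N - i) mod N)) = (\<Sum>k<N. g k)"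
proof (rule sum.reindex_bij_witness[of _ "\<lambda>k. (k + i) mod N" "\<lambda>j. (j + N - i) mod N"])
  fix j assume "j \<in> {..<N}"
  then have j: "j < N" by simp
  have "((j + N - i) mod N + i) mod N = (j + N - i + i) mod N" by (rule mod_add_left_eq)
  also have "j + N - i + i = j + N" using assms by simp
  finally show "((j + N - i) mod N + i) mod N = j" using j by simp
next
  fix k assume "k \<in> {..<N}"
  then have k: "k < N" by simp
  show "((k + i) mod N + N - i) mod N = k"
  proof (cases "k + i < N")
    case False
    then have "(k + i) mod N = k + i - N" using k assms by (simp add: mod_if)
    then show ?thesis using k False by simp
  qed (use k in simp)
qed (use assms in auto)

text \<open>
  The Fourier matrix diagonalises circulant matrices.  In particular the product on the right is an
  integer.
\<close>

theorem of_int_circulant_det: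
  assumes N: "N > 0"
  shows "of_int (circulant_det N q) = (\<Prod>z\<in>unity_roots N. ceval q z)"
proof -
  let ?c = "coeff (cyclic_reduction N q)"
  let ?M = "\<lambda>i j. complex_of_int (?c ((j + N - i) mod N))"
  let ?J = "unity_roots N"
  have fin: "finite ?J" using N by (intro finite_roots_unity) simp
  have z0: "z \<noteq> 0" if "z \<in> ?J" for z using that N by (auto simp: power_0_left)
  have "det_on {..<N} ?M = det_on ?J (\<lambda>z w. ceval q z * (if z = w then 1 else 0))"
  proof (rule det_on_intertwine[where K = "\<lambda>i z. z ^ i" and K' = "\<lambda>z i. (inverse z) ^ i / of_nat N"])
    show "card {..<N} = card ?J" using card_roots_unity_eq[OF N] by simp
    fix z w assume zw: "z \<in> ?J" "w \<in> ?J"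
    have "(\<Sum>k<N. inverse z ^ k / of_nat N * w ^ k) = (\<Sum>k<N. (w / z) ^ k) / of_nat N"
      by (simp add: sum_divide_distrib power_divide field_simps)
    also have "\<dots> = (if z = w then 1 else 0)"
      using zw z0 N sum_powers_unity_root[of "w / z" N] by (auto simp: power_divide)
    finally show "(\<Sum>k<N. inverse z ^ k / of_nat N * w ^ k) = (if z = w then 1 else 0)" .
  next
    fix i z assume i: "i \<in> {..<N}" and z: "z \<in> ?J"
    have zN: "z ^ N = 1" using z by simp
    note pow = power_mod_unity_root[OF zN]
    have "(\<Sum>j<N. ?M i j * z ^ j) = (\<Sum>j<N. of_int (?c ((j + N - i) mod N)) * (z ^ i * z ^ ((j + N - i) mod N)))"
    proof (intro sum.cong refl)
      fix j assume "j \<in> {..<N}"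
      have "z ^ i * z ^ ((j + N - i) mod N) = z ^ (j + N)"
        using i unfolding pow power_add[symmetric] by simp
      also have "\<dots> = z ^ j" unfolding power_add zN by simp
      finally show "?M i j * z ^ j = of_int (?c ((j + N - i) mod N)) * (z ^ i * z ^ ((j + N - i) mod N))"
        by simp
    qed
    also have "\<dots> = (\<Sum>k<N. of_int (?c k) * (z ^ i * z ^ k))"
      using i by (intro sum_shift_mod) simp
    also have "\<dots> = z ^ i * (\<Sum>k<N. of_int (?c k) * z ^ k)"
      by (simp add: sum_distrib_left mult_ac)
    also have "(\<Sum>k<N. of_int (?c k) * z ^ k) = ceval (cyclic_reduction N q) z"
    proof -
      have "(\<Sum>k<N. monom (?c k) k) = cyclic_reduction N q"
        using degree_cyclic_reduction[OF N, of q] N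
        by (metis Suc_pred' lessThan_Suc_atMost less_Suc_eq_le poly_as_sum_of_monoms')
      then have "ceval (cyclic_reduction N q) z = ceval (\<Sum>k<N. monom (?c k) k) z" by simp
      then show ?thesis by (simp)
    qed
    also have "\<dots> = ceval q z" using z by (simp add: ceval_cyclic_reduction)
    also have "z ^ i * ceval q z = (\<Sum>w\<in>?J. z ^ i * 0 + (if w = z then w ^ i * ceval q w else 0))"
      using fin z by (simp add: sum.delta)
    also have "\<dots> = (\<Sum>w\<in>?J. w ^ i * (ceval q w * (if w = z then 1 else 0)))"
      by (intro sum.cong) auto
    finally show "(\<Sum>j<N. ?M i j * z ^ j) = (\<Sum>w\<in>?J. w ^ i * (ceval q w * (if w = z then 1 else 0)))" .
  qed (use fin in auto)
  also have "\<dots> = (\<Prod>z\<in>?J. ceval q z)"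
    by (simp add: det_on_scale_rows det_on_identity[OF fin])
  finally show ?thesis
    by (simp add: circulant_det_def det_on_of_int)
qed

subsection \<open>Products over all roots of unity modulo a prime\<close>

lemma freshman_mod_prime:
  fixes a b :: "int poly"
  assumes "prime p"
  shows "[:int p:] dvd (a + b) ^ p - (a ^ p + b ^ p)"
proof -
  have p: "p > 0" using assms by (rule prime_gt_0_nat)
  have "(a + b) ^ p = (\<Sum>k\<le>p. of_nat (p choose k) * a ^ k * b ^ (p - k))"
    by (rule binomial_ring)
  also have "{..p} = insert 0 (insert p {1..<p})" using p by auto
  also have "(\<Sum>k\<in>\<dots>. of_nat (p choose k) * a ^ k * b ^ (p - k)) =
    a ^ p + b ^ p + (\<Sum>k\<in>{1..<p}. of_nat (p choose k) * a ^ k * b ^ (p - k))"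
    using p by simp
  finally have "(a + b) ^ p - (a ^ p + b ^ p) =
    (\<Sum>k\<in>{1..<p}. of_nat (p choose k) * a ^ k * b ^ (p - k))" by simp
  also have "[:int p:] dvd \<dots>"
  proof (rule dvd_sum)
    fix k assume k: "k \<in> {1..<p}"
    then have "p dvd p choose k" using assms by (intro dvd_choose_prime) auto
    then have "[:int p:] dvd (of_nat (p choose k) :: int poly)"
      by (auto simp: of_nat_poly)
    then show "[:int p:] dvd of_nat (p choose k) * a ^ k * b ^ (p - k)"
      by (simp add: mult.assoc)
  qed
  finally show ?thesis .
qed

lemma fermat_int:
  fixes a :: int
  assumes "prime p"
  shows "int p dvd a ^ p - a"
proof -
  have p: "p > 0" using assms by (rule prime_gt_0_nat)
  define b where "b = nat (a mod int p)"
  have b: "[a = int b] (mod int p)" using p by (simp add: b_def cong_def)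
  have "[b ^ p = b] (mod p)"
  proof (cases "p dvd b")
    case True
    then have "p dvd b ^ p" using p by (simp add: dvd_power_same dvd_trans dvd_power)
    then show ?thesis using True by (simp add: cong_def mod_eq_0_iff_dvd)
  next
    case False
    have "[b * b ^ (p - 1) = b * 1] (mod p)"
      using fermat_theorem[OF assms False] by (intro cong_mult cong_refl)
    moreover have "b * b ^ (p - 1) = b ^ p" using p by (metis power_eq_if not_gr0)
    ultimately show ?thesis by simp
  qed
  then have "[int b ^ p = int b] (mod int p)" by (metis cong_int_iff of_nat_power)
  then have "[a ^ p = a] (mod int p)"
    using b by (meson cong_pow cong_sym cong_trans)
  then show ?thesis by (simp add: cong_iff_dvd_diff)
qed

lemma power_diff_dvd: "a - b dvd a ^ n - (b::'a::comm_ring_1) ^ n"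
  by (metis dvd_triv_left power_diff_sumr2)

lemma frobenius_poly:
  assumes "prime p"
  shows "[:int p:] dvd q ^ p - pcompose q (monom 1 p)"
proof (induction q rule: pCons_induct)
  case 0
  then show ?case using prime_gt_0_nat[OF assms] by (simp add: power_0_left)
next
  case (pCons a q)
  define x where "x = (monom 1 1 :: int poly)"
  define A where "A = [:a:]"
  have e: "pCons a q = A + x * q" by (simp add: x_def A_def monom_Suc)
  have xp: "monom 1 p = x ^ p" by (simp add: x_def monom_power)
  have Ap: "[:a ^ p - a:] = A ^ p - A" by (simp add: A_def poly_const_pow)
  have c: "pcompose (pCons a q) (monom 1 p) = A + x ^ p * pcompose q (monom 1 p)"
    by (simp add: pcompose_pCons A_def xp)
  have "pCons a q ^ p - pcompose (pCons a q) (monom 1 p) =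
    ((A + x * q) ^ p - (A ^ p + (x * q) ^ p)) + [:a ^ p - a:]
      + x ^ p * (q ^ p - pcompose q (monom 1 p))"
    unfolding c unfolding e Ap by (simp add: power_mult_distrib algebra_simps)
  also have "[:int p:] dvd \<dots>"
    using freshman_mod_prime[OF assms] fermat_int[OF assms] pCons.IH
    by (intro dvd_add dvd_mult) simp_all
  finally show ?case .
qed

lemma frobenius_poly_iterate:
  assumes "prime p"
  shows "[:int p:] dvd q ^ (p ^ m) - pcompose q (monom 1 (p ^ m))"
proof (induction m)
  case 0
  have "pcompose q (monom 1 1) = q" by (simp add: monom_Suc one_pCons)
  then show ?case by simp
next
  case (Suc m)
  let ?q = "pcompose q (monom 1 (p ^ m))"
  have "[:int p:] dvd (q ^ (p ^ m)) ^ p - ?q ^ p"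
    using Suc.IH power_diff_dvd by (rule dvd_trans)
  moreover have "[:int p:] dvd ?q ^ p - pcompose ?q (monom 1 p)"
    by (rule frobenius_poly[OF assms])
  ultimately have "[:int p:] dvd ((q ^ (p ^ m)) ^ p - ?q ^ p) + (?q ^ p - pcompose ?q (monom 1 p))"
    by (rule dvd_add)
  moreover have "pcompose ?q (monom 1 p) = pcompose q (monom 1 (p ^ Suc m))"
    unfolding poly_eq_poly_eq_iff[symmetric]
    by (rule ext) (simp add: poly_pcompose poly_monom power_mult[symmetric] mult.commute)
  ultimately show ?case by (simp add: power_mult[symmetric] mult.commute)
qed

lemma circulant_det_power:
  assumes "N > 0"
  shows "circulant_det N (q ^ k) = circulant_det N q ^ k"
proof -
  have "complex_of_int (circulant_det N (q ^ k)) = of_int (circulant_det N q ^ k)"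
    using assms by (simp add: of_int_circulant_det prod_power_distrib)
  then show ?thesis by (simp only: of_int_eq_iff)
qed

lemma circulant_det_cong:
  assumes N: "N > 0" and dvd: "[:int p:] dvd a - b"
  shows "[circulant_det N a = circulant_det N b] (mod int p)"
  unfolding circulant_det_def
proof (rule det_on_mod_cong)
  fix i j
  obtain w where "a - b = [:int p:] * w" using dvd by (rule dvdE) (rule that)
  then have w: "a - b = smult (int p) w" by simp
  have "cyclic_reduction N a - cyclic_reduction N b = smult (int p) (cyclic_reduction N w)"
    unfolding cyclic_reduction_diff[OF N, symmetric] w by (rule cyclic_reduction_smult[OF N])
  then have "coeff (cyclic_reduction N a) k - coeff (cyclic_reduction N b) k =
      int p * coeff (cyclic_reduction N w) k" for k
    by (metis coeff_diff coeff_smult)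
  then show "[coeff (cyclic_reduction N a) ((j + N - i) mod N) =
      coeff (cyclic_reduction N b) ((j + N - i) mod N)] (mod int p)"
    by (simp add: cong_iff_dvd_diff)
qed

text \<open>
  Modulo \<open>p\<close>, the power \<open>q(x)\<^sup>N\<close> is \<open>q(x\<^sup>N)\<close>, which takes the constant value \<open>q(1)\<close> on the \<open>N\<close>-th roots
  of unity.
\<close>

lemma prime_not_dvd_circulant_det:
  assumes p: "prime p" and q: "\<not> int p dvd poly q 1"
  shows "\<not> int p dvd circulant_det (p ^ m) q"
proof
  let ?N = "p ^ m"
  assume dvd: "int p dvd circulant_det ?N q"
  have N: "?N > 0" using prime_gt_0_nat[OF p] by simp
  have "complex_of_int (circulant_det ?N (pcompose q (monom 1 ?N))) = of_int (poly q 1 ^ ?N)"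
    using card_roots_unity_eq[OF N] N by (simp add: of_int_circulant_det ceval_one)
  then have "circulant_det ?N (pcompose q (monom 1 ?N)) = poly q 1 ^ ?N"
    by (simp only: of_int_eq_iff)
  moreover have "[circulant_det ?N (q ^ ?N) = circulant_det ?N (pcompose q (monom 1 ?N))] (mod int p)"
    by (intro circulant_det_cong N frobenius_poly_iterate p)
  ultimately have "[circulant_det ?N q ^ ?N = poly q 1 ^ ?N] (mod int p)"
    using N by (simp add: circulant_det_power)
  moreover have "int p dvd circulant_det ?N q ^ ?N" using dvd N by (meson dvd_power dvd_trans)
  ultimately have "int p dvd poly q 1 ^ ?N" by (simp add: cong_dvd_iff)
  then show False using q p by (meson prime_dvd_power prime_nat_int_transfer)
qed

section \<open>The order of vanishing at 1 modulo a prime\<close>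

lemma poly_const: "poly [:c:] x = c"
  by simp

text \<open>
  The reduction of \<open>h\<close> modulo \<open>p\<close> vanishes at \<open>1\<close> to the exact order \<open>l\<close>; equivalently, \<open>h\<close> regarded
  as a power series in \<open>x - 1\<close> has \<open>\<mu>\<close>-invariant \<open>0\<close> and \<open>\<lambda>\<close>-invariant \<open>l\<close>.
\<close>

definition order_mod :: "nat \<Rightarrow> int poly \<Rightarrow> nat \<Rightarrow> bool" where
  "order_mod p h l \<longleftrightarrow> (\<exists>s r. h = [:-1, 1:] ^ l * s + smult (int p) r \<and> \<not> int p dvd poly s 1)"

lemma order_mod_exists:
  assumes "\<not> [:int p:] dvd h"
  shows "\<exists>l\<le>degree h. order_mod p h l"
  using assms
proof (induction "degree h" arbitrary: h rule: less_induct)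
  case less
  show ?case
  proof (cases "int p dvd poly h 1")
    case False
    then show ?thesis unfolding order_mod_def
      by (intro exI[of _ 0] conjI exI[of _ h] exI[of _ 0]) auto
  next
    case True
    define h1 where "h1 = synthetic_div h 1"
    have h: "h = [:-1, 1:] * h1 + [:poly h 1:]"
      unfolding h1_def using synthetic_div_correct'[of 1 h] by simp
    have deg: "degree h > 0"
    proof (rule ccontr)
      assume "\<not> degree h > 0"
      then obtain c where "h = [:c:]" by (metis degree_eq_zeroE neq0_conv)
      then show False using True less.prems by simp
    qed
    have d1: "degree h1 < degree h" unfolding h1_def using deg by (simp add: degree_synthetic_div)
    have "\<not> [:int p:] dvd h1"
    proof
      assume "[:int p:] dvd h1"
      then have "[:int p:] dvd [:-1, 1:] * h1 + [:poly h 1:]" using True by (intro dvd_add dvd_mult) simp_all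
      then show False using h less.prems by simp
    qed
    then obtain l s r where l: "l \<le> degree h1" and h1: "h1 = [:-1, 1:] ^ l * s + smult (int p) r"
      and s: "\<not> int p dvd poly s 1"
      using less.hyps[OF d1] by (auto simp: order_mod_def)
    obtain c where c: "poly h 1 = int p * c" using True unfolding dvd_def by blast
    have "h = [:-1, 1:] * ([:-1, 1:] ^ l * s + smult (int p) r) + [:int p * c:]"
      using h by (simp only: h1 c)
    also have "\<dots> = [:-1, 1:] ^ Suc l * s + smult (int p) ([:-1, 1:] * r + [:c:])"
      by (simp only: power_Suc distrib_left mult.assoc smult_add_right mult_smult_right smult_pCons smult_0_right)
    finally have "order_mod p h (Suc l)" unfolding order_mod_def using s by blast
    then show ?thesis using l d1 by (intro exI[of _ "Suc l"]) simp
  qed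
qed

lemma prime_elem_const_int_poly:
  assumes "prime p"
  shows "prime_elem [:int p:]"
  using assms by (simp add: prime_elem_const_poly_iff)

lemma const_not_dvd_linear:
  assumes "prime p"
  shows "\<not> [:int p:] dvd [:-1, 1:] ^ l"
proof
  assume "[:int p:] dvd [:-1, 1:] ^ l"
  then have "int p dvd coeff ([:-1, 1:] ^ l) l" by (simp only: const_poly_dvd_iff)
  then have "int p dvd 1" by (simp only: coeff_linear_power)
  then show False using assms by (metis not_prime_unit prime_nat_int_transfer)
qed

lemma order_mod_unique_le:
  assumes p: "prime p" and "order_mod p h l" "order_mod p h l'"
  shows "l' \<le> l"
proof (rule ccontr)
  assume "\<not> l' \<le> l"
  then have ll: "l' = l + (l' - l)" "l' - l > 0" by simp_all
  obtain s r where s: "h = [:-1, 1:] ^ l * s + smult (int p) r" "\<not> int p dvd poly s 1"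
    using assms(2) by (auto simp: order_mod_def)
  obtain s' r' where s': "h = [:-1, 1:] ^ l' * s' + smult (int p) r'"
    using assms(3) by (auto simp: order_mod_def)
  have "[:-1, 1:] ^ l * (s - [:-1, 1:] ^ (l' - l) * s') = [:-1, 1:] ^ l * s - [:-1, 1:] ^ l' * s'"
    using ll(1) by (simp only: right_diff_distrib mult.assoc[symmetric] power_add[symmetric])
  also have "\<dots> = smult (int p) (r' - r)"
  proof -
    have "[:-1, 1:] ^ l * s + smult (int p) r = [:-1, 1:] ^ l' * s' + smult (int p) r'"
      using s(1) s' by simp
    then show ?thesis by (simp only: smult_diff_right algebra_simps)
  qed
  finally have "[:int p:] dvd [:-1, 1:] ^ l * (s - [:-1, 1:] ^ (l' - l) * s')"
    by (simp add: const_poly_dvd_iff)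
  then have "[:int p:] dvd s - [:-1, 1:] ^ (l' - l) * s'"
    using const_not_dvd_linear[OF p] prime_elem_const_int_poly[OF p] by (meson prime_elem_dvd_mult_iff)
  then obtain t where "s - [:-1, 1:] ^ (l' - l) * s' = [:int p:] * t" unfolding dvd_def by blast
  then have "poly (s - [:-1, 1:] ^ (l' - l) * s') 1 = poly ([:int p:] * t) 1" by simp
  then have "poly s 1 = int p * poly t 1" using ll(2) by (simp add: power_0_left)
  then show False using s(2) by simp
qed

lemma monom_diff_one_mod_prime:
  assumes "prime p"
  shows "\<exists>w. monom 1 (p ^ m) - 1 = [:-1, 1:] ^ (p ^ m) + smult (int p) w"
proof -
  have "pcompose [:-1, 1:] (monom 1 (p ^ m)) = (monom 1 (p ^ m) - 1 :: int poly)"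
    by (simp add: pcompose_pCons one_pCons)
  then obtain w where "[:-1, 1:] ^ (p ^ m) - (monom 1 (p ^ m) - 1) = [:int p:] * w"
    using frobenius_poly_iterate[OF assms, of "[:-1, 1:]" m] by (metis dvdE)
  then have "monom 1 (p ^ m) - 1 = [:-1, 1:] ^ (p ^ m) + smult (int p) (- w)"
    by (simp add: algebra_simps)
  then show ?thesis by blast
qed

text \<open>
  Modulo \<open>p\<close> the polynomial \<open>x\<^bsup>p^m\<^esup> - 1\<close> equals \<open>(x - 1)\<^bsup>p^m\<^esup>\<close>, which vanishes at \<open>1\<close> to higher order
  than \<open>h\<close>.
\<close>

lemma order_mod_cong:
  assumes p: "prime p" and h: "order_mod p h l" and l: "l < p ^ m"
    and dvd: "monom 1 (p ^ m) - 1 dvd h' - h"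
  shows "order_mod p h' l"
proof -
  obtain s r where s: "h = [:-1, 1:] ^ l * s + smult (int p) r" "\<not> int p dvd poly s 1"
    using h by (auto simp: order_mod_def)
  obtain w where w: "monom 1 (p ^ m) - 1 = [:-1, 1:] ^ (p ^ m) + smult (int p) w"
    using monom_diff_one_mod_prime[OF p] by blast
  obtain g where g: "h' - h = (monom 1 (p ^ m) - 1) * g" using dvd unfolding dvd_def by blast
  have N: "p ^ m = l + (p ^ m - l)" "p ^ m - l > 0" using l by simp_all
  have "h' = h + ([:-1, 1:] ^ (p ^ m) + smult (int p) w) * g"
    using g unfolding w by (simp add: algebra_simps)
  also have "[:-1, 1:] ^ (p ^ m) = [:-1, 1:] ^ l * ([:-1, 1:] ^ (p ^ m - l) :: int poly)"
    by (subst N(1)) (simp only: power_add)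
  finally have "h' = [:-1, 1:] ^ l * (s + [:-1, 1:] ^ (p ^ m - l) * g) + smult (int p) (r + w * g)"
    unfolding s(1) by (simp only: distrib_left distrib_right mult.assoc smult_add_right mult_smult_left)
  moreover have "poly (s + [:-1, 1:] ^ (p ^ m - l) * g) 1 = poly s 1"
    using N(2) by (simp add: power_0_left)
  ultimately show ?thesis unfolding order_mod_def using s(2) by metis
qed

lemma order_mod_not_dvd:
  assumes p: "prime p" and h: "order_mod p h l"
  shows "\<not> [:int p:] dvd h"
proof
  assume "[:int p:] dvd h"
  obtain s r where s: "h = [:-1, 1:] ^ l * s + smult (int p) r" "\<not> int p dvd poly s 1"
    using h by (auto simp: order_mod_def)
  have "[:int p:] dvd smult (int p) r" by (simp add: const_poly_dvd_iff)
  then have "[:int p:] dvd [:-1, 1:] ^ l * s"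
    using \<open>[:int p:] dvd h\<close> s(1) by (metis dvd_add_left_iff)
  then have "[:int p:] dvd s"
    using const_not_dvd_linear[OF p] prime_elem_const_int_poly[OF p] by (meson prime_elem_dvd_mult_iff)
  then obtain t where "s = [:int p:] * t" unfolding dvd_def by blast
  then have "poly s 1 = int p * poly t 1" by simp
  then show False using s(2) by simp
qed

text \<open>
  In other words \<open>g(x) = x\<^bsup>2K\<^esup> g(1/x)\<close>.
\<close>

definition palindromic :: "nat \<Rightarrow> int poly \<Rightarrow> bool" where
  "palindromic K g \<longleftrightarrow> (\<forall>i. coeff g i = (if i \<le> 2 * K then coeff g (2 * K - i) else 0))"

lemma palindromic_add:
  assumes "palindromic K a" "palindromic K b"
  shows "palindromic K (a + b)"
  unfolding palindromic_def coeff_add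
proof
  fix i
  have "coeff a i = (if i \<le> 2 * K then coeff a (2 * K - i) else 0)"
    "coeff b i = (if i \<le> 2 * K then coeff b (2 * K - i) else 0)"
    using assms unfolding palindromic_def by blast+
  then show "coeff a i + coeff b i =
    (if i \<le> 2 * K then coeff a (2 * K - i) + coeff b (2 * K - i) else 0)"
    by (cases "i \<le> 2 * K") simp_all
qed

lemma palindromic_smult:
  assumes "palindromic K a"
  shows "palindromic K (smult c a)"
  unfolding palindromic_def coeff_smult
proof
  fix i
  have "coeff a i = (if i \<le> 2 * K then coeff a (2 * K - i) else 0)"
    using assms unfolding palindromic_def by blast
  then show "c * coeff a i = (if i \<le> 2 * K then c * coeff a (2 * K - i) else 0)"
    by (cases "i \<le> 2 * K") simp_all
qed

lemma palindromic_linear_power: "palindromic K ([:-1, 1:] ^ (2 * K))"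
  unfolding palindromic_def
proof (intro allI)
  fix i
  show "coeff ([:-1, 1:] ^ (2 * K)) i = (if i \<le> 2 * K then coeff ([:-1, 1:] ^ (2 * K)) (2 * K - i) else (0::int))"
  proof (cases "i \<le> 2 * K")
    case True
    have "(- 1 :: int) ^ (2 * K - i) = (- 1) ^ i"
      using True by (simp add: minus_one_power_iff)
    then show ?thesis using True
      by (simp add: coeff_linear_poly_power binomial_symmetric[OF True])
  next
    case False
    have "degree ([:-1, 1:] ^ (2 * K) :: int poly) = 2 * K" by (rule degree_linear_power)
    then show ?thesis using False by (simp add: coeff_eq_0)
  qed
qed

text \<open>
  By induction on \<open>K\<close>, a palindromic polynomial is a combination \<open>\<Sum> b\<^sub>j x\<^bsup>K-j\<^esup> (x - 1)\<^bsup>2j\<^esup>\<close> with integer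
  coefficients: subtracting a multiple of \<open>(x - 1)\<^bsup>2K\<^esup>\<close> kills both the constant and the top
  coefficient, and division by \<open>x\<close> leads to \<open>K - 1\<close>.  The first \<open>b\<^sub>j\<close> that is prime to \<open>p\<close> determines the
  order.
\<close>

lemma palindromic_order_even:
  assumes p: "prime p" and "palindromic K g" "\<not> [:int p:] dvd g"
  shows "\<exists>j\<le>K. order_mod p g (2 * j)"
  using assms(2,3)
proof (induction K arbitrary: g)
  case 0
  then have "coeff g i = 0" if "i > 0" for i using that by (simp add: palindromic_def)
  then have "g = [:coeff g 0:]" by (intro poly_eqI) (auto simp: coeff_pCons split: nat.split)
  then have "\<not> int p dvd poly g 1" using 0(2) by (metis const_poly_dvd_const_poly_iff poly_const)
  then have "order_mod p g 0" unfolding order_mod_def by (intro exI[of _ g] exI[of _ 0]) auto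
  then show ?case by auto
next
  case (Suc K)
  let ?L = "[:-1, 1:] ^ (2 * Suc K) :: int poly"
  define b where "b = coeff g 0"
  define g0 where "g0 = g - smult b ?L"
  have L: "palindromic (Suc K) ?L" by (rule palindromic_linear_power)
  have L1: "coeff ?L 0 = 1" by (simp add: coeff_linear_poly_power)
  have g0: "palindromic (Suc K) g0"
  proof -
    have "g0 = g + smult (- b) ?L" unfolding g0_def smult_minus_left by simp
    then show ?thesis using palindromic_add[OF Suc.prems(1) palindromic_smult[OF L]] by metis
  qed
  have g00: "coeff g0 0 = 0" by (simp add: g0_def b_def L1 del: power_Suc mult_Suc_right)
  define g' where "g' = poly_shift 1 g0"
  have g'c: "coeff g' i = coeff g0 (Suc i)" for i by (simp add: g'_def coeff_poly_shift)
  have g0': "g0 = monom 1 1 * g'"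
  proof (rule poly_eqI)
    fix i
    show "coeff g0 i = coeff (monom 1 1 * g') i"
      by (cases i) (simp_all add: g'c g00 coeff_monom_mult)
  qed
  have pal': "palindromic K g'"
    unfolding palindromic_def
  proof
    fix i
    have *: "coeff g0 (Suc i) = (if Suc i \<le> 2 * Suc K then coeff g0 (2 * Suc K - Suc i) else 0)"
      using g0 unfolding palindromic_def by blast
    show "coeff g' i = (if i \<le> 2 * K then coeff g' (2 * K - i) else 0)"
    proof (cases "i \<le> 2 * K")
      case True
      then have "2 * Suc K - Suc i = Suc (2 * K - i)" by simp
      then show ?thesis using * True by (simp add: g'c)
    next
      case False
      then consider "i = 2 * K + 1" | "i > 2 * K + 1" by linarith
      then show ?thesis using * False g00 by cases (simp_all add: g'c)
    qed
  qed
  have g: "g = monom 1 1 * g' + smult b ?L" using g0' by (simp add: g0_def)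
  show ?case
  proof (cases "[:int p:] dvd g'")
    case False
    then obtain j s r where j: "j \<le> K" and h: "g' = [:-1, 1:] ^ (2 * j) * s + smult (int p) r"
      and s: "\<not> int p dvd poly s 1"
      using Suc.IH[OF pal'] by (auto simp: order_mod_def)
    have e: "2 * Suc K = 2 * j + (2 * Suc K - 2 * j)" using j by simp
    have "?L = [:-1, 1:] ^ (2 * j) * [:-1, 1:] ^ (2 * Suc K - 2 * j)"
      by (subst e) (rule power_add)
    then have "g = [:-1, 1:] ^ (2 * j) * (monom 1 1 * s + smult b ([:-1, 1:] ^ (2 * Suc K - 2 * j)))
       + smult (int p) (monom 1 1 * r)"
      unfolding g h by (simp only: algebra_simps mult_smult_right mult_smult_left)
    moreover have "poly (monom 1 1 * s + smult b ([:-1, 1:] ^ (2 * Suc K - 2 * j))) 1 = poly s 1"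
      using j by (simp add: poly_monom power_0_left)
    ultimately have "order_mod p g (2 * j)"
      unfolding order_mod_def using s by metis
    then show ?thesis using j by (intro exI[of _ j]) simp
  next
    case True
    then obtain t where t: "g' = [:int p:] * t" unfolding dvd_def by blast
    have "\<not> int p dvd b"
    proof
      assume "int p dvd b"
      then have "[:int p:] dvd smult b ?L" by (simp add: const_poly_dvd_iff del: power_Suc mult_Suc_right)
      then have "[:int p:] dvd g" unfolding g using True by (intro dvd_add dvd_mult)
      then show False using Suc.prems(2) by simp
    qed
    moreover have "g = ?L * [:b:] + smult (int p) (monom 1 1 * t)"
      unfolding g t by simp
    ultimately have "order_mod p g (2 * Suc K)"
      unfolding order_mod_def by (metis poly_const)
    then show ?thesis by blast
  qed
qed

section \<open>Coherent families of symmetric polynomials\<close>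

lemma palindromic_sum: "(\<And>i. i \<in> A \<Longrightarrow> palindromic K (F i)) \<Longrightarrow> palindromic K (sum F A)"
  by (induction A rule: infinite_finite_induct) (auto simp: palindromic_add, simp_all add: palindromic_def)

lemma palindromic_monom_pair:
  assumes "i \<le> K"
  shows "palindromic K (monom 1 (K + i) + monom 1 (K - i))"
  unfolding palindromic_def
proof (intro allI)
  fix k
  have "K + i = k \<longleftrightarrow> k \<le> 2 * K \<and> K - i = 2 * K - k" "K - i = k \<longleftrightarrow> k \<le> 2 * K \<and> K + i = 2 * K - k"
    using assms by linarith+
  then show "coeff (monom 1 (K + i) + monom 1 (K - i)) k =
    (if k \<le> 2 * K then coeff (monom 1 (K + i) + monom 1 (K - i)) (2 * K - k) else (0::int))"
    by (auto simp: coeff_monom)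
qed

lemma palindromic_monom: "palindromic K (monom 1 K)"
  unfolding palindromic_def by (auto simp: coeff_monom)

lemma ceval_eq_sum:
  assumes "degree q < N"
  shows "ceval q z = (\<Sum>i<N. of_int (coeff q i) * z ^ i)"
proof -
  have "(\<Sum>i<N. monom (coeff q i) i) = q"
    using assms by (metis Suc_pred' gr_implies_not0 lessThan_Suc_atMost less_Suc_eq_le not_gr0 poly_as_sum_of_monoms')
  then have "ceval q z = ceval (\<Sum>i<N. monom (coeff q i) i) z" by simp
  then show ?thesis by simp
qed

lemma coeff_symmetric:
  assumes deg: "degree q < N" and sym: "\<And>z. z \<in> unity_roots N \<Longrightarrow> ceval q (inverse z) = ceval q z"
    and i: "0 < i" "i < N"
  shows "coeff q (N - i) = coeff q i"
proof -
  have N: "N > 0" using i by simp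
  define R where "R = (\<Sum>j<N. monom (coeff q j) ((N - j) mod N))"
  have "degree R \<le> N - 1"
    unfolding R_def
  proof (rule degree_sum_le)
    fix j
    have "degree (monom (coeff q j) ((N - j) mod N)) \<le> (N - j) mod N" by (rule degree_monom_le)
    also have "\<dots> \<le> N - 1" using N mod_less_divisor[of N "N - j"] by linarith
    finally show "degree (monom (coeff q j) ((N - j) mod N)) \<le> N - 1" .
  qed simp
  then have degR: "degree R < N" using N by simp
  have "R = q"
  proof (rule int_poly_eq_on_unity_roots[OF N degR deg])
    fix z assume z: "z \<in> unity_roots N"
    then have z0: "z \<noteq> 0" using N by (auto simp: power_0_left)
    have "z ^ ((N - j) mod N) = inverse z ^ j" if "j < N" for j
    proof -
      have "z ^ ((N - j) mod N) = z ^ (N - j)"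
        using z by (intro power_mod_unity_root) simp
      moreover have "z ^ (N - j) * z ^ j = 1"
        using z that by (simp add: power_add[symmetric])
      ultimately show ?thesis using z0 by (simp add: field_simps)
    qed
    then have "ceval R z = ceval q (inverse z)"
      by (simp add: R_def ceval_eq_sum[OF deg])
    then show "ceval R z = ceval q z" using sym[OF z] by simp
  qed
  have "coeff R i = (\<Sum>j<N. if j = N - i then coeff q j else 0)"
    unfolding R_def coeff_sum
  proof (intro sum.cong refl)
    fix j assume "j \<in> {..<N}"
    then have "(N - j) mod N = i \<longleftrightarrow> j = N - i" using i by (cases "j = 0") auto
    then show "coeff (monom (coeff q j) ((N - j) mod N)) i = (if j = N - i then coeff q j else 0)"
      by (simp add: coeff_monom)
  qed
  then show ?thesis using i \<open>R = q\<close> by simp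
qed

text \<open>
  A symmetric element of \<open>\<int>[x] / (x\<^bsup>pN\<^esup> - 1)\<close> is a combination of \<open>1\<close>, of the \<open>x\<^sup>i + x\<^bsup>-i\<^esup>\<close> and, if
  \<open>p = 2\<close>, of \<open>x\<^sup>N\<close>, which is its own inverse.  The last one prevents a palindromic representative, but
  it becomes \<open>1\<close> on the \<open>N\<close>-th roots of unity; this is why one level is lost.
\<close>

lemma symmetric_palindromic:
  assumes p: "prime p" and deg: "degree q < p ^ Suc m"
    and sym: "\<And>z. z \<in> unity_roots (p ^ Suc m) \<Longrightarrow> ceval q (inverse z) = ceval q z"
  shows "\<exists>G. palindromic (p ^ Suc m) G \<and> (\<forall>z\<in>unity_roots (p ^ m). ceval G z = ceval q z)"
proof -
  let ?N = "p ^ m" and ?K = "p ^ Suc m"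
  let ?c = "coeff q"
  define A where "A = {i. 0 < i \<and> 2 * i < ?K}"
  define B where "B = {i. i < ?K \<and> ?K < 2 * i}"
  define C where "C = {i. 0 < i \<and> ?K = 2 * i}"
  have fin: "finite A" "finite B" "finite C"
    by (rule finite_subset[of _ "{..<?K + 1}"]; force simp: A_def B_def C_def)+
  have K0: "?K > 0" using prime_gt_0_nat[OF p] by simp
  have split: "{..<?K} = insert 0 (A \<union> B \<union> C)"
    using K0 by (auto simp: A_def B_def C_def)
  have disj: "0 \<notin> A \<union> B \<union> C" "A \<inter> B = {}" "(A \<union> B) \<inter> C = {}"
    by (auto simp: A_def B_def C_def)
  define d where "d = ?c 0 + (\<Sum>i\<in>C. ?c i)"
  \<comment> \<open>The exponents are shifted by \<open>?K\<close>, which does not change the values at the roots of unity.\<close>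
  define G where "G = smult d (monom 1 ?K) + (\<Sum>i\<in>A. smult (?c i) (monom 1 (?K + i) + monom 1 (?K - i)))"
  have "palindromic ?K G"
    unfolding G_def
    by (intro palindromic_add palindromic_smult palindromic_monom palindromic_sum palindromic_monom_pair)
      (auto simp: A_def)
  moreover have "ceval G z = ceval q z" if z: "z \<in> unity_roots ?N" for z
  proof -
    have zN: "z ^ ?N = 1" using z by simp
    have zK: "z ^ ?K = 1" using zN by (simp add: power_mult mult.commute[of p])
    have B: "(\<Sum>i\<in>B. of_int (?c i) * z ^ i) = (\<Sum>i\<in>A. of_int (?c i) * z ^ (?K - i))"
      by (rule sum.reindex_bij_witness[of _ "\<lambda>i. ?K - i" "\<lambda>i. ?K - i"])
        (use coeff_symmetric[OF deg sym] in \<open>auto simp: A_def B_def\<close>)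
    have C: "(\<Sum>i\<in>C. of_int (?c i) * z ^ i) = (\<Sum>i\<in>C. of_int (?c i))"
    proof (intro sum.cong refl)
      fix i assume "i \<in> C"
      then have i: "?K = 2 * i" by (simp add: C_def)
      then have "2 dvd p ^ Suc m" by (metis dvd_triv_left)
      then have "2 dvd p" using prime_dvd_power two_is_prime_nat by blast
      then have "p = 2" using p by (metis primes_dvd_imp_eq two_is_prime_nat)
      then have "i = ?N" using i by simp
      then show "of_int (?c i) * z ^ i = (of_int (?c i) :: complex)" using zN by simp
    qed
    have "ceval q z = (\<Sum>i\<in>insert 0 (A \<union> B \<union> C). of_int (?c i) * z ^ i)"
      using ceval_eq_sum[OF deg, of z] split by simp
    also have "\<dots> = of_int (?c 0) + ((\<Sum>i\<in>A. of_int (?c i) * z ^ i) + (\<Sum>i\<in>B. of_int (?c i) * z ^ i)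
      + (\<Sum>i\<in>C. of_int (?c i) * z ^ i))"
      using fin disj by (simp add: sum.union_disjoint)
    also have "\<dots> = of_int d + (\<Sum>i\<in>A. of_int (?c i) * (z ^ i + z ^ (?K - i)))"
      unfolding B C d_def by (simp add: sum.distrib distrib_left)
    also have "\<dots> = ceval G z"
      using zK by (simp add: G_def power_add)
    finally show ?thesis by simp
  qed
  ultimately show ?thesis by blast
qed

lemma const_dvd_cyclic_reduction:
  assumes "N > 0" "[:c:] dvd a"
  shows "[:c:] dvd cyclic_reduction N a"
proof -
  obtain b where "a = [:c:] * b" using assms(2) by (rule dvdE)
  then have "cyclic_reduction N a = [:c:] * cyclic_reduction N b"
    by (simp add: cyclic_reduction_smult[OF assms(1)])
  then show ?thesis by (metis dvd_triv_left)
qed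

text \<open>
  Reduce \<open>f\<^sub>m\<close> modulo \<open>x\<^bsup>p^m\<^esup> - 1\<close>.  A power of \<open>p\<close> that divides the reduction at one level divides it at
  all lower levels, so the largest power that divides all of them is attained at every high level; this
  is \<open>\<mu>\<close>.  The quotients \<open>h\<^sub>m\<close> are again congruent to each other modulo \<open>x\<^bsup>p^m\<^esup> - 1\<close>.  As the degree of
  \<open>h\<^sub>m\<close> is less than \<open>p\<^sup>m\<close>, so is its order at \<open>1\<close> modulo \<open>p\<close>, and therefore the order is the same at all
  higher levels.
\<close>

theorem coherent_symmetric_family:
  fixes f :: "nat \<Rightarrow> int poly"
  assumes p: "prime p"
    and coh: "\<And>m z. z \<in> unity_roots (p ^ m) \<Longrightarrow> ceval (f (Suc m)) z = ceval (f m) z"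
    and sym: "\<And>m z. z \<in> unity_roots (p ^ m) \<Longrightarrow> ceval (f m) (inverse z) = ceval (f m) z"
    and nz: "z0 \<in> unity_roots (p ^ m0)" "ceval (f m0) z0 \<noteq> 0"
  obtains \<mu> l m1 h where "even l" "l < p ^ m1" "\<And>m. m \<ge> m1 \<Longrightarrow> order_mod p (h m) l"
    "\<And>m z. z \<in> unity_roots (p ^ m) \<Longrightarrow> ceval (f m) z = of_nat p ^ \<mu> * ceval (h m) z"
proof -
  have N: "p ^ m > 0" for m using prime_gt_0_nat[OF p] by simp
  have p1: "p > 1" using prime_gt_1_nat[OF p] .
  have up: "z \<in> unity_roots (p ^ Suc m)" if "z \<in> unity_roots (p ^ m)" for z m
    using that by (simp add: power_mult mult.commute[of p])
  define g where "g m = cyclic_reduction (p ^ m) (f m)" for m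
  have g_eval: "ceval (g m) z = ceval (f m) z" if "z \<in> unity_roots (p ^ m)" for m z
    using that by (simp add: g_def ceval_cyclic_reduction)
  have g_deg: "degree (g m) < p ^ m" for m
    unfolding g_def by (rule degree_cyclic_reduction[OF N])
  have g_step: "cyclic_reduction (p ^ m) (g (Suc m)) = g m" for m
  proof (rule cyclic_reduction_eqI[OF N g_deg])
    fix z assume z: "z \<in> unity_roots (p ^ m)"
    show "ceval (g m) z = ceval (g (Suc m)) z"
      using g_eval[OF z] g_eval[OF up[OF z]] coh[OF z] by simp
  qed
  have g0: "g m0 \<noteq> 0" using g_eval[OF nz(1)] nz(2) by (auto simp: ceval_def)
  define S where "S = {c. \<forall>m. [:int p ^ c:] dvd g m}"
  have "0 \<in> S" by (simp add: S_def one_pCons[symmetric])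
  have "finite S"
  proof -
    obtain i where i: "coeff (g m0) i \<noteq> 0" using g0 by (metis leading_coeff_0_iff)
    have "c \<le> nat \<bar>coeff (g m0) i\<bar>" if "c \<in> S" for c
    proof -
      have "int p ^ c dvd coeff (g m0) i" using that by (simp add: S_def const_poly_dvd_iff)
      then have "int p ^ c \<le> \<bar>coeff (g m0) i\<bar>"
        using dvd_imp_le_int[OF i] by fastforce
      moreover have "c < p ^ c"
        by (rule order_less_le_trans[OF less_exp[of c] power_mono[of 2 p c]]) (use p1 in simp_all)
      then have "int c < int p ^ c" by (metis of_nat_less_iff of_nat_power)
      ultimately show ?thesis by linarith
    qed
    then show ?thesis by (meson finite_nat_set_iff_bounded_le)
  qed
  define \<mu> where "\<mu> = Max S"
  have "\<mu> \<in> S" unfolding \<mu>_def using \<open>finite S\<close> \<open>0 \<in> S\<close> by (intro Max_in) auto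
  moreover have "Suc \<mu> \<notin> S" using Max_ge[OF \<open>finite S\<close>, of "Suc \<mu>"] by (auto simp: \<mu>_def)
  ultimately have dvd: "\<And>m. [:int p ^ \<mu>:] dvd g m" and "\<exists>m. \<not> [:int p ^ Suc \<mu>:] dvd g m"
    unfolding S_def by blast+
  then obtain m1 where m1: "\<not> [:int p ^ Suc \<mu>:] dvd g m1" by blast
  have ndvd: "\<not> [:int p ^ Suc \<mu>:] dvd g m" if "m \<ge> m1" for m
    using that
  proof (induction m rule: dec_induct)
    case (step m)
    then show ?case using const_dvd_cyclic_reduction[OF N, of _ "g (Suc m)" m] g_step[of m] by auto
  qed (rule m1)
  have "\<exists>h. \<forall>m. g m = smult (int p ^ \<mu>) (h m)"
  proof (rule choice, rule allI)
    fix m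
    obtain k where "g m = [:int p ^ \<mu>:] * k" using dvd[of m] by (rule dvdE)
    then show "\<exists>k. g m = smult (int p ^ \<mu>) k" by auto
  qed
  then obtain h where h: "\<And>m. g m = smult (int p ^ \<mu>) (h m)" by blast
  have pm0: "int p ^ \<mu> \<noteq> 0" using p1 by simp
  have h_deg: "degree (h m) < p ^ m" for m using g_deg[of m] pm0 p1 by (simp add: h)
  have h_step: "cyclic_reduction (p ^ m) (h (Suc m)) = h m" for m
  proof -
    have "smult (int p ^ \<mu>) (cyclic_reduction (p ^ m) (h (Suc m))) = smult (int p ^ \<mu>) (h m)"
      using g_step[of m] by (simp add: h cyclic_reduction_smult[OF N])
    then show ?thesis using pm0 by (metis smult_cancel)
  qed
  have h_ndvd: "\<not> [:int p:] dvd h m" if "m \<ge> m1" for m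
  proof
    assume "[:int p:] dvd h m"
    then obtain k where "h m = [:int p:] * k" by (rule dvdE)
    then have "g m = [:int p ^ Suc \<mu>:] * k" by (simp add: h mult.commute)
    then show False using ndvd[OF that] by (metis dvd_triv_left)
  qed
  have h_eval: "ceval (f m) z = of_nat p ^ \<mu> * ceval (h m) z" if "z \<in> unity_roots (p ^ m)" for m z
    using g_eval[OF that] by (simp add: h)
  have h_sym: "ceval (h m) (inverse z) = ceval (h m) z" if z: "z \<in> unity_roots (p ^ m)" for m z
  proof -
    have "inverse z \<in> unity_roots (p ^ m)" using z by (simp add: power_inverse)
    then show ?thesis using h_eval[OF z] h_eval[of "inverse z" m] sym[OF z] p1 by simp
  qed
  obtain l where l: "l \<le> degree (h m1)" "order_mod p (h m1) l"
    using order_mod_exists[OF h_ndvd[OF order_refl]] by blast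
  have lN: "l < p ^ m1" using l(1) h_deg[of m1] by simp
  have "even l"
  proof -
    obtain G where G: "palindromic (p ^ Suc m1) G"
      "\<And>z. z \<in> unity_roots (p ^ m1) \<Longrightarrow> ceval G z = ceval (h (Suc m1)) z"
      using symmetric_palindromic[OF p h_deg h_sym, of m1] by blast
    have "ceval (h m1) z = ceval G z" if "z \<in> unity_roots (p ^ m1)" for z
      using G(2)[OF that] ceval_cyclic_reduction[of z "p ^ m1" "h (Suc m1)"] that
      unfolding h_step by simp
    then have "cyclic_reduction (p ^ m1) G = h m1"
      by (rule cyclic_reduction_eqI[OF N h_deg])
    then have "monom 1 (p ^ m1) - 1 dvd G - h m1"
      using dvd_sub_cyclic_reduction[of "p ^ m1" G] by simp
    then have Gl: "order_mod p G l" by (rule order_mod_cong[OF p l(2) lN])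
    obtain j where "order_mod p G (2 * j)"
      using palindromic_order_even[OF p G(1) order_mod_not_dvd[OF p Gl]] by blast
    then have "l = 2 * j" using Gl order_mod_unique_le[OF p] by (metis order_antisym)
    then show ?thesis by simp
  qed
  moreover have "order_mod p (h m) l" if "m \<ge> m1" for m
    using that
  proof (induction m rule: dec_induct)
    case (step m)
    have "p ^ m1 \<le> p ^ m" using step(1) p1 by (simp add: power_increasing)
    then have "l < p ^ m" using lN by simp
    moreover have "monom 1 (p ^ m) - 1 dvd h (Suc m) - h m"
      using dvd_sub_cyclic_reduction[of "p ^ m" "h (Suc m)"] unfolding h_step .
    ultimately show ?case by (rule order_mod_cong[OF p step.IH])
  qed (rule l(2))
  ultimately show thesis using lN h_eval that by blast
qed

section \<open>Products over primitive roots of unity\<close>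

lemma poly_prod_unity_roots:
  assumes N: "N > 0"
  shows "(\<Prod>z\<in>unity_roots N. [:-z, 1:]) = monom 1 N - 1"
proof (rule ccontr)
  let ?S = "unity_roots N" and ?P = "(\<Prod>z\<in>unity_roots N. [:-z, 1:])"
  assume "?P \<noteq> monom 1 N - 1"
  then have D0: "?P - (monom 1 N - 1) \<noteq> 0" by simp
  have fin: "finite ?S" using N by (intro finite_roots_unity) simp
  have card: "card ?S = N" by (rule card_roots_unity_eq[OF N])
  have deg: "degree ?P = N"
    using card by (simp add: degree_prod_eq_sum_degree)
  have lead: "coeff ?P N = 1"
    using lead_coeff_prod[of "\<lambda>z. [:-z, 1:]" ?S] deg by simp
  have "degree (?P - (monom 1 N - 1)) \<le> N - 1"
  proof (rule degree_le, intro allI impI)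
    fix i assume "N - 1 < i"
    then consider "i = N" | "i > N" by linarith
    then show "coeff (?P - (monom 1 N - 1)) i = 0"
    proof cases
      case 1
      then show ?thesis using lead N by (simp add: coeff_monom)
    next
      case 2
      then show ?thesis using deg by (simp add: coeff_eq_0)
    qed
  qed
  moreover have "?S \<subseteq> {z. poly (?P - (monom 1 N - 1)) z = 0}"
    using fin by (auto simp: poly_prod poly_monom)
  then have "card ?S \<le> card {z. poly (?P - (monom 1 N - 1)) z = 0}"
    by (intro card_mono poly_roots_finite[OF D0])
  then have "N \<le> degree (?P - (monom 1 N - 1))"
    using card card_poly_roots_bound[OF D0] by simp
  ultimately show False using N by linarith
qed

lemma prod_one_minus_unity_roots:
  assumes N: "N > 0"
  shows "(\<Prod>z\<in>unity_roots N - {1}. 1 - z) = of_nat N"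
proof -
  let ?Q = "(\<Prod>z\<in>unity_roots N - {1}. [:-z, 1:])"
  have fin: "finite (unity_roots N)" using N by (intro finite_roots_unity) simp
  have "[:-1, 1:] * ?Q = monom 1 N - 1"
    unfolding poly_prod_unity_roots[OF N, symmetric] by (rule prod.remove[OF fin, symmetric]) simp
  also have "monom 1 N - 1 = (monom 1 1 - 1) * (\<Sum>i<N. monom 1 1 ^ i :: complex poly)"
    using N by (metis monom_power mult.left_neutral power_diff_1_eq power_one neq0_conv)
  also have "monom 1 1 - 1 = [:-1, 1 :: complex:]" by (simp add: monom_Suc one_pCons)
  finally have "[:-1, 1:] * ?Q = [:-1, 1:] * (\<Sum>i<N. monom 1 1 ^ i)" .
  moreover have "[:-1, 1 :: complex:] \<noteq> 0" by simp
  ultimately have "?Q = (\<Sum>i<N. monom 1 1 ^ i)" unfolding mult_cancel_left by blast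
  then have "poly ?Q 1 = of_nat N" by (simp add: poly_sum poly_monom)
  then show ?thesis by (simp add: poly_prod)
qed

definition primitive_roots :: "nat \<Rightarrow> nat \<Rightarrow> complex set" where
  "primitive_roots p m = unity_roots (p ^ Suc m) - unity_roots (p ^ m)"

lemma unity_roots_mono: "unity_roots (p ^ m) \<subseteq> unity_roots (p ^ Suc m)"
  by (auto simp: power_mult mult.commute[of p])

lemma finite_primitive_roots:
  assumes "p > 0"
  shows "finite (primitive_roots p m)"
  unfolding primitive_roots_def using assms by (intro finite_Diff finite_roots_unity) simp

lemma card_primitive_roots:
  assumes "p > 0"
  shows "card (primitive_roots p m) = p ^ Suc m - p ^ m"
  unfolding primitive_roots_def using assms unity_roots_mono[of p m] finite_roots_unity[of "p ^ m"]
  by (subst card_Diff_subset) (simp_all add: card_roots_unity_eq)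

lemma prod_unity_roots_split:
  fixes F :: "complex \<Rightarrow> complex"
  assumes "p > 0"
  shows "(\<Prod>z\<in>unity_roots (p ^ Suc m). F z) = (\<Prod>z\<in>unity_roots (p ^ m). F z) * (\<Prod>z\<in>primitive_roots p m. F z)"
proof -
  have "finite (unity_roots (p ^ Suc m))" using assms by (intro finite_roots_unity) simp
  then show ?thesis unfolding primitive_roots_def
    using prod.subset_diff[OF unity_roots_mono[of p m], of F] by (simp add: mult.commute)
qed

lemma prod_one_minus_primitive_roots:
  assumes p: "p > 0"
  shows "(\<Prod>z\<in>primitive_roots p m. 1 - z) = of_nat p"
proof -
  have fin: "finite (unity_roots (p ^ k))" for k using p by (intro finite_roots_unity) simp
  have e: "unity_roots (p ^ Suc m) - {1} = (unity_roots (p ^ m) - {1}) \<union> primitive_roots p m"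
    using unity_roots_mono[of p m] by (auto simp: primitive_roots_def)
  have "of_nat (p ^ Suc m) = (\<Prod>z\<in>unity_roots (p ^ Suc m) - {1}. 1 - z)"
    using p by (intro prod_one_minus_unity_roots[symmetric]) simp
  also have "\<dots> = (\<Prod>z\<in>unity_roots (p ^ m) - {1}. 1 - z) * (\<Prod>z\<in>primitive_roots p m. 1 - z)"
    unfolding e using fin finite_primitive_roots[OF p]
    by (intro prod.union_disjoint) (auto simp: primitive_roots_def)
  also have "(\<Prod>z\<in>unity_roots (p ^ m) - {1}. 1 - z) = of_nat (p ^ m)"
    using p by (intro prod_one_minus_unity_roots) simp
  finally show ?thesis using p by simp
qed

text \<open>
  The cyclotomic polynomial \<open>\<Phi>\<close> of level \<open>p\<^bsup>m+1\<^esup>\<close> is \<open>(x - 1)\<^sup>\<phi> + p v\<close> with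
  \<open>\<phi> = p\<^bsup>m+1\<^esup> - p\<^sup>m\<close>, and \<open>v\<close> takes the value \<open>1\<close> at
  \<open>1\<close> because \<open>\<Phi>(1) = p\<close>.  This is the statement that \<open>p\<close> is \<open>(z - 1)\<^sup>\<phi>\<close> up to a unit at \<open>p\<close>.
\<close>

lemma cyclotomic_mod_prime:
  assumes p: "prime p"
  shows "\<exists>v. poly v 1 = 1 \<and>
    (\<forall>z\<in>primitive_roots p m. (z - 1) ^ (p ^ Suc m - p ^ m) = - of_nat p * ceval v z)"
proof -
  let ?x = "[:-1, 1:] :: int poly" and ?q = "p ^ m" and ?N = "p ^ Suc m"
  define \<phi> where "\<phi> = ?N - ?q"
  have p1: "p > 1" using prime_gt_1_nat[OF p] .
  have "?q < ?N" using p1 by (intro power_strict_increasing) auto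
  then have Nq: "?N = ?q + \<phi>" "\<phi> > 0" unfolding \<phi>_def by linarith+
  define \<Phi> where "\<Phi> = (\<Sum>i<p. monom 1 ?q ^ i :: int poly)"
  have \<Phi>: "(monom 1 ?q - 1) * \<Phi> = monom 1 ?N - 1"
    using p1 power_diff_1_eq[of "monom 1 ?q :: int poly" p]
    by (simp add: \<Phi>_def monom_power mult.commute)
  obtain w1 where w1: "monom 1 ?q - 1 = ?x ^ ?q + smult (int p) w1"
    using monom_diff_one_mod_prime[OF p] by blast
  obtain w2 where w2: "monom 1 ?N - 1 = ?x ^ ?N + smult (int p) w2"
    using monom_diff_one_mod_prime[OF p] by blast
  have "(?x ^ ?q + smult (int p) w1) * \<Phi> = ?x ^ ?q * ?x ^ \<phi> + smult (int p) w2"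
    using \<Phi> unfolding w1 w2 by (simp only: Nq(1) power_add)
  then have "?x ^ ?q * (\<Phi> - ?x ^ \<phi>) = [:int p:] * (w2 - w1 * \<Phi>)"
    by (simp add: algebra_simps smult_diff_right)
  then have "[:int p:] dvd ?x ^ ?q * (\<Phi> - ?x ^ \<phi>)" by (metis dvd_triv_left)
  then have "[:int p:] dvd \<Phi> - ?x ^ \<phi>"
    using const_not_dvd_linear[OF p] prime_elem_const_int_poly[OF p] by (meson prime_elem_dvd_mult_iff)
  then obtain v where v: "\<Phi> - ?x ^ \<phi> = [:int p:] * v" by (rule dvdE)
  have "poly (\<Phi> - ?x ^ \<phi>) 1 = poly ([:int p:] * v) 1" by (simp only: v)
  then have "poly v 1 = 1"
    using Nq(2) p1 by (simp add: \<Phi>_def poly_sum poly_monom power_0_left)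
  moreover have "(z - 1) ^ \<phi> = - of_nat p * ceval v z" if z: "z \<in> primitive_roots p m" for z
  proof -
    have one: "ceval 1 z = 1" by (simp add: ceval_def)
    have x: "ceval ?x z = z - 1" by (simp add: ceval_def)
    have "ceval ((monom 1 ?q - 1) * \<Phi>) z = 0"
      unfolding \<Phi> using z by (simp add: primitive_roots_def one)
    then have "ceval \<Phi> z = 0" using z by (simp add: primitive_roots_def one)
    then have "ceval ([:int p:] * v) z = - ((z - 1) ^ \<phi>)"
      unfolding v[symmetric] by (simp add: x del: power_Suc)
    then show ?thesis by simp
  qed
  ultimately show ?thesis unfolding \<phi>_def by blast
qed

text \<open>
  Write \<open>h = (x - 1)\<^sup>l s + p r\<close>.  At a primitive root \<open>z\<close> the number \<open>p v(z)\<close> is \<open>- (z - 1)\<^sup>\<phi>\<close>, so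
  \<open>h(z) v(z) = (z - 1)\<^sup>l W(z)\<close> for an integer polynomial \<open>W\<close> with \<open>W(1) = s(1)\<close>.  Products of \<open>v\<close> and
  \<open>W\<close> over primitive roots are quotients of integers prime to \<open>p\<close>, and the product of the \<open>z - 1\<close> is
  \<open>p\<close> up to sign.
\<close>

theorem prod_primitive_roots_valuation:
  assumes p: "prime p" and h: "order_mod p h l" and l: "l < p ^ Suc m - p ^ m"
  obtains A B :: int where "\<not> int p dvd A" "\<not> int p dvd B"
    "of_int A * (\<Prod>z\<in>primitive_roots p m. ceval h z) = of_int B * of_nat p ^ l"
proof -
  let ?x = "[:-1, 1:] :: int poly" and ?Z = "primitive_roots p m"
  define \<phi> where "\<phi> = p ^ Suc m - p ^ m"
  have p0: "p > 0" using prime_gt_0_nat[OF p] .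
  have pp: "prime (int p)" using p by simp
  obtain s r where hs: "h = ?x ^ l * s + smult (int p) r" and s: "\<not> int p dvd poly s 1"
    using h by (auto simp: order_mod_def)
  obtain v where v1: "poly v 1 = 1" and v: "\<And>z. z \<in> ?Z \<Longrightarrow> (z - 1) ^ \<phi> = - of_nat p * ceval v z"
    using cyclotomic_mod_prime[OF p, of m] unfolding \<phi>_def by blast
  define W where "W = s * v - ?x ^ (\<phi> - l) * r"
  have W1: "poly W 1 = poly s 1"
    using l by (simp add: W_def v1 \<phi>_def power_0_left)
  have x: "ceval ?x z = z - 1" for z by (simp add: ceval_def)
  have key: "ceval h z * ceval v z = (z - 1) ^ l * ceval W z" if z: "z \<in> ?Z" for z
  proof -
    have "(z - 1) ^ l * (z - 1) ^ (\<phi> - l) = (z - 1) ^ \<phi>"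
      using l by (simp add: power_add[symmetric] \<phi>_def)
    then have e: "(z - 1) ^ l * (z - 1) ^ (\<phi> - l) = - of_nat p * ceval v z" using v[OF z] by simp
    have "(z - 1) ^ l * ceval W z = (z - 1) ^ l * (ceval s z * ceval v z)
      - ((z - 1) ^ l * (z - 1) ^ (\<phi> - l)) * ceval r z"
      by (simp add: W_def x algebra_simps)
    also have "\<dots> = ceval h z * ceval v z"
      unfolding e by (simp add: hs x algebra_simps)
    finally show ?thesis by simp
  qed
  let ?c = "\<lambda>k q. circulant_det (p ^ k) q"
  have c: "complex_of_int (?c (Suc m) q) = of_int (?c m q) * (\<Prod>z\<in>?Z. ceval q z)" for q
    using p0 prod_unity_roots_split[OF p0, of "ceval q" m] by (simp add: of_int_circulant_det)
  have nd: "\<not> int p dvd ?c k v" "\<not> int p dvd ?c k W" for k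
  proof -
    have "\<not> int p dvd poly v 1" using v1 prime_gt_1_nat[OF p] by simp
    then show "\<not> int p dvd ?c k v" by (rule prime_not_dvd_circulant_det[OF p])
    have "\<not> int p dvd poly W 1" using W1 s by simp
    then show "\<not> int p dvd ?c k W" by (rule prime_not_dvd_circulant_det[OF p])
  qed
  define A where "A = ?c (Suc m) v * ?c m W"
  define B where "B = (- 1) ^ (\<phi> * l) * ?c m v * ?c (Suc m) W"
  have "\<not> int p dvd A" unfolding A_def prime_dvd_mult_iff[OF pp] using nd by blast
  moreover have "\<not> int p dvd B"
  proof
    assume "int p dvd B"
    then have "int p dvd ?c m v * ?c (Suc m) W"
      unfolding B_def by (simp add: minus_one_power_iff split: if_splits)
    then show False unfolding prime_dvd_mult_iff[OF pp] using nd by blast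
  qed
  moreover have "of_int A * (\<Prod>z\<in>?Z. ceval h z) = of_int B * of_nat p ^ l"
  proof -
    have "(\<Prod>z\<in>?Z. z - 1) = (\<Prod>z\<in>?Z. - 1 * (1 - z))" by simp
    also have "\<dots> = (- 1) ^ \<phi> * of_nat p"
      unfolding prod.distrib prod_one_minus_primitive_roots[OF p0]
      by (simp add: card_primitive_roots[OF p0] \<phi>_def)
    finally have z1: "(\<Prod>z\<in>?Z. (z - 1) ^ l) = (- 1) ^ (\<phi> * l) * of_nat p ^ l"
      by (simp add: prod_power_distrib[symmetric] power_mult_distrib power_mult)
    have "of_int A * (\<Prod>z\<in>?Z. ceval h z) =
      of_int (?c m v) * of_int (?c m W) * ((\<Prod>z\<in>?Z. ceval h z) * (\<Prod>z\<in>?Z. ceval v z))"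
      unfolding A_def of_int_mult c[of v] by (simp add: mult_ac)
    also have "(\<Prod>z\<in>?Z. ceval h z) * (\<Prod>z\<in>?Z. ceval v z) = (\<Prod>z\<in>?Z. (z - 1) ^ l) * (\<Prod>z\<in>?Z. ceval W z)"
      unfolding prod.distrib[symmetric] using key by (intro prod.cong) auto
    also have "of_int (?c m v) * of_int (?c m W) * \<dots> = of_int B * of_nat p ^ l"
      unfolding z1 B_def of_int_mult c[of W] by (simp add: mult_ac)
    finally show ?thesis .
  qed
  ultimately show thesis by (rule that)
qed

text \<open>
  The value at \<open>1\<close> is the same at all levels; if it is zero, then \<open>f\<close> has a zero at the trivial
  character and its order is positive.
\<close>

theorem coherent_family_valuation:
  fixes f :: "nat \<Rightarrow> int poly"
  assumes p: "prime p"
    and coh: "\<And>m z. z \<in> unity_roots (p ^ m) \<Longrightarrow> ceval (f (Suc m)) z = ceval (f m) z"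
    and sym: "\<And>m z. z \<in> unity_roots (p ^ m) \<Longrightarrow> ceval (f m) (inverse z) = ceval (f m) z"
    and nz: "z0 \<in> unity_roots (p ^ m0)" "ceval (f m0) z0 \<noteq> 0"
  obtains \<mu> l m1 where "even l" "ceval (f 0) 1 = 0 \<Longrightarrow> l > 0"
    "\<And>m. m \<ge> m1 \<Longrightarrow> \<exists>A B :: int. \<not> int p dvd A \<and> \<not> int p dvd B \<and>
       of_int A * (\<Prod>z\<in>primitive_roots p m. ceval (f (Suc m)) z) =
       of_int B * of_nat p ^ (\<mu> * (p ^ Suc m - p ^ m) + l)"
proof -
  obtain \<mu> l m1 h where l: "even l" "l < p ^ m1" and h: "\<And>m. m \<ge> m1 \<Longrightarrow> order_mod p (h m) l"
    and fh: "\<And>m z. z \<in> unity_roots (p ^ m) \<Longrightarrow> ceval (f m) z = of_nat p ^ \<mu> * ceval (h m) z"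
    by (rule coherent_symmetric_family[OF p coh sym nz]) (assumption | rule that)+
  have p1: "p > 1" using prime_gt_1_nat[OF p] .
  have f1: "ceval (f m) 1 = ceval (f 0) 1" for m
  proof (induction m)
    case (Suc m)
    then show ?case using coh[of 1 m] by simp
  qed simp
  have pos: "l > 0" if "ceval (f 0) 1 = 0"
  proof (rule ccontr)
    assume "\<not> l > 0"
    then obtain s r where hs: "h m1 = s + smult (int p) r" and s: "\<not> int p dvd poly s 1"
      using h[of m1] by (auto simp: order_mod_def)
    have "ceval (h m1) 1 = 0" using that f1[of m1] fh[of 1 m1] p1 by simp
    then have "poly s 1 + int p * poly r 1 = 0" by (simp add: ceval_one hs flip: of_int_mult of_int_add)
    then have "poly s 1 = int p * (- poly r 1)" by simp
    then show False using s by simp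
  qed
  have val: "\<exists>A B :: int. \<not> int p dvd A \<and> \<not> int p dvd B \<and>
       of_int A * (\<Prod>z\<in>primitive_roots p m. ceval (f (Suc m)) z) =
       of_int B * of_nat p ^ (\<mu> * (p ^ Suc m - p ^ m) + l)" if m: "m \<ge> m1" for m
  proof -
    have "p ^ m1 \<le> p ^ m" using m p1 by (simp add: power_increasing)
    moreover have "p ^ Suc m - p ^ m \<ge> p ^ m"
    proof -
      have "2 * p ^ m \<le> p ^ Suc m" unfolding power_Suc using p1 by (intro mult_right_mono) auto
      then show ?thesis by linarith
    qed
    ultimately have "l < p ^ Suc m - p ^ m" using l(2) by linarith
    then obtain A B where AB: "\<not> int p dvd A" "\<not> int p dvd B"
      "of_int A * (\<Prod>z\<in>primitive_roots p m. ceval (h (Suc m)) z) = of_int B * of_nat p ^ l"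
      using prod_primitive_roots_valuation[OF p h[of "Suc m"]] m by (metis le_SucI)
    have "(\<Prod>z\<in>primitive_roots p m. ceval (f (Suc m)) z) =
      (\<Prod>z\<in>primitive_roots p m. of_nat p ^ \<mu> * ceval (h (Suc m)) z)"
      by (intro prod.cong refl fh) (simp add: primitive_roots_def)
    also have "\<dots> = of_nat p ^ (\<mu> * (p ^ Suc m - p ^ m)) * (\<Prod>z\<in>primitive_roots p m. ceval (h (Suc m)) z)"
      using p1 by (simp add: prod.distrib card_primitive_roots power_mult del: power_Suc)
    finally have "of_int A * (\<Prod>z\<in>primitive_roots p m. ceval (f (Suc m)) z) =
       of_int B * of_nat p ^ (\<mu> * (p ^ Suc m - p ^ m) + l)"
      using AB(3) by (simp add: power_add mult_ac del: power_Suc)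
    then show ?thesis using AB(1,2) by blast
  qed
  show thesis by (rule that) (rule l(1), erule pos, erule val)
qed

section \<open>Laplacians in a ramified tower\<close>

lemma ceval_det_on: "ceval (det_on S M) z = det_on S (\<lambda>i j. ceval (M i j) z)"
proof -
  have p: "ceval (\<Prod>i\<in>A. F i) z = (\<Prod>i\<in>A. ceval (F i) z)" for A :: "'x set" and F
    by (simp add: ceval_def of_int_poly_hom.hom_prod poly_prod)
  have o: "ceval (of_int c) z = of_int c" for c
    by (simp add: ceval_def of_int_poly of_int_hom.map_poly_pCons_hom)
  show ?thesis by (simp add: det_on_def p o)
qed

lemma (in fin_digraph) laplacian_apply:
  fixes f :: "'a \<Rightarrow> complex"
  assumes x: "x \<in> verts G"
  shows "(\<Sum>y\<in>verts G. of_int (laplacian G x y) * f y) = (\<Sum>e\<in>out_arcs G x. f x - f (head G e))"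
proof -
  have "(\<Sum>y\<in>verts G. of_int (laplacian G x y) * f y) =
    (\<Sum>y\<in>verts G. \<Sum>e\<in>out_arcs G x. (of_bool (x = y) - of_bool (head G e = y)) * f y)"
    by (simp add: laplacian_def sum_distrib_right)
  also have "\<dots> = (\<Sum>e\<in>out_arcs G x. \<Sum>y\<in>verts G. (of_bool (x = y) - of_bool (head G e = y)) * f y)"
    by (rule sum.swap)
  also have "\<dots> = (\<Sum>e\<in>out_arcs G x. f x - f (head G e))"
  proof (rule sum.cong[OF refl])
    fix e assume "e \<in> out_arcs G x"
    then have h: "head G e \<in> verts G" by simp
    have "(\<Sum>y\<in>verts G. (of_bool (x = y) - of_bool (head G e = y)) * f y) =
      (\<Sum>y\<in>verts G. (if y = x then f y else 0) - (if y = head G e then f y else 0))"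
      by (rule sum.cong[OF refl]) auto
    also have "\<dots> = f x - f (head G e)"
      using x h by (simp add: sum_subtractf)
    finally show "(\<Sum>y\<in>verts G. (of_bool (x = y) - of_bool (head G e = y)) * f y) = f x - f (head G e)" .
  qed
  finally show ?thesis .
qed

lemma sum_residue_class:
  fixes F :: "nat \<Rightarrow> 'a::comm_monoid_add"
  assumes "i < w"
  shows "(\<Sum>j | j < c * w \<and> j mod w = i. F j) = (\<Sum>q<c. F (i + w * q))"
proof (rule sum.reindex_bij_witness[of _ "\<lambda>q. i + w * q" "\<lambda>j. j div w"])
  fix j assume "j \<in> {j. j < c * w \<and> j mod w = i}"
  then have j: "j < c * w" "j mod w = i" by simp_all
  show "i + w * (j div w) = j" using j(2) mod_mult_div_eq[of j w] by simp
  then show "F (i + w * (j div w)) = F j" by simp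
  show "j div w \<in> {..<c}" using j(1) assms by (simp add: less_mult_imp_div_less)
next
  fix q assume q: "q \<in> {..<c}"
  show "(i + w * q) div w = q" using assms by simp
  have "i + w * q < w * Suc q" using assms by simp
  also have "\<dots> \<le> w * c" using q by (intro mult_le_mono2) simp
  finally show "i + w * q \<in> {j. j < c * w \<and> j mod w = i}"
    using assms by (simp add: mult.commute)
qed

lemma sum_mod_periodic:
  fixes H :: "nat \<Rightarrow> complex"
  assumes w: "w dvd N" "N > 0" "i < w"
  shows "(\<Sum>j | j < c * N \<and> j mod w = i. H (j mod N)) = of_nat c * (\<Sum>j | j < N \<and> j mod w = i. H j)"
proof -
  have S: "{j. j < c * N \<and> j mod w = i} = (\<Union>j0\<in>{j. j < N \<and> j mod w = i}. {j. j < c * N \<and> j mod N = j0})"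
    using w by (auto simp: mod_mod_cancel)
  have fin: "finite {j. j < K \<and> Q j}" for K :: nat and Q by simp
  have "(\<Sum>j | j < c * N \<and> j mod w = i. H (j mod N)) =
    (\<Sum>j0 | j0 < N \<and> j0 mod w = i. \<Sum>j | j < c * N \<and> j mod N = j0. H (j mod N))"
    unfolding S by (rule sum.UNION_disjoint) (use fin in auto)
  also have "\<dots> = (\<Sum>j0 | j0 < N \<and> j0 mod w = i. of_nat c * H j0)"
  proof (rule sum.cong[OF refl])
    fix j0 assume "j0 \<in> {j. j < N \<and> j mod w = i}"
    then have "j0 < N" by simp
    then show "(\<Sum>j | j < c * N \<and> j mod N = j0. H (j mod N)) = of_nat c * H j0"
      using sum_residue_class[of j0 N "\<lambda>j. H (j mod N)" c] by simp
  qed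
  finally show ?thesis by (simp add: sum_distrib_left)
qed

lemma sum_unity_root_residue_class:
  fixes z :: complex
  assumes z: "z ^ (c * w) = 1" "z ^ w \<noteq> 1" and i: "i < w"
  shows "(\<Sum>j | j < c * w \<and> j mod w = i. z ^ j) = 0"
proof -
  have "(\<Sum>j | j < c * w \<and> j mod w = i. z ^ j) = z ^ i * (\<Sum>q<c. (z ^ w) ^ q)"
    by (simp add: sum_residue_class[OF i] power_add power_mult sum_distrib_left)
  also have "(\<Sum>q<c. (z ^ w) ^ q) = 0"
    using z by (intro sum_powers_unity_root) (simp_all add: power_mult[symmetric] mult.commute)
  finally show ?thesis by simp
qed

text \<open>
  The tower in coordinates: \<open>a m e\<close> is the voltage of \<open>e\<close> as a residue modulo \<open>p\<^sup>m\<close>, the set \<open>U\<close>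
  consists of the unramified vertices, and \<open>p\<^bsup>k v\<^esup>\<close> is the index of the isotropy group of a ramified
  vertex \<open>v\<close>.
\<close>

locale voltage_tower = serre_graph X bar
  for X :: "('v, 'e) pre_digraph" and bar :: "'e \<Rightarrow> 'e" +
  fixes p :: nat and a :: "nat \<Rightarrow> 'e \<Rightarrow> nat" and U :: "'v set" and k :: "'v \<Rightarrow> nat"
  assumes p: "prime p" and U: "U \<subseteq> verts X"
    and a_Suc: "\<And>e m. e \<in> arcs X \<Longrightarrow> [a (Suc m) e = a m e] (mod p ^ m)"
    and a_bar: "\<And>e m. e \<in> arcs X \<Longrightarrow> [a m e + a m (bar e) = 0] (mod p ^ m)"
begin

lemma p0: "p > 0" using prime_gt_0_nat[OF p] .

lemma finite_U: "finite U" using finite_subset[OF U] by simp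

text \<open>
  The number of vertices above \<open>v\<close> at level \<open>m\<close>, provided that \<open>k v \<le> m\<close> in the ramified case.
\<close>

definition width :: "nat \<Rightarrow> 'v \<Rightarrow> nat" where
  "width m v = (if v \<in> U then p ^ m else p ^ k v)"

definition level :: "nat \<Rightarrow> ('v \<times> nat, 'e \<times> nat) pre_digraph" where
  "level m = \<lparr>verts = Sigma (verts X) (\<lambda>v. {..<width m v}), arcs = arcs X \<times> {..<p ^ m},
     tail = (\<lambda>(e, i). (tail X e, i mod width m (tail X e))),
     head = (\<lambda>(e, i). (head X e, (i + a m e) mod width m (head X e)))\<rparr>"

lemma width_pos: "width m v > 0"
  using p0 by (simp add: width_def)

lemma fin_digraph_level: "fin_digraph (level m)"
  by unfold_locales (auto simp: level_def width_pos)

lemma out_arcs_level: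
  "out_arcs (level m) (v, i) = out_arcs X v \<times> {j. j < p ^ m \<and> j mod width m v = i}"
  by (auto simp: out_arcs_def level_def)

lemma laplacian_level_apply:
  fixes f :: "'v \<times> nat \<Rightarrow> complex"
  assumes "(v, i) \<in> verts (level m)"
  shows "(\<Sum>y\<in>verts (level m). of_int (laplacian (level m) (v, i) y) * f y) =
    (\<Sum>e\<in>out_arcs X v. \<Sum>j | j < p ^ m \<and> j mod width m v = i.
      f (v, i) - f (head X e, (j + a m e) mod width m (head X e)))"
  unfolding fin_digraph.laplacian_apply[OF fin_digraph_level assms] out_arcs_level sum.cartesian_product
  by (rule sum.cong[OF refl]) (auto simp: level_def)

lemma sum_verts_level: "(\<Sum>y\<in>verts (level m). F y) = (\<Sum>v\<in>verts X. \<Sum>j<width m v. F (v, j))"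
  by (subst sum.Sigma) (auto simp: level_def)

lemma prod_verts_level: "(\<Prod>y\<in>verts (level m). F y) = (\<Prod>v\<in>verts X. \<Prod>j<width m v. F (v, j))"
  by (subst prod.Sigma) (auto simp: level_def)

definition down :: "nat \<Rightarrow> 'v \<times> nat \<Rightarrow> 'v \<times> nat" where
  "down m = (\<lambda>(v, i). (v, i mod width m v))"

text \<open>
  The factor by which the number of arcs leaving a vertex grows in one step of the tower.
\<close>

definition ram_weight :: "'v \<times> nat \<Rightarrow> int" where
  "ram_weight x = (if fst x \<in> U then 1 else int p)"

text \<open>
  The action of the Laplacian of level \<open>m\<close> on the functions that transform under the character sending
  the generator to \<open>z\<close>.  If \<open>z\<close> is a primitive root of large order, such functions vanish above the
  ramified vertices, so that only the rows and columns in \<open>U\<close> matter.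
\<close>

definition twisted :: "nat \<Rightarrow> complex \<Rightarrow> 'v \<Rightarrow> 'v \<Rightarrow> complex" where
  "twisted m z w u = (\<Sum>e\<in>out_arcs X w. of_bool (w = u) - of_bool (head X e = u) * z ^ a m e)"

definition twist_poly :: "nat \<Rightarrow> int poly" where
  "twist_poly m = det_on U (\<lambda>w u. \<Sum>e\<in>out_arcs X w. of_bool (w = u) - of_bool (head X e = u) * monom 1 (a m e))"

definition character_vector :: "complex \<Rightarrow> 'v \<Rightarrow> 'v \<times> nat \<Rightarrow> complex" where
  "character_vector z u = (\<lambda>(w, j). of_bool (w = u) * z ^ j)"

end

locale voltage_step = voltage_tower +
  fixes n :: nat
  assumes k: "\<And>v. v \<in> verts X - U \<Longrightarrow> k v \<le> n"
begin

lemma width_dvd: "v \<in> verts X \<Longrightarrow> width n v dvd p ^ n"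
  using k by (auto simp: width_def le_imp_power_dvd)

lemma width_dvd_Suc: "width n v dvd width (Suc n) v"
  by (simp add: width_def)

lemma down_mod: "down n (v, i mod width (Suc n) v) = (v, i mod width n v)"
  using width_dvd_Suc[of v] by (simp add: down_def mod_mod_cancel)

lemma down_in_verts: "x \<in> verts (level (Suc n)) \<Longrightarrow> down n x \<in> verts (level n)"
  by (auto simp: level_def down_def width_pos)

lemma primitive_root_width:
  assumes "z \<in> primitive_roots p n" "w \<in> verts X"
  shows "z ^ width n w \<noteq> 1"
proof
  assume "z ^ width n w = 1"
  moreover obtain c where "p ^ n = width n w * c" using width_dvd[OF assms(2)] by (rule dvdE)
  ultimately have "z ^ p ^ n = 1" by (simp add: power_mult)
  then show False using assms(1) by (simp add: primitive_roots_def)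
qed

lemma residue_class_sum_down:
  fixes H :: "nat \<Rightarrow> complex"
  assumes v: "v \<in> verts X" and i: "i < width (Suc n) v"
  shows "(\<Sum>j | j < p ^ Suc n \<and> j mod width (Suc n) v = i. H (j mod p ^ n)) =
    of_int (ram_weight (v, i)) * (\<Sum>j | j < p ^ n \<and> j mod width n v = i mod width n v. H j)"
proof (cases "v \<in> U")
  case True
  have "{j. j < p ^ Suc n \<and> j mod width (Suc n) v = i} = {i}"
    using True i by (auto simp: width_def)
  moreover have "{j. j < p ^ n \<and> j mod width n v = i mod width n v} = {i mod p ^ n}"
    using True p0 by (auto simp: width_def)
  ultimately show ?thesis using True by (simp add: ram_weight_def)
next
  case False
  then have w: "width (Suc n) v = width n v" by (simp add: width_def)
  have "(\<Sum>j | j < p * p ^ n \<and> j mod width n v = i. H (j mod p ^ n)) =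
    of_nat p * (\<Sum>j | j < p ^ n \<and> j mod width n v = i. H j)"
    using width_dvd[OF v] p0 i w by (intro sum_mod_periodic) simp_all
  then show ?thesis using False i w by (simp add: ram_weight_def)
qed

text \<open>
  Near the vertices above an unramified vertex the projection to the lower level is a local
  isomorphism; at a vertex above a ramified one, \<open>p\<close> leaving arcs lie over each leaving arc of the lower
  level.
\<close>

lemma laplacian_pullback:
  fixes g :: "'a \<times> nat \<Rightarrow> complex"
  assumes x: "x \<in> verts (level (Suc n))"
  shows "(\<Sum>y\<in>verts (level (Suc n)). of_int (laplacian (level (Suc n)) x y) * g (down n y)) =
    of_int (ram_weight x) * (\<Sum>y\<in>verts (level n). of_int (laplacian (level n) (down n x) y) * g y)"
proof -
  obtain v i where xv: "x = (v, i)" by (cases x)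
  have v: "v \<in> verts X" and i: "i < width (Suc n) v" using x by (auto simp: xv level_def)
  have d: "down n (v, i) = (v, i mod width n v)" by (simp add: down_def)
  have dn: "(v, i mod width n v) \<in> verts (level n)" using v by (simp add: level_def width_pos)
  let ?H = "\<lambda>e j. g (v, i mod width n v) - g (head X e, (j + a n e) mod width n (head X e))"
  have "(\<Sum>y\<in>verts (level (Suc n)). of_int (laplacian (level (Suc n)) x y) * g (down n y)) =
    (\<Sum>e\<in>out_arcs X v. \<Sum>j | j < p ^ Suc n \<and> j mod width (Suc n) v = i. ?H e (j mod p ^ n))"
    unfolding xv laplacian_level_apply[OF x[unfolded xv]] down_mod d
  proof (rule sum.cong[OF refl], rule sum.cong[OF refl])
    fix e j assume e: "e \<in> out_arcs X v"
    then have eX: "e \<in> arcs X" and h: "head X e \<in> verts X" by auto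
    have "[j + a (Suc n) e = j mod p ^ n + a n e] (mod p ^ n)"
      by (intro cong_add a_Suc eX) (simp add: cong_def)
    then have "[j + a (Suc n) e = j mod p ^ n + a n e] (mod width n (head X e))"
      using width_dvd[OF h] by (rule cong_dvd_modulus_nat)
    then show "g (v, i mod width n v) - g (head X e, (j + a (Suc n) e) mod width n (head X e)) =
      ?H e (j mod p ^ n)" by (simp add: cong_def)
  qed
  also have "\<dots> = of_int (ram_weight x) *
     (\<Sum>e\<in>out_arcs X v. \<Sum>j | j < p ^ n \<and> j mod width n v = i mod width n v. ?H e j)"
    unfolding xv by (subst sum_distrib_left, rule sum.cong[OF refl])
      (rule residue_class_sum_down[OF v i, of "?H e" for e])
  also have "(\<Sum>e\<in>out_arcs X v. \<Sum>j | j < p ^ n \<and> j mod width n v = i mod width n v. ?H e j) =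
    (\<Sum>y\<in>verts (level n). of_int (laplacian (level n) (down n x) y) * g y)"
    unfolding xv d laplacian_level_apply[OF dn] ..
  finally show ?thesis .
qed

text \<open>
  At a vertex above a ramified vertex the arcs form full cosets of a subgroup on which the character is
  nontrivial, so their contributions cancel.
\<close>

lemma laplacian_character_vector:
  assumes x: "(w, j) \<in> verts (level (Suc n))" and z: "z \<in> primitive_roots p n" and u: "u \<in> U"
  shows "(\<Sum>y\<in>verts (level (Suc n)). of_int (laplacian (level (Suc n)) (w, j) y) * character_vector z u y) =
    of_bool (w \<in> U) * (z ^ j * twisted (Suc n) z w u)"
proof -
  have zN: "z ^ p ^ Suc n = 1" using z by (simp add: primitive_roots_def)
  have w: "w \<in> verts X" and j: "j < width (Suc n) w" using x by (auto simp: level_def)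
  have cv: "character_vector z u (head X e, i mod width (Suc n) (head X e)) = of_bool (head X e = u) * z ^ i"
    for e i
    using u power_mod_unity_root[OF zN, of i] by (auto simp: character_vector_def width_def)
  show ?thesis
  proof (cases "w \<in> U")
    case True
    have "{i. i < p ^ Suc n \<and> i mod width (Suc n) w = j} = {j}"
      using True j by (auto simp: width_def)
    then show ?thesis
      unfolding laplacian_level_apply[OF x] cv using True
      by (simp add: twisted_def character_vector_def sum_distrib_left power_add algebra_simps)
  next
    case False
    have wn: "width (Suc n) w = width n w" using False by (simp add: width_def)
    have "width n w dvd p ^ Suc n" using width_dvd[OF w] by (rule dvd_trans) simp
    then obtain c where "p ^ Suc n = width n w * c" by (rule dvdE)
    then have c: "p ^ Suc n = c * width n w" by (simp only: mult.commute)
    have 0: "(\<Sum>i | i < p ^ Suc n \<and> i mod width (Suc n) w = j. z ^ i) = 0"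
      unfolding wn c using zN c j primitive_root_width[OF z w]
      by (intro sum_unity_root_residue_class) (simp_all add: wn)
    have wu: "w \<noteq> u" using False u by auto
    have "(\<Sum>e\<in>out_arcs X w. \<Sum>i | i < p ^ Suc n \<and> i mod width (Suc n) w = j.
        character_vector z u (w, j) - of_bool (head X e = u) * z ^ (i + a (Suc n) e)) =
      (\<Sum>e\<in>out_arcs X w. - (of_bool (head X e = u) * z ^ a (Suc n) e *
        (\<Sum>i | i < p ^ Suc n \<and> i mod width (Suc n) w = j. z ^ i)))"
      using wu by (simp only: character_vector_def) (simp add: sum_distrib_left sum_negf power_add mult_ac del: power_Suc)
    then show ?thesis
      unfolding laplacian_level_apply[OF x] cv 0 using False by simp
  qed
qed

lemma sum_verts_level_fiber:
  fixes F :: "nat \<Rightarrow> complex"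
  assumes "u \<in> verts X"
  shows "(\<Sum>y\<in>verts (level m). of_bool (fst y = u) * F (snd y)) = (\<Sum>j<width m u. F j)"
proof -
  have "(\<Sum>y\<in>verts (level m). of_bool (fst y = u) * F (snd y)) =
    (\<Sum>v\<in>verts X. \<Sum>j<width m v. of_bool (v = u) * F j)"
    by (simp add: sum_verts_level)
  also have "\<dots> = (\<Sum>v\<in>verts X. if v = u then (\<Sum>j<width m v. F j) else 0)"
    by (rule sum.cong[OF refl]) auto
  finally show ?thesis using assms by simp
qed

lemma sum_fiber_down:
  fixes F :: "nat \<Rightarrow> complex"
  assumes "(v, i) \<in> verts (level n)"
  shows "(\<Sum>y\<in>verts (level (Suc n)). of_bool (down n y = (v, i)) * F (snd y)) =
    (\<Sum>j | j < width (Suc n) v \<and> j mod width n v = i. F j)"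
proof -
  have v: "v \<in> verts X" using assms by (simp add: level_def)
  have "(\<Sum>y\<in>verts (level (Suc n)). of_bool (down n y = (v, i)) * F (snd y)) =
    (\<Sum>y\<in>verts (level (Suc n)). of_bool (fst y = v) * (of_bool (snd y mod width n v = i) * F (snd y)))"
    by (rule sum.cong[OF refl]) (auto simp: down_def split: prod.splits)
  also have "\<dots> = (\<Sum>j<width (Suc n) v. of_bool (j mod width n v = i) * F j)"
    by (rule sum_verts_level_fiber[OF v])
  also have "\<dots> = (\<Sum>j | j < width (Suc n) v \<and> j mod width n v = i. F j)"
    by (rule sum.mono_neutral_cong_right) auto
  finally show ?thesis .
qed

lemma card_verts_level: "card (verts (level m)) = card U * p ^ m + (\<Sum>v\<in>verts X - U. p ^ k v)"
proof -
  have "card (verts (level m)) = (\<Sum>v\<in>verts X. width m v)"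
    by (simp add: level_def)
  also have "\<dots> = (\<Sum>v\<in>U. width m v) + (\<Sum>v\<in>verts X - U. width m v)"
    using U by (simp add: sum.subset_diff[of U] add.commute)
  finally show ?thesis by (simp add: width_def)
qed

lemma sum_ram_weight: "(\<Sum>x\<in>verts (level (Suc n)). ram_weight x) = int p * int (card (verts (level n)))"
proof -
  have "(\<Sum>x\<in>verts (level (Suc n)). ram_weight x) =
    (\<Sum>v\<in>verts X. \<Sum>j<width (Suc n) v. if v \<in> U then 1 else int p)"
    by (simp add: sum_verts_level ram_weight_def)
  also have "\<dots> = (\<Sum>v\<in>verts X. int p * int (width n v))"
    by (rule sum.cong[OF refl]) (simp add: width_def)
  also have "\<dots> = int p * int (card (verts (level n)))"
    by (simp add: level_def sum_distrib_left)
  finally show ?thesis .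
qed

lemma prod_ram_weight: "(\<Prod>x\<in>verts (level n). ram_weight x) = int p ^ (\<Sum>v\<in>verts X - U. p ^ k v)"
proof -
  have "(\<Prod>x\<in>verts (level n). ram_weight x) =
    (\<Prod>v\<in>verts X. \<Prod>j<width n v. if v \<in> U then 1 else int p)"
    by (simp add: prod_verts_level ram_weight_def)
  also have "\<dots> = (\<Prod>v\<in>verts X - U. int p ^ (p ^ k v))"
    by (rule prod.mono_neutral_cong_right) (auto simp: width_def)
  finally show ?thesis by (simp add: power_sum)
qed

text \<open>
  The basis consists of the indicator functions of the fibres of the projection \<open>down n\<close>, indexed by the
  vertices of level \<open>n\<close>, and of the functions on the fibres over unramified vertices given by characters
  of exact order \<open>p\<^bsup>n+1\<^esup>\<close>.  In it the operator is block triangular.  The column \<open>r\<close> is perturbed by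
  \<open>ram_weight\<close>, a function pulled back from level \<open>n\<close>; hence the perturbation preserves the first
  block, and dividing its rows by \<open>ram_weight\<close> leaves the perturbation by \<open>1\<close> at level \<open>n\<close>.
\<close>

theorem det_level_step:
  assumes r: "r \<in> verts (level (Suc n))"
  shows "of_int (det_on (verts (level (Suc n)))
      (\<lambda>x y. laplacian (level (Suc n)) x y + ram_weight x * of_bool (y = r))) =
    of_nat p ^ (\<Sum>v\<in>verts X - U. p ^ k v) *
    of_int (det_on (verts (level n)) (\<lambda>x y. laplacian (level n) x y + of_bool (y = down n r))) *
    (\<Prod>z\<in>primitive_roots p n. det_on U (twisted (Suc n) z))"
proof -
  let ?V = "verts (level (Suc n))" and ?W = "verts (level n)"
  let ?Z = "primitive_roots p n"
  let ?J = "Inl ` ?W \<union> Inr ` (?Z \<times> U) :: ('a \<times> nat + complex \<times> 'a) set"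
  \<comment> \<open>The columns of \<open>K\<close> are the basis, \<open>K'\<close> is the inverse of \<open>K\<close> given by averaging over fibres and by Fourier inversion, and \<open>D\<close> is the operator in the new basis.\<close>
  define K where "K y j = (case j of Inl x \<Rightarrow> of_bool (down n y = x) | Inr (z, u) \<Rightarrow> character_vector z u y)"
    for y and j :: "'a \<times> nat + complex \<times> 'a"
  define K' where "K' j y = (case j of
      Inl x \<Rightarrow> of_bool (down n y = x) / of_nat (width (Suc n) (fst x) div width n (fst x))
    | Inr (z, u) \<Rightarrow> character_vector (inverse z) u y / of_nat (p ^ Suc n))"
    for y and j :: "'a \<times> nat + complex \<times> 'a"
  define D where "D i j = (case i of
      Inl x \<Rightarrow> of_int (ram_weight x) * ((case j of Inl y \<Rightarrow> of_int (laplacian (level n) x y) | Inr c \<Rightarrow> 0) + K r j)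
    | Inr (z, u) \<Rightarrow> (case j of Inl y \<Rightarrow> 0 | Inr (z', u') \<Rightarrow> if z = z' then twisted (Suc n) z u u' else 0))"
    for i j :: "'a \<times> nat + complex \<times> 'a"
  interpret V: fin_digraph "level (Suc n)" by (rule fin_digraph_level)
  interpret W: fin_digraph "level n" by (rule fin_digraph_level)
  have finZ: "finite ?Z" by (rule finite_primitive_roots[OF p0])
  have finZU: "finite (?Z \<times> U)" using finZ finite_U by simp
  have sumJ: "(\<Sum>j\<in>?J. F j) = (\<Sum>x\<in>?W. F (Inl x)) + (\<Sum>z\<in>?Z. \<Sum>u\<in>U. F (Inr (z, u)))"
    for F :: "_ \<Rightarrow> complex"
    using finZU by (subst sum.union_disjoint) (auto simp: sum.reindex sum.cartesian_product)
  have zN: "z ^ p ^ Suc n = 1" "z \<noteq> 0" "z ^ p ^ n \<noteq> 1" if "z \<in> ?Z" for z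
    using that p0 by (auto simp: primitive_roots_def power_0_left)
  have ratio: "width (Suc n) v = (if v \<in> U then p else 1) * width n v" for v
    by (simp add: width_def)
  have fiber_z: "(\<Sum>y\<in>?V. of_bool (down n y = x) * character_vector z u y) = 0"
    if x: "x \<in> ?W" and z: "z ^ p ^ Suc n = 1" "z ^ p ^ n \<noteq> 1" and u: "u \<in> U" for x z u
  proof -
    obtain v i where xv: "x = (v, i)" by (cases x)
    have i: "i < width n v" using x by (simp add: xv level_def)
    have "(\<Sum>y\<in>?V. of_bool (down n y = x) * character_vector z u y) =
      (\<Sum>y\<in>?V. of_bool (down n y = (v, i)) * (of_bool (v = u) * z ^ snd y))"
      by (rule sum.cong[OF refl]) (auto simp: xv down_def character_vector_def split: prod.splits)
    also have "\<dots> = (\<Sum>j | j < width (Suc n) v \<and> j mod width n v = i. of_bool (v = u) * z ^ j)"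
      by (rule sum_fiber_down[OF x[unfolded xv]])
    also have "\<dots> = 0"
    proof (cases "v = u")
      case True
      then have w: "width (Suc n) v = p * width n v" "width n v = p ^ n" using u by (simp_all add: width_def)
      have "(\<Sum>j | j < p * width n v \<and> j mod width n v = i. z ^ j) = 0"
        using z i w(2) by (intro sum_unity_root_residue_class) simp_all
      then show ?thesis using True w(1) by simp
    qed simp
    finally show ?thesis .
  qed
  have "det_on ?V (\<lambda>x y. of_int (laplacian (level (Suc n)) x y) + of_int (ram_weight x) * of_bool (y = r))
      = det_on ?J D"
  proof (rule det_on_intertwine[where K = K and K' = K'])
    have "card ?J = card ?W + card (?Z \<times> U)"
      using finZU by (subst card_Un_disjoint) (auto simp: card_image)
    also have "\<dots> = card ?V"
    proof -
      have "p ^ n \<le> p ^ Suc n" using p0 by simp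
      then have "card U * p ^ n + (p ^ Suc n - p ^ n) * card U = card U * p ^ Suc n"
        by (metis add_mult_distrib2 le_add_diff_inverse mult.commute)
      then show ?thesis
        unfolding card_verts_level card_cartesian_product card_primitive_roots[OF p0] by linarith
    qed
    finally show "card ?V = card ?J" by simp
  next
    fix i j assume i: "i \<in> ?J" and j: "j \<in> ?J"
    show "(\<Sum>y\<in>?V. K' i y * K y j) = (if i = j then 1 else 0)"
    proof (cases i)
      case iL: (Inl x)
      have x: "x \<in> ?W" using i iL by auto
      obtain v l where xv: "x = (v, l)" by (cases x)
      let ?c = "of_nat (width (Suc n) (fst x) div width n (fst x)) :: complex"
      show ?thesis
      proof (cases j)
        case jL: (Inl x')
        have "(\<Sum>y\<in>?V. K' i y * K y j) = of_bool (x = x') / ?c * (\<Sum>y\<in>?V. of_bool (down n y = (v, l)) * 1)"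
          unfolding sum_distrib_left by (rule sum.cong[OF refl]) (auto simp: K'_def K_def iL jL xv)
        also have "(\<Sum>y\<in>?V. of_bool (down n y = (v, l)) * 1) = ?c"
        proof -
          have l: "l < width n v" using x by (simp add: xv level_def)
          have "(\<Sum>y\<in>?V. of_bool (down n y = (v, l)) * 1) =
            (\<Sum>j | j < (if v \<in> U then p else 1) * width n v \<and> j mod width n v = l. 1 :: complex)"
            using sum_fiber_down[OF x[unfolded xv], of "\<lambda>_. 1"] unfolding ratio .
          also have "\<dots> = (\<Sum>q<(if v \<in> U then p else 1). 1)"
            by (rule sum_residue_class[OF l])
          also have "\<dots> = ?c" using width_pos[of n v] by (simp add: xv ratio)
          finally show ?thesis .
        qed
        also have "of_bool (x = x') / ?c * ?c = (if i = j then 1 else 0)"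
          using width_pos[of n v] p0 by (simp add: iL jL ratio xv)
        finally show ?thesis .
      next
        case jR: (Inr c)
        obtain z u where c: "c = (z, u)" by (cases c)
        have z: "z \<in> ?Z" and u: "u \<in> U" using j jR c by auto
        have "(\<Sum>y\<in>?V. K' i y * K y j) = (\<Sum>y\<in>?V. of_bool (down n y = x) * character_vector z u y) / ?c"
          unfolding sum_divide_distrib by (rule sum.cong[OF refl]) (simp add: K'_def K_def iL jR c)
        then show ?thesis using fiber_z[OF x zN(1,3)[OF z] u] by (simp add: iL jR)
      qed
    next
      case iR: (Inr b)
      obtain z u where b: "b = (z, u)" by (cases b)
      have z: "z \<in> ?Z" and u: "u \<in> U" using i iR b by auto
      have iz: "inverse z ^ p ^ Suc n = 1" "inverse z ^ p ^ n \<noteq> 1"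
        using zN[OF z] by (simp_all add: power_inverse)
      show ?thesis
      proof (cases j)
        case jL: (Inl x)
        have x: "x \<in> ?W" using j jL by auto
        have "(\<Sum>y\<in>?V. K' i y * K y j) = (\<Sum>y\<in>?V. of_bool (down n y = x) * character_vector (inverse z) u y) / of_nat (p ^ Suc n)"
          unfolding sum_divide_distrib by (rule sum.cong[OF refl]) (simp add: K'_def K_def iR jL b)
        then show ?thesis using fiber_z[OF x iz u] by (simp add: iR jL)
      next
        case jR: (Inr c)
        obtain z' u' where c: "c = (z', u')" by (cases c)
        have z': "z' \<in> ?Z" and u': "u' \<in> U" using j jR c by auto
        have "(\<Sum>y\<in>?V. K' i y * K y j) =
          (\<Sum>y\<in>?V. of_bool (fst y = u) * (of_bool (u = u') * (z' / z) ^ snd y / of_nat (p ^ Suc n)))"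
          by (rule sum.cong[OF refl])
            (auto simp: K'_def K_def iR jR b c character_vector_def power_mult_distrib divide_inverse power_inverse mult_ac
              split: prod.splits)
        also have "\<dots> = (\<Sum>l<width (Suc n) u. of_bool (u = u') * (z' / z) ^ l / of_nat (p ^ Suc n))"
          using U u by (intro sum_verts_level_fiber) auto
        also have "\<dots> = of_bool (u = u') / of_nat (p ^ Suc n) * (\<Sum>l<p ^ Suc n. (z' / z) ^ l)"
          using u by (simp add: width_def sum_distrib_left)
        also have "\<dots> = (if i = j then 1 else 0)"
        proof (cases "z = z'")
          case True
          then show ?thesis using zN(2)[OF z] p0 by (simp add: iR jR b c)
        next
          case False
          have "(\<Sum>l<p ^ Suc n. (z' / z) ^ l) = 0"
            using zN(1,2)[OF z] zN(1)[OF z'] False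
            by (intro sum_powers_unity_root) (simp_all add: power_divide del: power_Suc)
          then show ?thesis using False by (simp add: iR jR b c)
        qed
        finally show ?thesis .
      qed
    qed
  next
    fix x j assume x: "x \<in> ?V" and j: "j \<in> ?J"
    obtain w l where xw: "x = (w, l)" by (cases x)
    have w: "w \<in> verts X" using x by (simp add: xw level_def)
    have "(\<Sum>y\<in>?V. (of_int (laplacian (level (Suc n)) x y) + of_int (ram_weight x) * of_bool (y = r)) * K y j) =
      (\<Sum>y\<in>?V. of_int (laplacian (level (Suc n)) x y) * K y j)
      + (\<Sum>y\<in>?V. if y = r then of_int (ram_weight x) * K y j else 0)"
      unfolding sum.distrib[symmetric] by (rule sum.cong[OF refl]) (simp add: algebra_simps)
    also have "(\<Sum>y\<in>?V. if y = r then of_int (ram_weight x) * K y j else 0) = of_int (ram_weight x) * K r j"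
      using r by simp
    finally have lhs: "(\<Sum>y\<in>?V. (of_int (laplacian (level (Suc n)) x y) + of_int (ram_weight x) * of_bool (y = r)) * K y j)
      = (\<Sum>y\<in>?V. of_int (laplacian (level (Suc n)) x y) * K y j) + of_int (ram_weight x) * K r j" .
    have "(\<Sum>i\<in>?J. K x i * D i j) =
      (\<Sum>y\<in>?W. if y = down n x then D (Inl y) j else 0) + (\<Sum>z\<in>?Z. \<Sum>u\<in>U. if u = w then z ^ l * D (Inr (z, u)) j else 0)"
      unfolding sumJ by (intro arg_cong2[of _ _ _ _ "(+)"] sum.cong refl)
        (auto simp: K_def character_vector_def xw)
    also have "\<dots> = D (Inl (down n x)) j + (\<Sum>z\<in>?Z. of_bool (w \<in> U) * (z ^ l * D (Inr (z, w)) j))"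
      using down_in_verts[OF x] finite_U by (simp add: of_bool_def)
    finally have rhs: "(\<Sum>i\<in>?J. K x i * D i j) =
      D (Inl (down n x)) j + (\<Sum>z\<in>?Z. of_bool (w \<in> U) * (z ^ l * D (Inr (z, w)) j))" .
    have rw: "ram_weight (down n x) = ram_weight x" by (simp add: ram_weight_def down_def xw)
    show "(\<Sum>y\<in>?V. (of_int (laplacian (level (Suc n)) x y) + of_int (ram_weight x) * of_bool (y = r)) * K y j) =
      (\<Sum>i\<in>?J. K x i * D i j)"
    proof (cases j)
      case jL: (Inl x')
      have x': "x' \<in> ?W" using j jL by auto
      have "(\<Sum>y\<in>?V. of_int (laplacian (level (Suc n)) x y) * K y j) =
        (\<Sum>y\<in>?V. of_int (laplacian (level (Suc n)) x y) * of_bool (down n y = x'))"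
        by (simp add: K_def jL)
      also have "\<dots> = of_int (ram_weight x) * (\<Sum>y\<in>?W. of_int (laplacian (level n) (down n x) y) * of_bool (y = x'))"
        by (rule laplacian_pullback[OF x])
      also have "(\<Sum>y\<in>?W. of_int (laplacian (level n) (down n x) y) * of_bool (y = x')) =
        (\<Sum>y\<in>?W. if y = x' then of_int (laplacian (level n) (down n x) y) else (0::complex))"
        by (rule sum.cong[OF refl]) simp
      also have "\<dots> = of_int (laplacian (level n) (down n x) x')" using x' by simp
      finally show ?thesis unfolding lhs rhs by (simp add: D_def jL rw algebra_simps)
    next
      case jR: (Inr c)
      obtain z u where c: "c = (z, u)" by (cases c)
      have z: "z \<in> ?Z" and u: "u \<in> U" using j jR c by auto
      have "(\<Sum>y\<in>?V. of_int (laplacian (level (Suc n)) x y) * K y j) =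
        of_bool (w \<in> U) * (z ^ l * twisted (Suc n) z w u)"
        unfolding laplacian_character_vector[OF x[unfolded xw] z u, symmetric] by (simp add: K_def jR c xw)
      moreover have "(\<Sum>z'\<in>?Z. of_bool (w \<in> U) * (z' ^ l * D (Inr (z', w)) j)) =
        (\<Sum>z'\<in>?Z. if z' = z then of_bool (w \<in> U) * (z' ^ l * twisted (Suc n) z' w u) else 0)"
        by (rule sum.cong[OF refl]) (simp add: D_def jR c)
      moreover have "\<dots> = of_bool (w \<in> U) * (z ^ l * twisted (Suc n) z w u)" using z finZ by simp
      ultimately show ?thesis unfolding lhs rhs by (simp add: D_def jR rw)
    qed
  qed (use finZU in auto)
  also have "\<dots> = det_on (Inl ` ?W) D * det_on (Inr ` (?Z \<times> U)) D"
    using finZU by (intro det_on_block) (auto simp: D_def)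
  also have "det_on (Inl ` ?W) D = det_on ?W (\<lambda>x y. D (Inl x) (Inl y))"
    by (rule det_on_reindex) (auto simp: bij_betw_def)
  also have "\<dots> = det_on ?W (\<lambda>x y. of_int (ram_weight x) *
      of_int (laplacian (level n) x y + of_bool (y = down n r)))"
    by (rule det_on_cong) (auto simp: D_def K_def)
  also have "\<dots> = of_nat p ^ (\<Sum>v\<in>verts X - U. p ^ k v) *
      of_int (det_on ?W (\<lambda>x y. laplacian (level n) x y + of_bool (y = down n r)))"
    unfolding det_on_scale_rows of_int_prod[symmetric] prod_ram_weight det_on_of_int by simp
  also have "det_on (Inr ` (?Z \<times> U)) D = det_on (?Z \<times> U) (\<lambda>x y. D (Inr x) (Inr y))"
    using finZU by (intro det_on_reindex) (auto simp: bij_betw_def)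
  also have "\<dots> = det_on (?Z \<times> U) (\<lambda>x y. if fst x = fst y then twisted (Suc n) (fst x) (snd x) (snd y) else 0)"
    by (rule det_on_cong) (auto simp: D_def)
  also have "\<dots> = (\<Prod>z\<in>?Z. det_on U (twisted (Suc n) z))"
    by (rule det_on_block_diagonal[OF finZ finite_U])
  finally show ?thesis by (simp add: det_on_of_int)
qed

end

context voltage_tower
begin

lemma ceval_twist_poly: "ceval (twist_poly m) z = det_on U (twisted m z)"
proof -
  have b: "ceval (of_bool b) z = of_bool b" for b
    by (simp add: ceval_def)
  show ?thesis unfolding twist_poly_def ceval_det_on twisted_def by (simp add: b)
qed

lemma twisted_Suc:
  assumes "z ^ p ^ m = 1"
  shows "twisted (Suc m) z w u = twisted m z w u"
proof -
  have "z ^ a (Suc m) e = z ^ a m e" if "e \<in> out_arcs X w" for e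
  proof -
    have "a (Suc m) e mod p ^ m = a m e mod p ^ m" using a_Suc[of e m] that by (simp add: cong_def)
    then show ?thesis using power_mod_unity_root[OF assms] by metis
  qed
  then show ?thesis by (simp add: twisted_def)
qed

text \<open>
  The involution of the arcs exchanges the two vertices and inverts the voltage.
\<close>

lemma twisted_inverse:
  assumes z: "z ^ p ^ m = 1"
  shows "twisted m (inverse z) w u = twisted m z u w"
proof -
  have z0: "z \<noteq> 0" using z p0 by (auto simp: power_0_left)
  have fin: "finite {e \<in> arcs X. Q e}" for Q by simp
  have T: "twisted m y w u = of_bool (w = u) * of_nat (card (out_arcs X w)) - (\<Sum>e | e \<in> arcs X \<and> tail X e = w \<and> head X e = u. y ^ a m e)"
    for y w u
  proof -
    have "(\<Sum>e\<in>out_arcs X w. of_bool (head X e = u) * y ^ a m e) =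
      (\<Sum>e | e \<in> arcs X \<and> tail X e = w \<and> head X e = u. y ^ a m e)"
      by (rule sum.mono_neutral_cong_right) auto
    then show ?thesis by (simp add: twisted_def sum_subtractf)
  qed
  have "(\<Sum>e | e \<in> arcs X \<and> tail X e = w \<and> head X e = u. inverse z ^ a m e) =
    (\<Sum>e | e \<in> arcs X \<and> tail X e = u \<and> head X e = w. z ^ a m e)"
  proof (rule sum.reindex_bij_witness[of _ bar bar])
    fix e assume "e \<in> {e \<in> arcs X. tail X e = w \<and> head X e = u}"
    then have e: "e \<in> arcs X" by simp
    have "(a m e + a m (bar e)) mod p ^ m = 0" using a_bar[OF e, of m] by (simp add: cong_def)
    then have "z ^ (a m e + a m (bar e)) = 1"
      using power_mod_unity_root[OF z, of "a m e + a m (bar e)"] by simp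
    then show "z ^ a m (bar e) = inverse z ^ a m e" using z0 by (simp add: power_add field_simps power_inverse)
  qed simp_all
  then show ?thesis unfolding T by auto
qed

lemma twist_poly_coherent: "z \<in> unity_roots (p ^ m) \<Longrightarrow> ceval (twist_poly (Suc m)) z = ceval (twist_poly m) z"
  unfolding ceval_twist_poly by (intro det_on_cong twisted_Suc) simp

lemma twist_poly_symmetric: "z \<in> unity_roots (p ^ m) \<Longrightarrow> ceval (twist_poly m) (inverse z) = ceval (twist_poly m) z"
  unfolding ceval_twist_poly det_on_transpose[OF finite_U, of "twisted m z", symmetric]
  by (intro det_on_cong twisted_inverse) simp

text \<open>
  Without ramification the trivial twist is the Laplacian of \<open>X\<close>, which kills the constant functions.
\<close>

lemma twist_poly_unramified:
  assumes "U = verts X" "verts X \<noteq> {}"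
  shows "ceval (twist_poly m) 1 = 0"
proof -
  obtain r where r: "r \<in> U" using assms by auto
  show ?thesis unfolding ceval_twist_poly
  proof (rule det_on_kernel[OF finite_U r, where x = "\<lambda>_. 1"])
    fix w assume "w \<in> U"
    have "(\<Sum>u\<in>U. twisted m 1 w u * 1) = (\<Sum>u\<in>verts X. of_int (laplacian X w u) * (1::complex))"
      by (simp add: assms twisted_def laplacian_def)
    also have "\<dots> = 0"
      using laplacian_apply[of w "\<lambda>_. 1"] \<open>w \<in> U\<close> U by auto
    finally show "(\<Sum>u\<in>U. twisted m 1 w u * 1) = 0" .
  qed simp
qed

end

section \<open>Coordinates on a group isomorphic to the p-adic integers\<close>

text \<open>
  The value \<open>c n x\<close> is the residue of \<open>x\<close> modulo \<open>p\<^sup>n\<close> under an isomorphism with \<open>\<int>\<^sub>p\<close>.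
\<close>

locale padic_coordinates = group \<Gamma> for p :: nat and \<Gamma> :: "'g monoid" (structure) +
  fixes c :: "nat \<Rightarrow> 'g \<Rightarrow> nat"
  assumes prime_p: "prime p"
    and c_less: "\<And>n x. x \<in> carrier \<Gamma> \<Longrightarrow> c n x < p ^ n"
    and c_mult: "\<And>n x y. x \<in> carrier \<Gamma> \<Longrightarrow> y \<in> carrier \<Gamma> \<Longrightarrow> c n (x \<otimes> y) = (c n x + c n y) mod p ^ n"
    and c_Suc: "\<And>n x. x \<in> carrier \<Gamma> \<Longrightarrow> c (Suc n) x mod p ^ n = c n x"
    and c_inj: "\<And>x y. x \<in> carrier \<Gamma> \<Longrightarrow> y \<in> carrier \<Gamma> \<Longrightarrow> (\<And>n. c n x = c n y) \<Longrightarrow> x = y"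
    and c_glue: "\<And>f. (\<And>n. f n < p ^ n \<and> f (Suc n) mod p ^ n = f n) \<Longrightarrow> \<exists>x\<in>carrier \<Gamma>. \<forall>n. c n x = f n"
begin

lemma pn0: "p ^ n > 0" using prime_gt_0_nat[OF prime_p] by simp

lemma c_one: "c n \<one> = 0"
proof -
  have "c n \<one> = (c n \<one> + c n \<one>) mod p ^ n"
    by (rule c_mult[OF one_closed one_closed, unfolded l_one[OF one_closed]])
  then have "[c n \<one> + c n \<one> = c n \<one> + 0] (mod p ^ n)"
    by (metis add_0_right cong_mod_left cong_refl)
  then have "[c n \<one> = 0] (mod p ^ n)" by (rule cong_add_lcancel_nat[THEN iffD1])
  then show ?thesis using c_less[OF one_closed, of n] by (simp add: cong_def)
qed

lemma c_pow: "x \<in> carrier \<Gamma> \<Longrightarrow> c n (x [^] (k::nat)) = (k * c n x) mod p ^ n"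
proof (induction k)
  case 0
  then show ?case by (simp add: c_one)
next
  case (Suc k)
  then show ?case by (simp add: c_mult mod_simps add.commute)
qed

lemma c_mod:
  assumes "x \<in> carrier \<Gamma>" "m \<le> n"
  shows "c n x mod p ^ m = c m x"
  using assms(2)
proof (induction n rule: dec_induct)
  case base
  then show ?case using c_less[OF assms(1)] by simp
next
  case (step n)
  have "c (Suc n) x mod p ^ n mod p ^ m = c (Suc n) x mod p ^ m"
    using step(1) by (intro mod_mod_cancel le_imp_power_dvd)
  then show ?case using step c_Suc[OF assms(1), of n] by simp
qed

lemma c_surj:
  assumes "i < p ^ n"
  shows "\<exists>x\<in>carrier \<Gamma>. c n x = i"
proof -
  have "\<exists>x\<in>carrier \<Gamma>. \<forall>m. c m x = i mod p ^ m"
    by (rule c_glue) (simp add: mod_less_divisor[OF pn0] mod_mod_cancel)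
  then obtain x where x: "x \<in> carrier \<Gamma>" "c n x = i mod p ^ n" by blast
  then show ?thesis using assms by (intro bexI[of _ x]) simp_all
qed

lemma mult_commute:
  assumes "x \<in> carrier \<Gamma>" "y \<in> carrier \<Gamma>"
  shows "x \<otimes> y = y \<otimes> x"
  using assms by (intro c_inj) (simp_all add: c_mult add.commute)

lemma comm: "comm_group \<Gamma>"
  by (rule group_comm_groupI) (rule mult_commute)

text \<open>
  If the residue of \<open>x\<close> modulo \<open>p\<^sup>n\<close> is zero, then dividing the residue modulo \<open>p\<^bsup>m+n\<^esup>\<close> by \<open>p\<^sup>n\<close> for
  every \<open>m\<close> gives the coordinates of a \<open>p\<^sup>n\<close>-th root of \<open>x\<close>.
\<close>

lemma power_subgroup_eq: "power_subgroup p \<Gamma> n = {x \<in> carrier \<Gamma>. c n x = 0}"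
proof (intro equalityI subsetI)
  fix x assume "x \<in> power_subgroup p \<Gamma> n"
  then show "x \<in> {x \<in> carrier \<Gamma>. c n x = 0}"
    by (auto simp: power_subgroup_def c_pow)
next
  fix x assume "x \<in> {x \<in> carrier \<Gamma>. c n x = 0}"
  then have x: "x \<in> carrier \<Gamma>" and x0: "c n x = 0" by simp_all
  have dvd: "p ^ n dvd c (m + n) x" for m
    using c_mod[OF x, of n "m + n"] x0 by (simp add: mod_eq_0_iff_dvd)
  have "\<exists>y\<in>carrier \<Gamma>. \<forall>m. c m y = c (m + n) x div p ^ n"
  proof (rule c_glue, rule conjI)
    fix m
    have "c (m + n) x < p ^ m * p ^ n" using c_less[OF x, of "m + n"] by (simp add: power_add)
    then show "c (m + n) x div p ^ n < p ^ m" by (simp add: less_mult_imp_div_less)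
    have e: "c (m + n) x = c (Suc m + n) x mod (p ^ n * p ^ m)"
      using c_Suc[OF x, of "m + n"] by (simp add: power_add mult.commute)
    show "c (Suc m + n) x div p ^ n mod p ^ m = c (m + n) x div p ^ n"
      unfolding e mod_mult2_eq using pn0[of n] by simp
  qed
  then obtain y where y: "y \<in> carrier \<Gamma>" "\<And>m. c m y = c (m + n) x div p ^ n" by blast
  have "c m (y [^] (p ^ n)) = c m x" for m
    using dvd[of m] c_mod[OF x, of m "m + n"] by (simp add: c_pow[OF y(1)] y(2))
  then have "y [^] (p ^ n) = x" by (intro c_inj) (use x y in auto)
  then show "x \<in> power_subgroup p \<Gamma> n" unfolding power_subgroup_def using y(1) by blast
qed

lemma c_inv:
  assumes "x \<in> carrier \<Gamma>"
  shows "(c n x + c n (inv x)) mod p ^ n = 0"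
  unfolding c_mult[OF assms inv_closed[OF assms], symmetric] using assms by (simp add: c_one)

lemma power_subgroup_normal: "power_subgroup p \<Gamma> n \<lhd> \<Gamma>"
proof -
  have "subgroup (power_subgroup p \<Gamma> n) \<Gamma>"
  proof (rule subgroupI)
    show "power_subgroup p \<Gamma> n \<noteq> {}" using c_one[of n] by (auto simp: power_subgroup_eq)
    show "inv x \<in> power_subgroup p \<Gamma> n" if "x \<in> power_subgroup p \<Gamma> n" for x
      using that c_inv[of x n] c_less[of "inv x" n] by (auto simp: power_subgroup_eq)
  qed (auto simp: power_subgroup_eq c_mult)
  then show ?thesis by (rule comm_group.subgroup_imp_normal[OF comm])
qed

definition residue_class :: "nat \<Rightarrow> nat \<Rightarrow> 'g set" where
  "residue_class n i = {x \<in> carrier \<Gamma>. c n x = i}"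

lemma level_proj_eq:
  assumes g: "\<gamma> \<in> carrier \<Gamma>"
  shows "level_proj p \<Gamma> n \<gamma> = residue_class n (c n \<gamma>)"
proof (intro equalityI subsetI)
  fix x assume "x \<in> level_proj p \<Gamma> n \<gamma>"
  then show "x \<in> residue_class n (c n \<gamma>)"
    using g c_less[OF g, of n]
    by (auto simp: level_proj_def r_coset_def power_subgroup_eq residue_class_def c_mult)
next
  fix x assume "x \<in> residue_class n (c n \<gamma>)"
  then have x: "x \<in> carrier \<Gamma>" "c n x = c n \<gamma>" by (simp_all add: residue_class_def)
  have "c n (x \<otimes> inv \<gamma>) = 0"
    using x g c_inv[OF g, of n] by (simp add: c_mult)
  moreover have "x = x \<otimes> inv \<gamma> \<otimes> \<gamma>" using x g by (simp add: m_assoc)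
  ultimately show "x \<in> level_proj p \<Gamma> n \<gamma>"
    unfolding level_proj_def r_coset_def power_subgroup_eq using x g by blast
qed

lemma residue_class_inj:
  assumes "i < p ^ n" "residue_class n i = residue_class n j"
  shows "i = j"
proof -
  obtain x where "x \<in> carrier \<Gamma>" "c n x = i" using c_surj[OF assms(1)] by blast
  then have "x \<in> residue_class n i" by (simp add: residue_class_def)
  then have "x \<in> residue_class n j" using assms(2) by simp
  then show ?thesis using \<open>c n x = i\<close> by (simp add: residue_class_def)
qed

lemma carrier_level_group: "carrier (level_group p \<Gamma> n) = residue_class n ` {..<p ^ n}"
proof -
  have "carrier (level_group p \<Gamma> n) = level_proj p \<Gamma> n ` carrier \<Gamma>"
    by (auto simp: level_group_def FactGroup_def RCOSETS_def level_proj_def)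
  also have "\<dots> = (\<lambda>x. residue_class n (c n x)) ` carrier \<Gamma>"
    by (simp add: level_proj_eq cong: image_cong)
  also have "\<dots> = residue_class n ` {..<p ^ n}"
  proof -
    have "(\<lambda>x. c n x) ` carrier \<Gamma> = {..<p ^ n}"
    proof (intro equalityI subsetI)
      fix i assume "i \<in> {..<p ^ n}"
      then obtain x where "x \<in> carrier \<Gamma>" "c n x = i" using c_surj[of i n] by blast
      then show "i \<in> (\<lambda>x. c n x) ` carrier \<Gamma>" by blast
    qed (auto simp: c_less)
    then show ?thesis by (metis image_image)
  qed
  finally show ?thesis .
qed

lemma level_group_mult:
  assumes "i < p ^ n" "j < p ^ n"
  shows "residue_class n i \<otimes>\<^bsub>level_group p \<Gamma> n\<^esub> residue_class n j = residue_class n ((i + j) mod p ^ n)"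
proof -
  obtain x y where x: "x \<in> carrier \<Gamma>" "c n x = i" and y: "y \<in> carrier \<Gamma>" "c n y = j"
    using c_surj assms by blast
  have "residue_class n i \<otimes>\<^bsub>level_group p \<Gamma> n\<^esub> residue_class n j = level_proj p \<Gamma> n x <#> level_proj p \<Gamma> n y"
    using x y by (simp add: level_proj_eq level_group_def FactGroup_def)
  also have "\<dots> = level_proj p \<Gamma> n (x \<otimes> y)"
    unfolding level_proj_def using x y normal.rcos_sum[OF power_subgroup_normal] by simp
  also have "\<dots> = residue_class n ((i + j) mod p ^ n)"
    using x y by (simp add: level_proj_eq c_mult)
  finally show ?thesis .
qed

lemma card_rcosets_power_subgroup: "card (rcosets (power_subgroup p \<Gamma> n)) = p ^ n"
proof -
  have "rcosets (power_subgroup p \<Gamma> n) = carrier (level_group p \<Gamma> n)"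
    by (simp add: level_group_def FactGroup_def)
  moreover have "inj_on (residue_class n) {..<p ^ n}"
    using residue_class_inj by (auto intro!: inj_onI)
  ultimately show ?thesis by (simp add: carrier_level_group card_image)
qed

end

lemma prime_power_congruence_solvable:
  fixes u t :: nat
  assumes p: "prime p" and u: "\<not> p dvd u"
  shows "\<exists>m. [m * u = t] (mod p ^ n)"
proof -
  have "coprime u (p ^ n)"
    using prime_imp_coprime[OF p u] coprime_commute[of p u] by simp
  from cong_solve_coprime_nat[OF this] obtain x where x: "[u * x = 1] (mod p ^ n)" by auto
  have "[u * x * t = 1 * t] (mod p ^ n)" by (rule cong_mult[OF x cong_refl])
  moreover have "u * x * t = x * t * u" by (simp only: mult_ac)
  ultimately have "[x * t * u = t] (mod p ^ n)" by simp
  then show ?thesis by blast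
qed

text \<open>
  Each coordinate determines the earlier ones, so the sets of sequences with a prescribed \<open>n\<close>-th
  coordinate form a basis of the product topology.
\<close>

lemma padic_topology_basis:
  assumes W: "openin (padic_topology p) W" and y: "y \<in> W"
  shows "\<exists>n. \<forall>z\<in>carrier (padic_int p). z n = y n \<longrightarrow> z \<in> W"
proof -
  let ?S = "carrier (padic_int p)"
  obtain O' where O': "openin (product_topology (\<lambda>n::nat. discrete_topology (UNIV :: int set)) UNIV) O'"
    and WO: "W = O' \<inter> ?S"
    using W by (auto simp: padic_topology_def openin_subtopology)
  obtain B where B: "finite {i. B i \<noteq> (UNIV :: int set)}" "y \<in> PiE UNIV B" "PiE UNIV B \<subseteq> O'"
    using O' y unfolding openin_product_topology_alt WO by force
  obtain n where n: "\<And>i. B i \<noteq> UNIV \<Longrightarrow> i \<le> n"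
    using finite_nat_set_iff_bounded_le[of "{i. B i \<noteq> UNIV}"] B(1) by auto
  have mono: "z i = z n mod int p ^ i" if "z \<in> ?S" "i \<le> n" for z i
    using that(2)
  proof (induction n rule: dec_induct)
    case base
    then show ?case using that(1) by (auto simp: padic_int_def)
  next
    case (step n)
    have "z (Suc n) mod int p ^ n = z n" using that(1) by (simp add: padic_int_def)
    then show ?case using step by (metis le_imp_power_dvd mod_mod_cancel)
  qed
  have "z \<in> W" if z: "z \<in> ?S" "z n = y n" for z
  proof -
    have "z i \<in> B i" for i
    proof (cases "B i = UNIV")
      case False
      have "z i = y i" using mono[of z i] mono[of y i] z y n[OF False] WO by auto
      then show ?thesis using B(2) by auto
    qed simp
    then show ?thesis using B(3) z WO by auto
  qed
  then show ?thesis by blast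
qed

text \<open>
  For the closed subgroups, let \<open>k\<close> be maximal such that all elements of \<open>I\<close> vanish modulo \<open>p\<^sup>k\<close>.  Some
  element of \<open>I\<close> is then \<open>p\<^sup>k\<close> times a unit, so its multiples approximate every element of \<open>p\<^sup>k \<int>\<^sub>p\<close>
  modulo every power of \<open>p\<close>, and \<open>I\<close> contains their limits.
\<close>

theorem Zp_group_coordinates:
  fixes p :: nat and \<Gamma> :: "'g monoid" (structure) and T :: "'g topology"
  assumes p: "prime p" and Z: "Zp_group p \<Gamma> T"
  shows "\<exists>c. padic_coordinates p \<Gamma> c \<and>
    (\<forall>I. subgroup I \<Gamma> \<longrightarrow> closedin T I \<longrightarrow> I \<noteq> {\<one>\<^bsub>\<Gamma>\<^esub>} \<longrightarrow> (\<exists>k. I = power_subgroup p \<Gamma> k))"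
proof -
  interpret Zp_group p \<Gamma> T by (rule Z)
  obtain \<phi> where iso: "\<phi> \<in> iso \<Gamma> (padic_int p)" and homeo: "homeomorphic_map T (padic_topology p) \<phi>"
    using iso_padic by blast
  have bij: "bij_betw \<phi> (carrier \<Gamma>) (carrier (padic_int p))"
    and hom: "\<And>x y. x \<in> carrier \<Gamma> \<Longrightarrow> y \<in> carrier \<Gamma> \<Longrightarrow> \<phi> (x \<otimes> y) = \<phi> x \<otimes>\<^bsub>padic_int p\<^esub> \<phi> y"
    using iso by (auto simp: iso_def hom_def)
  have im: "\<phi> x \<in> carrier (padic_int p)" if "x \<in> carrier \<Gamma>" for x
    using bij that by (auto simp: bij_betw_def)
  define c where "c n x = nat (\<phi> x n)" for n x
  have int_c: "int (c n x) = \<phi> x n" if "x \<in> carrier \<Gamma>" for n x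
    using im[OF that] by (auto simp: padic_int_def c_def)
  have p0: "p > 0" using prime_gt_0_nat[OF p] .
  interpret padic_coordinates p \<Gamma> c
  proof unfold_locales
    fix n x assume x: "x \<in> carrier \<Gamma>"
    have "int (c n x) < int (p ^ n)" using im[OF x] by (simp add: int_c[OF x] padic_int_def)
    then show "c n x < p ^ n" by linarith
    have "int (c (Suc n) x mod p ^ n) = int (c n x)"
      using im[OF x] by (simp add: int_c[OF x] padic_int_def zmod_int)
    then show "c (Suc n) x mod p ^ n = c n x" by (simp only: of_nat_eq_iff)
  next
    fix n x y assume x: "x \<in> carrier \<Gamma>" and y: "y \<in> carrier \<Gamma>"
    have "int (c n (x \<otimes> y)) = int ((c n x + c n y) mod p ^ n)"
      using hom[OF x y] x y by (simp add: int_c zmod_int) (simp add: padic_int_def)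
    then show "c n (x \<otimes> y) = (c n x + c n y) mod p ^ n" by (simp only: of_nat_eq_iff)
  next
    fix x y assume x: "x \<in> carrier \<Gamma>" and y: "y \<in> carrier \<Gamma>" and eq: "\<And>n. c n x = c n y"
    have "\<phi> x = \<phi> y"
      using eq by (intro ext) (metis int_c x y)
    then show "x = y" using bij x y by (auto simp: bij_betw_def inj_on_def)
  next
    fix f assume f: "\<And>n. f n < p ^ n \<and> f (Suc n) mod p ^ n = f n"
    have "(\<lambda>n. int (f n)) \<in> carrier (padic_int p)"
    proof -
      have "int (f n) < int p ^ n \<and> int (f (Suc n)) mod int p ^ n = int (f n)" for n
        using f[of n] by (metis of_nat_less_iff of_nat_power zmod_int)
      then show ?thesis by (simp add: padic_int_def)
    qed
    then have "(\<lambda>n. int (f n)) \<in> \<phi> ` carrier \<Gamma>" using bij by (simp add: bij_betw_def)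
    then obtain x where "x \<in> carrier \<Gamma>" "\<phi> x = (\<lambda>n. int (f n))" by (elim imageE) simp
    then show "\<exists>x\<in>carrier \<Gamma>. \<forall>n. c n x = f n" by (intro bexI[of _ x]) (simp_all add: c_def)
  qed (rule p)
  have "\<exists>k. I = power_subgroup p \<Gamma> k" if I: "subgroup I \<Gamma>" "closedin T I" "I \<noteq> {\<one>}" for I
  proof -
    have Isub: "I \<subseteq> carrier \<Gamma>" using I(1) by (rule subgroup.subset)
    have oneI: "\<one> \<in> I" using I(1) by (rule subgroup.one_closed)
    obtain x0 where x0: "x0 \<in> I" "x0 \<noteq> \<one>" using I(3) oneI by blast
    have "\<exists>n. \<exists>x\<in>I. c n x \<noteq> 0"
    proof (rule ccontr)
      assume "\<not> ?thesis"
      then have "x0 = \<one>" using x0(1) Isub by (intro c_inj) (auto simp: c_one)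
      then show False using x0(2) by simp
    qed
    define N where "N = (LEAST n. \<exists>x\<in>I. c n x \<noteq> 0)"
    have "\<exists>x\<in>I. c N x \<noteq> 0" unfolding N_def by (rule LeastI_ex) fact
    then obtain x1 where x1: "x1 \<in> I" "c N x1 \<noteq> 0" by blast
    have x1c: "x1 \<in> carrier \<Gamma>" using x1 Isub by auto
    have "N \<noteq> 0" using x1(2) c_less[OF x1c, of 0] by (intro notI) simp
    then obtain k where k: "N = Suc k" by (cases N) auto
    have ck: "c k x = 0" if "x \<in> I" for x
      using not_less_Least[of k "\<lambda>n. \<exists>x\<in>I. c n x \<noteq> 0"] that k by (auto simp: N_def)
    have "I = power_subgroup p \<Gamma> k"
    proof (intro equalityI subsetI)
      fix x assume "x \<in> I"
      then show "x \<in> power_subgroup p \<Gamma> k" using ck Isub by (auto simp: power_subgroup_eq)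
    next
      fix y assume "y \<in> power_subgroup p \<Gamma> k"
      then have y: "y \<in> carrier \<Gamma>" "c k y = 0" by (simp_all add: power_subgroup_eq)
      show "y \<in> I"
      proof (rule ccontr)
        assume nI: "y \<notin> I"
        have "openin T (carrier \<Gamma> - I)" using I(2) by (simp add: closedin_def topspace_eq)
        then have "openin (padic_topology p) (\<phi> ` (carrier \<Gamma> - I))"
          using homeomorphic_map_openness[OF homeo, of "carrier \<Gamma> - I"] by (simp add: topspace_eq)
        then obtain n where n: "\<And>z. z \<in> carrier (padic_int p) \<Longrightarrow> z n = \<phi> y n \<Longrightarrow> z \<in> \<phi> ` (carrier \<Gamma> - I)"
          using padic_topology_basis[of p "\<phi> ` (carrier \<Gamma> - I)" "\<phi> y"] y nI by auto
        have "\<exists>m. c n (x1 [^] (m::nat)) = c n y"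
        proof (cases "n \<le> k")
          case True
          have "c n y = 0" using c_mod[OF y(1) True] y(2) by simp
          then show ?thesis by (intro exI[of _ 0]) (simp add: c_one)
        next
          case False
          have "p ^ k dvd c n x1" "p ^ k dvd c n y"
            using c_mod[OF x1c, of k n] c_mod[OF y(1), of k n] ck[OF x1(1)] y(2) False
            by (simp_all add: mod_eq_0_iff_dvd)
          then obtain u t where u: "c n x1 = p ^ k * u" and t: "c n y = p ^ k * t" by (auto elim!: dvdE)
          have "\<not> p dvd u"
          proof
            assume "p dvd u"
            then have "p ^ Suc k dvd c n x1" unfolding u by (simp add: mult.commute)
            then have "c n x1 mod p ^ N = 0" by (simp add: k mod_eq_0_iff_dvd)
            then show False using c_mod[OF x1c, of N n] x1(2) False k by simp
          qed
          then obtain m where "[m * u = t] (mod p ^ n)" using prime_power_congruence_solvable[OF p] by blast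
          then have "[p ^ k * (m * u) = p ^ k * t] (mod p ^ n)" by (intro cong_mult cong_refl)
          then have "(m * c n x1) mod p ^ n = c n y mod p ^ n"
            by (simp add: u t cong_def mult_ac)
          then show ?thesis using c_less[OF y(1), of n] by (intro exI[of _ m]) (simp add: c_pow[OF x1c])
        qed
        then obtain m where m: "c n (x1 [^] (m::nat)) = c n y" by blast
        let ?w = "x1 [^] m"
        have wI: "?w \<in> I" using x1(1) I(1) by (simp add: subgroup_int_pow_closed[OF I(1)] int_pow_int[symmetric])
        then have wc: "?w \<in> carrier \<Gamma>" using Isub by auto
        have "\<phi> ?w n = \<phi> y n" using m int_c[OF wc] int_c[OF y(1)] by metis
        then have "\<phi> ?w \<in> \<phi> ` (carrier \<Gamma> - I)" using n im[OF wc] by blast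
        then have "?w \<notin> I" using bij wc by (auto simp: bij_betw_def inj_on_def)
        then show False using wI by simp
      qed
    qed
    then show ?thesis by blast
  qed
  then show ?thesis using padic_coordinates_axioms by blast
qed

section \<open>The derived graphs in coordinates\<close>

lemma laplacian_transport:
  assumes wf: "wf_digraph G1"
    and F: "bij_betw F (verts G1) (verts G2)" and H: "bij_betw H (arcs G1) (arcs G2)"
    and tail: "\<And>e. e \<in> arcs G1 \<Longrightarrow> tail G2 (H e) = F (tail G1 e)"
    and head: "\<And>e. e \<in> arcs G1 \<Longrightarrow> head G2 (H e) = F (head G1 e)"
    and x: "x \<in> verts G1" and y: "y \<in> verts G1"
  shows "laplacian G2 (F x) (F y) = laplacian G1 x y"
proof -
  interpret wf_digraph G1 by (rule wf)
  have Finj: "F u = F v \<longleftrightarrow> u = v" if "u \<in> verts G1" "v \<in> verts G1" for u v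
    using F that by (auto simp: bij_betw_def inj_on_def)
  have Hinj: "inj_on H (out_arcs G1 x)"
    using H by (auto simp: bij_betw_def inj_on_def)
  have "out_arcs G2 (F x) = H ` out_arcs G1 x"
  proof (intro equalityI subsetI)
    fix e' assume "e' \<in> out_arcs G2 (F x)"
    then have e': "e' \<in> arcs G2" "tail G2 e' = F x" by simp_all
    then obtain e where e: "e \<in> arcs G1" "e' = H e" using H by (auto simp: bij_betw_def)
    then have "tail G1 e = x" using e'(2) tail[OF e(1)] Finj[of "tail G1 e" x] x by simp
    then show "e' \<in> H ` out_arcs G1 x" using e by auto
  next
    fix e' assume "e' \<in> H ` out_arcs G1 x"
    then show "e' \<in> out_arcs G2 (F x)" using H tail by (auto simp: bij_betw_def)
  qed
  then have "laplacian G2 (F x) (F y) = (\<Sum>e\<in>out_arcs G1 x. of_bool (F x = F y) - of_bool (head G2 (H e) = F y))"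
    unfolding laplacian_def by (simp add: sum.reindex[OF Hinj])
  also have "\<dots> = laplacian G1 x y"
    unfolding laplacian_def
  proof (rule sum.cong[OF refl])
    fix e assume "e \<in> out_arcs G1 x"
    then have e: "e \<in> arcs G1" by simp
    show "of_bool (F x = F y) - of_bool (head G2 (H e) = F y) = (of_bool (x = y) - of_bool (head G1 e = y) :: int)"
      using e x y by (simp add: head Finj)
  qed
  finally show ?thesis .
qed

text \<open>
  The isotropy groups take only these two forms because every nontrivial closed subgroup of a group
  isomorphic to \<open>\<int>\<^sub>p\<close> consists of the \<open>p\<^sup>k\<close>-th powers for some \<open>k\<close>.
\<close>

locale ramified_tower = padic_coordinates p \<Gamma> c + serre_graph X bar
  for p :: nat and \<Gamma> :: "'g monoid" and c :: "nat \<Rightarrow> 'g \<Rightarrow> nat"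
    and X :: "('v, 'e) pre_digraph" and bar :: "'e \<Rightarrow> 'e" +
  fixes \<alpha> :: "'e \<Rightarrow> 'g" and I :: "'v \<Rightarrow> 'g set" and k :: "'v \<Rightarrow> nat"
  assumes volt: "voltage_assignment \<Gamma> X bar \<alpha>"
    and I_cases: "\<And>v. v \<in> verts X \<Longrightarrow> I v = {\<one>\<^bsub>\<Gamma>\<^esub>} \<or> I v = power_subgroup p \<Gamma> (k v)"
begin

lemma alpha: "e \<in> arcs X \<Longrightarrow> \<alpha> e \<in> carrier \<Gamma>" "e \<in> arcs X \<Longrightarrow> \<alpha> (bar e) = inv\<^bsub>\<Gamma>\<^esub> (\<alpha> e)"
  using volt by (auto simp: voltage_assignment_def)

sublocale voltage_tower X bar p "\<lambda>m e. c m (\<alpha> e)" "trivial_verts \<Gamma> X I" k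
proof unfold_locales
  show "prime p" by (rule prime_p)
  show "trivial_verts \<Gamma> X I \<subseteq> verts X" by (auto simp: trivial_verts_def)
  fix e m assume e: "e \<in> arcs X"
  show "[c (Suc m) (\<alpha> e) = c m (\<alpha> e)] (mod p ^ m)"
    using c_Suc[OF alpha(1)[OF e], of m] c_less[OF alpha(1)[OF e], of m] by (simp add: cong_def)
  show "[c m (\<alpha> e) + c m (\<alpha> (bar e)) = 0] (mod p ^ m)"
    using c_inv[OF alpha(1)[OF e], of m] by (simp add: alpha(2)[OF e] cong_def)
qed

abbreviation derived :: "nat \<Rightarrow> ('g set set \<times> 'v, 'g set \<times> 'e) pre_digraph" where
  "derived n \<equiv> derived_graph p \<Gamma> X \<alpha> I n"

abbreviation dbar :: "nat \<Rightarrow> 'g set \<times> 'e \<Rightarrow> 'g set \<times> 'e" where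
  "dbar n \<equiv> derived_bar p \<Gamma> X bar \<alpha> n"

text \<open>
  A coset of the image of \<open>I v\<close> in \<open>\<Gamma>\<^sub>n\<close>: the residues modulo \<open>p\<^sup>n\<close> that agree with \<open>i\<close> modulo the index.
\<close>

definition coset_of_residue :: "nat \<Rightarrow> 'v \<Rightarrow> nat \<Rightarrow> 'g set set" where
  "coset_of_residue n v i = residue_class n ` {j. j < p ^ n \<and> j mod width n v = i}"

end

text \<open>
  A level \<open>n\<close> so high that every nontrivial \<open>I v\<close> contains \<open>\<Gamma>\<^bsup>p^n\<^esup>\<close>.
\<close>

locale ramified_level = ramified_tower + voltage_step X bar p "\<lambda>m e. c m (\<alpha> e)" "trivial_verts \<Gamma> X I" k n
  for n
begin

lemma width_le: "v \<in> verts X \<Longrightarrow> width n v \<le> p ^ n"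
  using width_dvd pn0 by (simp add: dvd_imp_le)

lemma image_isotropy:
  assumes v: "v \<in> verts X"
  shows "level_proj p \<Gamma> n ` I v = coset_of_residue n v 0"
proof (cases "v \<in> trivial_verts \<Gamma> X I")
  case True
  then have w: "width n v = p ^ n" by (simp only: width_def if_True)
  have I: "I v = {\<one>\<^bsub>\<Gamma>\<^esub>}" using True by (simp add: trivial_verts_def)
  have "{j. j < p ^ n \<and> j mod p ^ n = 0} = {0}" using pn0[of n] by auto
  then show ?thesis unfolding I coset_of_residue_def w by (simp add: level_proj_eq c_one)
next
  case False
  then have w: "width n v = p ^ k v" by (simp only: width_def if_False)
  have I: "I v = power_subgroup p \<Gamma> (k v)" using False I_cases[OF v] v by (auto simp: trivial_verts_def)
  have kn: "k v \<le> n" using k[of v] False v by simp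
  have "c n ` power_subgroup p \<Gamma> (k v) = {j. j < p ^ n \<and> j mod p ^ k v = 0}"
  proof (intro equalityI subsetI)
    fix j assume "j \<in> c n ` power_subgroup p \<Gamma> (k v)"
    then show "j \<in> {j. j < p ^ n \<and> j mod p ^ k v = 0}"
      using c_mod[OF _ kn] c_less by (auto simp: power_subgroup_eq)
  next
    fix j assume j: "j \<in> {j. j < p ^ n \<and> j mod p ^ k v = 0}"
    then obtain x where x: "x \<in> carrier \<Gamma>" "c n x = j" using c_surj[of j n] by blast
    then have "c (k v) x = 0" using c_mod[OF x(1) kn] j by simp
    then show "j \<in> c n ` power_subgroup p \<Gamma> (k v)" using x by (auto simp: power_subgroup_eq)
  qed
  moreover have "level_proj p \<Gamma> n ` power_subgroup p \<Gamma> (k v) = residue_class n ` c n ` power_subgroup p \<Gamma> (k v)"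
    unfolding image_image by (rule image_cong[OF refl]) (simp add: level_proj_eq power_subgroup_eq)
  ultimately show ?thesis unfolding I coset_of_residue_def w by simp
qed

lemma isotropy_coset:
  assumes v: "v \<in> verts X" and j: "j < p ^ n"
  shows "(level_proj p \<Gamma> n ` I v) #>\<^bsub>level_group p \<Gamma> n\<^esub> residue_class n j = coset_of_residue n v (j mod width n v)"
proof -
  let ?w = "width n v"
  have "(level_proj p \<Gamma> n ` I v) #>\<^bsub>level_group p \<Gamma> n\<^esub> residue_class n j =
    (\<lambda>i. residue_class n i \<otimes>\<^bsub>level_group p \<Gamma> n\<^esub> residue_class n j) ` {i. i < p ^ n \<and> i mod ?w = 0}"
    unfolding image_isotropy[OF v] coset_of_residue_def r_coset_def UNION_singleton_eq_range image_image ..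
  also have "\<dots> = (\<lambda>i. residue_class n ((i + j) mod p ^ n)) ` {i. i < p ^ n \<and> i mod ?w = 0}"
    by (rule image_cong[OF refl]) (simp add: level_group_mult j)
  also have "\<dots> = residue_class n ` ((\<lambda>i. (i + j) mod p ^ n) ` {i. i < p ^ n \<and> i mod ?w = 0})"
    by (simp only: image_image)
  also have "(\<lambda>i. (i + j) mod p ^ n) ` {i. i < p ^ n \<and> i mod ?w = 0} = {l. l < p ^ n \<and> l mod ?w = j mod ?w}"
  proof (intro equalityI subsetI)
    fix l assume "l \<in> (\<lambda>i. (i + j) mod p ^ n) ` {i. i < p ^ n \<and> i mod ?w = 0}"
    then obtain i where i': "l = (i + j) mod p ^ n" "i \<in> {i. i < p ^ n \<and> i mod ?w = 0}" by (rule imageE)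
    then have i: "i mod ?w = 0" "l = (i + j) mod p ^ n" by simp_all
    have "l mod ?w = (i + j) mod ?w" unfolding i(2) by (rule mod_mod_cancel[OF width_dvd[OF v]])
    also have "\<dots> = j mod ?w" using i(1) by (metis add_0 mod_add_left_eq)
    finally show "l \<in> {l. l < p ^ n \<and> l mod ?w = j mod ?w}"
      using i(2) mod_less_divisor[OF pn0] by simp
  next
    fix l assume "l \<in> {l. l < p ^ n \<and> l mod ?w = j mod ?w}"
    then have l: "l < p ^ n" "l mod ?w = j mod ?w" by simp_all
    let ?i = "(l + (p ^ n - j)) mod p ^ n"
    have "?i mod ?w = (l + (p ^ n - j)) mod ?w" by (rule mod_mod_cancel[OF width_dvd[OF v]])
    also have "\<dots> = (j + (p ^ n - j)) mod ?w" using l(2) by (rule mod_add_cong) simp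
    also have "\<dots> = 0" using j width_dvd[OF v] by (simp add: mod_eq_0_iff_dvd)
    finally have "?i mod ?w = 0" .
    moreover have "?i < p ^ n" by (rule mod_less_divisor[OF pn0])
    moreover have "(?i + j) mod p ^ n = l"
    proof -
      have "(?i + j) mod p ^ n = (l + (p ^ n - j) + j) mod p ^ n" by (rule mod_add_left_eq)
      also have "l + (p ^ n - j) + j = l + p ^ n" using j by simp
      finally show ?thesis using l(1) by simp
    qed
    ultimately show "l \<in> (\<lambda>i. (i + j) mod p ^ n) ` {i. i < p ^ n \<and> i mod ?w = 0}"
      by (intro image_eqI[of _ _ ?i]) simp_all
  qed
  finally show ?thesis by (simp add: coset_of_residue_def)
qed

definition vertex_iso :: "'b \<times> nat \<Rightarrow> 'a set set \<times> 'b" where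
  "vertex_iso = (\<lambda>(v, i). (coset_of_residue n v i, v))"

definition arc_iso :: "'c \<times> nat \<Rightarrow> 'a set \<times> 'c" where
  "arc_iso = (\<lambda>(e, j). (residue_class n j, e))"

lemma coset_of_residue_inj:
  assumes v: "v \<in> verts X" and i: "i < width n v" and eq: "coset_of_residue n v i = coset_of_residue n v i'"
  shows "i = i'"
proof -
  have ip: "i < p ^ n" using i width_le[OF v] by simp
  then have "residue_class n i \<in> coset_of_residue n v i"
    unfolding coset_of_residue_def using i by simp
  then have "residue_class n i \<in> coset_of_residue n v i'" unfolding eq .
  then obtain j where "residue_class n i = residue_class n j" "j mod width n v = i'"
    by (auto simp: coset_of_residue_def)
  then show ?thesis using residue_class_inj[OF ip] i by auto
qed

lemma verts_derived: "verts (derived n) = {(coset_of_residue n v i, v) | v i. v \<in> verts X \<and> i < width n v}"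
proof -
  have "carrier (level_group p \<Gamma> n Mod level_proj p \<Gamma> n ` I v) = coset_of_residue n v ` {..<width n v}"
    if v: "v \<in> verts X" for v
  proof -
    have "carrier (level_group p \<Gamma> n Mod level_proj p \<Gamma> n ` I v) =
      (\<lambda>B. (level_proj p \<Gamma> n ` I v) #>\<^bsub>level_group p \<Gamma> n\<^esub> B) ` residue_class n ` {..<p ^ n}"
      unfolding carrier_level_group[symmetric] by (auto simp: FactGroup_def RCOSETS_def)
    also have "\<dots> = (\<lambda>j. coset_of_residue n v (j mod width n v)) ` {..<p ^ n}"
      unfolding image_image by (rule image_cong[OF refl]) (simp add: isotropy_coset[OF v])
    also have "\<dots> = coset_of_residue n v ` {..<width n v}"
    proof (intro equalityI subsetI)
      fix A assume "A \<in> coset_of_residue n v ` {..<width n v}"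
      then obtain i where "i < width n v" "A = coset_of_residue n v i" by blast
      then show "A \<in> (\<lambda>j. coset_of_residue n v (j mod width n v)) ` {..<p ^ n}"
        using width_le[OF v] by (intro image_eqI[of _ _ i]) simp_all
    qed (use width_pos in auto)
    finally show ?thesis .
  qed
  then show ?thesis by (auto simp: derived_graph_def Let_def)
qed

lemma bij_vertex_iso: "bij_betw vertex_iso (verts (level n)) (verts (derived n))"
proof -
  have "inj_on vertex_iso (verts (level n))"
  proof (rule inj_onI)
    fix x y assume x: "x \<in> verts (level n)" and y: "y \<in> verts (level n)" and eq: "vertex_iso x = vertex_iso y"
    obtain v i where vi: "x = (v, i)" by (cases x)
    have v: "v \<in> verts X" "i < width n v" using x by (simp_all add: vi level_def)
    obtain i' where y': "y = (v, i')" "coset_of_residue n v i = coset_of_residue n v i'"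
      using eq by (cases y) (auto simp: vi vertex_iso_def)
    show "x = y" using coset_of_residue_inj[OF v y'(2)] by (simp add: vi y')
  qed
  moreover have "vertex_iso ` verts (level n) = verts (derived n)"
    unfolding verts_derived by (force simp: vertex_iso_def level_def)
  ultimately show ?thesis by (simp add: bij_betw_def)
qed

lemma arcs_derived: "arcs (derived n) = residue_class n ` {..<p ^ n} \<times> arcs X"
  by (simp add: derived_graph_def Let_def carrier_level_group)

lemma bij_arc_iso: "bij_betw arc_iso (arcs (level n)) (arcs (derived n))"
proof -
  have "inj_on arc_iso (arcs (level n))"
  proof (rule inj_onI)
    fix x y assume x: "x \<in> arcs (level n)" and y: "y \<in> arcs (level n)" and eq: "arc_iso x = arc_iso y"
    obtain e j where ej: "x = (e, j)" by (cases x)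
    have j: "j < p ^ n" using x by (simp add: ej level_def)
    obtain j' where y': "y = (e, j')" "residue_class n j = residue_class n j'"
      using eq by (cases y) (auto simp: ej arc_iso_def)
    show "x = y" using residue_class_inj[OF j y'(2)] by (simp add: ej y')
  qed
  moreover have "arc_iso ` arcs (level n) = arcs (derived n)"
    unfolding arcs_derived by (force simp: arc_iso_def level_def)
  ultimately show ?thesis by (simp add: bij_betw_def)
qed

lemma tail_derived:
  assumes "e \<in> arcs X" "j < p ^ n"
  shows "tail (derived n) (residue_class n j, e) = vertex_iso (tail X e, j mod width n (tail X e))"
  using assms by (simp add: derived_graph_def Let_def isotropy_coset vertex_iso_def)

lemma arc_voltage:
  assumes "e \<in> arcs X" "j < p ^ n"
  shows "residue_class n j \<otimes>\<^bsub>level_group p \<Gamma> n\<^esub> level_proj p \<Gamma> n (\<alpha> e) = residue_class n ((j + c n (\<alpha> e)) mod p ^ n)"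
  using assms by (simp add: level_proj_eq alpha(1) level_group_mult c_less)

lemma head_derived:
  assumes "e \<in> arcs X" "j < p ^ n"
  shows "head (derived n) (residue_class n j, e) =
    vertex_iso (head X e, (j + c n (\<alpha> e)) mod width n (head X e))"
  using assms mod_less_divisor[OF pn0] width_dvd[of "head X e"]
  by (simp add: derived_graph_def Let_def arc_voltage isotropy_coset vertex_iso_def mod_mod_cancel)

lemma dbar_apply:
  assumes "e \<in> arcs X" "j < p ^ n"
  shows "dbar n (residue_class n j, e) = (residue_class n ((j + c n (\<alpha> e)) mod p ^ n), bar e)"
  using assms by (simp add: derived_bar_def arc_voltage carrier_level_group)

lemma arcs_derived_cases:
  assumes "x \<in> arcs (derived n)"
  obtains j e where "x = (residue_class n j, e)" "j < p ^ n" "e \<in> arcs X"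
  using assms unfolding arcs_derived by auto

lemma serre_graph_derived: "serre_graph (derived n) (dbar n)"
proof -
  have vi: "vertex_iso (v, i) \<in> verts (derived n)" if "v \<in> verts X" "i < width n v" for v i
    using that unfolding verts_derived by (auto simp: vertex_iso_def)
  interpret D: fin_digraph "derived n"
  proof unfold_locales
    fix x assume "x \<in> arcs (derived n)"
    then obtain j e where x: "x = (residue_class n j, e)" "j < p ^ n" "e \<in> arcs X"
      by (rule arcs_derived_cases)
    show "tail (derived n) x \<in> verts (derived n)"
      unfolding x(1) tail_derived[OF x(3,2)] using x(3) width_pos by (intro vi) simp_all
    show "head (derived n) x \<in> verts (derived n)"
      unfolding x(1) head_derived[OF x(3,2)] using x(3) width_pos by (intro vi) simp_all
  next
    show "finite (verts (derived n))"
      using bij_betw_finite[OF bij_vertex_iso] fin_digraph.finite_verts[OF fin_digraph_level] by blast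
    show "finite (arcs (derived n))"
      using bij_betw_finite[OF bij_arc_iso] fin_digraph.finite_arcs[OF fin_digraph_level] by blast
  qed
  have "bidirected_digraph (derived n) (dbar n)"
  proof (rule D.bidirected_digraphI)
    fix x assume "x \<notin> arcs (derived n)"
    then show "dbar n x = x"
      by (cases x) (auto simp: arcs_derived derived_bar_def carrier_level_group)
  next
    fix x assume "x \<in> arcs (derived n)"
    then obtain j e where x: "x = (residue_class n j, e)" "j < p ^ n" "e \<in> arcs X"
      by (rule arcs_derived_cases)
    let ?j = "(j + c n (\<alpha> e)) mod p ^ n"
    have j': "?j < p ^ n" by (rule mod_less_divisor[OF pn0])
    have be: "bar e \<in> arcs X" using x(3) by simp
    show "dbar n x \<noteq> x" unfolding x(1) dbar_apply[OF x(3,2)] using arev_neq[OF x(3)] by simp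
    have "(c n (\<alpha> e) + c n (\<alpha> (bar e))) mod p ^ n = 0"
      using c_inv[OF alpha(1)[OF x(3)]] by (simp add: alpha(2)[OF x(3)])
    then have "(j + (c n (\<alpha> e) + c n (\<alpha> (bar e)))) mod p ^ n = (j + 0) mod p ^ n"
      by (intro mod_add_cong) simp_all
    then have "(?j + c n (\<alpha> (bar e))) mod p ^ n = j"
      using x(2) by (simp add: mod_add_left_eq add.assoc)
    then show "dbar n (dbar n x) = x"
      unfolding x(1) dbar_apply[OF x(3,2)] dbar_apply[OF be j'] by simp
    show "tail (derived n) (dbar n x) = head (derived n) x"
      unfolding x(1) dbar_apply[OF x(3,2)] tail_derived[OF be j'] head_derived[OF x(3,2)]
      using x(3) width_dvd[of "head X e"] by (simp add: mod_mod_cancel)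
  qed
  then show ?thesis
    by (intro serre_graph.intro D.fin_digraph)
qed

text \<open>
  The derived graph is isomorphic to the graph \<open>level n\<close>, so the matrix-tree theorem for the former is
  a statement about the Laplacian of the latter.
\<close>

theorem kappa_derived_det:
  assumes r: "r \<in> verts (level n)"
  shows "det_on (verts (level n)) (\<lambda>x y. laplacian (level n) x y + w x * of_bool (y = r)) =
    int (kappa (derived n) (dbar n)) * (\<Sum>x\<in>verts (level n). w x)"
proof -
  interpret D: serre_graph "derived n" "dbar n" by (rule serre_graph_derived)
  interpret L: fin_digraph "level n" by (rule fin_digraph_level)
  let ?F = vertex_iso
  let ?g = "inv_into (verts (level n)) ?F"
  have inj: "inj_on ?F (verts (level n))" using bij_vertex_iso by (simp add: bij_betw_def)
  have g: "?g (?F x) = x" if "x \<in> verts (level n)" for x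
    using inj that by simp
  have Fr: "?F r \<in> verts (derived n)" using bij_vertex_iso r by (auto simp: bij_betw_def)
  have arc: "tail (derived n) (arc_iso e) = ?F (tail (level n) e) \<and> head (derived n) (arc_iso e) = ?F (head (level n) e)"
    if "e \<in> arcs (level n)" for e
    using that by (auto simp: level_def arc_iso_def tail_derived head_derived)
  have "int (kappa (derived n) (dbar n)) * (\<Sum>y\<in>verts (derived n). w (?g y)) =
    det_on (verts (derived n)) (\<lambda>x y. laplacian (derived n) x y + w (?g x) * of_bool (y = ?F r))"
    by (rule D.matrix_tree[OF Fr, symmetric])
  also have "\<dots> = det_on (verts (level n))
      (\<lambda>x y. laplacian (derived n) (?F x) (?F y) + w (?g (?F x)) * of_bool (?F y = ?F r))"
    by (rule det_on_reindex[OF L.finite_verts bij_vertex_iso])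
  also have "\<dots> = det_on (verts (level n)) (\<lambda>x y. laplacian (level n) x y + w x * of_bool (y = r))"
  proof (rule det_on_cong)
    fix x y assume xy: "x \<in> verts (level n)" "y \<in> verts (level n)"
    have "laplacian (derived n) (?F x) (?F y) = laplacian (level n) x y"
      using arc xy by (intro laplacian_transport[OF L.wf_digraph bij_vertex_iso bij_arc_iso]) auto
    moreover have "?F y = ?F r \<longleftrightarrow> y = r" using inj xy r by (auto simp: inj_on_def)
    ultimately show "laplacian (derived n) (?F x) (?F y) + w (?g (?F x)) * of_bool (?F y = ?F r) =
      laplacian (level n) x y + w x * of_bool (y = r)" using g[OF xy(1)] by simp
  qed
  also have "(\<Sum>y\<in>verts (derived n). w (?g y)) = (\<Sum>x\<in>verts (level n). w x)"
    unfolding sum.reindex_bij_betw[OF bij_vertex_iso, symmetric] by (rule sum.cong[OF refl]) (simp only: g)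
  finally show ?thesis by simp
qed

end

section \<open>The parity of the lambda invariant\<close>

context ramified_tower
begin

lemma ramified_levelI:
  assumes "\<And>v. v \<in> verts X - trivial_verts \<Gamma> X I \<Longrightarrow> k v \<le> n"
  shows "ramified_level p \<Gamma> c X bar \<alpha> I k n"
  using assms by unfold_locales

text \<open>
  With \<open>ram_weight\<close> as perturbation the matrix-tree theorem at level \<open>n + 1\<close> gives the factor \<open>p N\<close> and
  with \<open>1\<close> as perturbation at level \<open>n\<close> the factor \<open>N\<close>, where \<open>N\<close> is the number of vertices at level \<open>n\<close>.
  This is where the summand \<open>-1\<close> in the formula for \<open>\<lambda>\<close> comes from.
\<close>

theorem kappa_step:
  assumes n: "\<And>v. v \<in> verts X - trivial_verts \<Gamma> X I \<Longrightarrow> k v \<le> n" and ne: "verts X \<noteq> {}"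
  shows "of_nat p * of_nat (kappa (derived (Suc n)) (dbar (Suc n))) =
    of_nat p ^ (\<Sum>v\<in>verts X - trivial_verts \<Gamma> X I. p ^ k v) * of_nat (kappa (derived n) (dbar n)) *
    (\<Prod>z\<in>primitive_roots p n. ceval (twist_poly (Suc n)) z)"
proof -
  interpret A: ramified_level p \<Gamma> c X bar \<alpha> I k n by (rule ramified_levelI) (rule n)
  interpret B: ramified_level p \<Gamma> c X bar \<alpha> I k "Suc n"
    by (rule ramified_levelI) (use n in \<open>auto intro: le_SucI\<close>)
  obtain v where v: "v \<in> verts X" using ne by blast
  let ?r = "(v, 0)"
  have r: "?r \<in> verts (level (Suc n))" using v width_pos by (simp add: level_def)
  have dr: "down n ?r \<in> verts (level n)" by (rule A.down_in_verts[OF r])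
  have card: "card (verts (level n)) > 0"
    using dr fin_digraph.finite_verts[OF fin_digraph_level, of n] by (auto simp: card_gt_0_iff)
  let ?R = "\<Sum>v\<in>verts X - trivial_verts \<Gamma> X I. p ^ k v"
  let ?N = "card (verts (level n))"
  have 1: "det_on (verts (level (Suc n))) (\<lambda>x y. laplacian (level (Suc n)) x y + ram_weight x * of_bool (y = ?r)) =
    int (kappa (derived (Suc n)) (dbar (Suc n))) * (int p * int ?N)"
    unfolding B.kappa_derived_det[OF r] A.sum_ram_weight ..
  have 2: "det_on (verts (level n)) (\<lambda>x y. laplacian (level n) x y + of_bool (y = down n ?r)) =
    int (kappa (derived n) (dbar n)) * int ?N"
    using A.kappa_derived_det[OF dr, of "\<lambda>_. 1"] by simp
  have "of_nat (kappa (derived (Suc n)) (dbar (Suc n))) * (of_nat p * of_nat ?N) =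
    of_nat p ^ ?R * (of_nat (kappa (derived n) (dbar n)) * of_nat ?N) *
    (\<Prod>z\<in>primitive_roots p n. ceval (twist_poly (Suc n)) z)"
    using A.det_level_step[OF r] unfolding 1 2 ceval_twist_poly by simp
  then show ?thesis using card by (simp add: mult_ac)
qed

lemma kappa_derived_pos:
  assumes "\<And>v. v \<in> verts X - trivial_verts \<Gamma> X I \<Longrightarrow> k v \<le> n" "connected_graph (derived n)"
  shows "kappa (derived n) (dbar n) > 0"
proof -
  interpret A: ramified_level p \<Gamma> c X bar \<alpha> I k n by (rule ramified_levelI) (rule assms(1))
  interpret D: serre_graph "derived n" "dbar n" by (rule A.serre_graph_derived)
  show ?thesis by (rule D.kappa_pos[OF assms(2)])
qed

end

text \<open>
  The second difference of \<open>l n + m p\<^sup>n + \<nu>\<close> determines \<open>m\<close>, and then the first difference determines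
  \<open>l\<close>.
\<close>

lemma iwasawa_invariants_unique:
  assumes p: "p > 1" and a: "iwasawa_invariants p f l m \<nu>" and b: "iwasawa_invariants p f l' m' \<nu>'"
  shows "l = l'"
proof -
  have "\<forall>\<^sub>F n in sequentially. int l * int n + int m * int p ^ n + \<nu> = int l' * int n + int m' * int p ^ n + \<nu>'"
    using a b unfolding iwasawa_invariants_def by eventually_elim simp
  then obtain N where N: "\<And>n. n \<ge> N \<Longrightarrow>
      int l * int n + int m * int p ^ n + \<nu> = int l' * int n + int m' * int p ^ n + \<nu>'"
    unfolding eventually_sequentially by blast
  define x y where "x = int l - int l'" and "y = int m - int m'"
  have d: "x + y * (int p ^ n * (int p - 1)) = 0" if "n \<ge> N" for n
    using N[OF that] N[of "Suc n"] that by (simp add: x_def y_def algebra_simps)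
  have "y * (int p ^ N * (int p - 1) * (int p - 1)) = 0"
    using d[of N] d[of "Suc N"] by (simp add: algebra_simps)
  then have "y = 0" using p by simp
  then have "x = 0" using d[of N] by simp
  then show ?thesis by (simp add: x_def)
qed

lemma iwasawa_lambda_eqI:
  assumes "p > 1" "iwasawa_invariants p (\<lambda>n. kappa (derived_graph p \<Gamma> X \<alpha> I n) (derived_bar p \<Gamma> X bar \<alpha> n)) l m \<nu>"
  shows "iwasawa_lambda p \<Gamma> X bar \<alpha> I = l"
  unfolding iwasawa_lambda_def using assms(2) iwasawa_invariants_unique[OF assms(1)]
  by (intro the_equality) blast+

lemma multiplicity_from_identity:
  fixes A B :: int
  assumes p: "prime p" and AB: "\<not> int p dvd A" "\<not> int p dvd B" and pos: "a > 0" "b > 0"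
    and eq: "A * (int p * int a) = B * int p ^ s * int b"
  shows "Suc (multiplicity p a) = s + multiplicity p b"
proof -
  have pp: "prime (int p)" using p by simp
  then have pe: "prime_elem (int p)" by simp
  have p1: "p > 1" using prime_gt_1_nat[OF p] .
  have times: "multiplicity (int p) (int p * x) = Suc (multiplicity (int p) x)" if "x \<noteq> 0" for x
    using p1 that by (intro multiplicity_times_same) simp_all
  have m: "multiplicity (int p) (int x) = multiplicity p x" if "x > 0" for x
  proof (rule multiplicity_eqI)
    have "p ^ multiplicity p x dvd x" by (rule multiplicity_dvd)
    then show "int p ^ multiplicity p x dvd int x" by (metis of_nat_dvd_iff of_nat_power)
    have "\<not> p ^ Suc (multiplicity p x) dvd x"
      using that p1 by (subst power_dvd_iff_le_multiplicity) auto
    then show "\<not> int p ^ Suc (multiplicity p x) dvd int x" by (metis of_nat_dvd_iff of_nat_power)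
  qed
  have pow: "multiplicity (int p) (int p ^ t * y) = t + multiplicity (int p) y" if "y \<noteq> 0" for t y
  proof (induction t)
    case (Suc t)
    then show ?case using times[of "int p ^ t * y"] p1 that by (simp add: mult.assoc)
  qed simp
  have "Suc (multiplicity p a) = multiplicity (int p) (A * (int p * int a))"
    using pos(1) by (simp add: multiplicity_prime_elem_times_other[OF pe AB(1)] times m)
  also have "\<dots> = s + multiplicity p b"
    using pos(2) by (simp add: eq mult.assoc multiplicity_prime_elem_times_other[OF pe AB(2)] pow m)
  finally show ?thesis .
qed

text \<open>
  The steps of \<open>ord\<^sub>p \<kappa>(X\<^sub>n)\<close> are \<open>R + l - 1 + \<mu> (p\<^bsup>n+1\<^esup> - p\<^sup>n)\<close> from some level on, which identifies the
  invariants.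
\<close>

theorem (in ramified_tower) iwasawa_lambda_parity:
  assumes ne: "verts X \<noteq> {}" and conn: "\<And>n. connected_graph (derived n)"
  shows "[int (iwasawa_lambda p \<Gamma> X bar \<alpha> I) = - 1 + (\<Sum>v\<in>verts X - trivial_verts \<Gamma> X I. int (p ^ k v))] (mod 2)"
proof -
  let ?U = "trivial_verts \<Gamma> X I"
  define R where "R = (\<Sum>v\<in>verts X - ?U. p ^ k v)"
  define K where "K = (\<Sum>v\<in>verts X - ?U. k v)"
  have p1: "p > 1" using prime_gt_1_nat[OF prime_p] .
  have K: "k v \<le> n" if "n \<ge> K" "v \<in> verts X - ?U" for n v
    using member_le_sum[of v "verts X - ?U" k] that by (simp add: K_def)
  define \<kappa> where "\<kappa> n = kappa (derived n) (dbar n)" for n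
  have pos: "\<kappa> n > 0" if "n \<ge> K" for n
    unfolding \<kappa>_def by (rule kappa_derived_pos[OF K[OF that] conn])
  have step: "complex_of_nat p * of_nat (\<kappa> (Suc n)) = of_nat p ^ R * of_nat (\<kappa> n) *
      (\<Prod>z\<in>primitive_roots p n. ceval (twist_poly (Suc n)) z)" if "n \<ge> K" for n
    unfolding \<kappa>_def R_def by (rule kappa_step[OF K[OF that] ne])
  have "card (primitive_roots p K) > 0"
  proof -
    have "p ^ K < p ^ Suc K" using p1 by (intro power_strict_increasing) auto
    then show ?thesis using p1 by (simp only: card_primitive_roots[of p K])
  qed
  then obtain z0 where z0: "z0 \<in> primitive_roots p K" by (auto simp: card_gt_0_iff)
  have z0': "z0 \<in> unity_roots (p ^ Suc K)" using z0 by (simp only: primitive_roots_def Diff_iff)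
  have nz: "ceval (twist_poly (Suc K)) z0 \<noteq> 0"
  proof
    assume "ceval (twist_poly (Suc K)) z0 = 0"
    then have "(\<Prod>z\<in>primitive_roots p K. ceval (twist_poly (Suc K)) z) = 0"
      using z0 finite_primitive_roots[of p K] p1 by (intro prod_zero) auto
    then have "complex_of_nat p * of_nat (\<kappa> (Suc K)) = 0" using step[of K] by simp
    then show False using pos[of "Suc K"] p1 by simp
  qed
  obtain \<mu> l m1 where l: "even l" and l0: "ceval (twist_poly 0) 1 = 0 \<Longrightarrow> l > 0"
    and val: "\<And>m. m \<ge> m1 \<Longrightarrow> \<exists>A B :: int. \<not> int p dvd A \<and> \<not> int p dvd B \<and>
       of_int A * (\<Prod>z\<in>primitive_roots p m. ceval (twist_poly (Suc m)) z) =
       of_int B * of_nat p ^ (\<mu> * (p ^ Suc m - p ^ m) + l)"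
    by (rule coherent_family_valuation[OF prime_p twist_poly_coherent twist_poly_symmetric z0' nz])
      (assumption | rule that)+
  \<comment> \<open>Without ramified vertices \<open>f\<close> vanishes at the trivial character, so \<open>l\<close> is positive; this makes \<open>R + l - 1\<close> a natural number.\<close>
  have Rl: "R + l > 0"
  proof (cases "verts X - ?U = {}")
    case True
    then have "?U = verts X" by (auto simp: trivial_verts_def)
    then have "l > 0" using l0 twist_poly_unramified[of 0] ne by blast
    then show ?thesis by simp
  next
    case False
    then have "R > 0" unfolding R_def using p1 by (intro sum_pos) auto
    then show ?thesis by simp
  qed
  define lam where "lam = R + l - 1"
  define N where "N = max K m1"
  let ?v = "\<lambda>n. multiplicity p (\<kappa> n)"
  have vstep: "int (?v (Suc n)) = int (?v n) + int lam + int \<mu> * (int p ^ Suc n - int p ^ n)" if "n \<ge> N" for n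
  proof -
    have nK: "n \<ge> K" and nm: "n \<ge> m1" using that by (simp_all add: N_def)
    let ?s = "R + (\<mu> * (p ^ Suc n - p ^ n) + l)"
    obtain A B :: int where AB: "\<not> int p dvd A" "\<not> int p dvd B"
      "of_int A * (\<Prod>z\<in>primitive_roots p n. ceval (twist_poly (Suc n)) z) =
       of_int B * of_nat p ^ (\<mu> * (p ^ Suc n - p ^ n) + l)"
      using val[OF nm] by blast
    have "complex_of_int (A * (int p * int (\<kappa> (Suc n)))) =
      of_int A * (of_nat p ^ R * of_nat (\<kappa> n) * (\<Prod>z\<in>primitive_roots p n. ceval (twist_poly (Suc n)) z))"
      unfolding step[OF nK, symmetric] by simp
    also have "\<dots> = of_nat p ^ R * of_nat (\<kappa> n) *
      (of_int A * (\<Prod>z\<in>primitive_roots p n. ceval (twist_poly (Suc n)) z))"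
      by (simp only: mult_ac)
    also have "\<dots> = of_int (B * int p ^ ?s * int (\<kappa> n))"
      unfolding AB(3) by (simp add: power_add mult_ac del: power_Suc)
    finally have eq: "A * (int p * int (\<kappa> (Suc n))) = B * int p ^ ?s * int (\<kappa> n)"
      by (simp only: of_int_eq_iff)
    have pos': "\<kappa> (Suc n) > 0" "\<kappa> n > 0" using pos nK by simp_all
    have "Suc (?v (Suc n)) = ?s + ?v n"
      by (rule multiplicity_from_identity[OF prime_p AB(1,2) pos' eq])
    moreover have "int (p ^ Suc n - p ^ n) = int p ^ Suc n - int p ^ n"
    proof -
      have "p ^ n \<le> p ^ Suc n" using p1 by (intro power_increasing) auto
      then show ?thesis by (simp only: of_nat_diff of_nat_power)
    qed
    then have "int (\<mu> * (p ^ Suc n - p ^ n)) = int \<mu> * (int p ^ Suc n - int p ^ n)" by (simp only: of_nat_mult)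
    moreover have "int lam = int R + int l - 1" using Rl unfolding lam_def by linarith
    ultimately show ?thesis by linarith
  qed
  define \<nu> where "\<nu> = int (?v N) - int lam * int N - int \<mu> * int p ^ N"
  have "int (?v n) = int lam * int n + int \<mu> * int p ^ n + \<nu>" if "n \<ge> N" for n
    using that
  proof (induction n rule: dec_induct)
    case (step n)
    then show ?case using vstep[OF step(1)] by (simp add: algebra_simps)
  qed (simp add: \<nu>_def)
  then have "iwasawa_invariants p \<kappa> lam \<mu> \<nu>"
    unfolding iwasawa_invariants_def eventually_sequentially by blast
  then have "iwasawa_lambda p \<Gamma> X bar \<alpha> I = lam"
    unfolding \<kappa>_def by (rule iwasawa_lambda_eqI[OF p1])
  moreover have "int lam = - 1 + int R + int l" using Rl unfolding lam_def by linarith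
  moreover have "(- 1 + int R + int l) mod 2 = (- 1 + int R) mod 2" using l by presburger
  ultimately show ?thesis unfolding cong_def R_def by simp
qed

theorem proposition6p3:
  fixes p :: nat
    and \<Gamma> :: "'g monoid" and T :: "'g topology"
    and X :: "('v, 'e) pre_digraph" and bar :: "'e \<Rightarrow> 'e"
    and \<alpha> :: "'e \<Rightarrow> 'g" and I :: "'v \<Rightarrow> 'g set"
  assumes "prime p"
    and "Zp_group p \<Gamma> T"
    and "serre_graph X bar"
    and "connected_graph X"
    and "voltage_assignment \<Gamma> X bar \<alpha>"
    and "\<And>v. v \<in> verts X \<Longrightarrow> subgroup (I v) \<Gamma>"
    and "\<And>v. v \<in> verts X \<Longrightarrow> closedin T (I v)"
    and "\<And>n. connected_graph (derived_graph p \<Gamma> X \<alpha> I n)"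
  shows "[int (iwasawa_lambda p \<Gamma> X bar \<alpha> I) =
          - 1 + (\<Sum>v \<in> verts X - trivial_verts \<Gamma> X I. int (card (rcosets\<^bsub>\<Gamma>\<^esub> (I v))))] (mod 2)"
proof -
  obtain c where c: "padic_coordinates p \<Gamma> c"
    and closed: "\<And>J. subgroup J \<Gamma> \<Longrightarrow> closedin T J \<Longrightarrow> J \<noteq> {\<one>\<^bsub>\<Gamma>\<^esub>} \<Longrightarrow> \<exists>k. J = power_subgroup p \<Gamma> k"
    using Zp_group_coordinates[OF assms(1,2)] by blast
  define k where "k v = (SOME k. I v = power_subgroup p \<Gamma> k)" for v
  have k: "I v = power_subgroup p \<Gamma> (k v)" if "v \<in> verts X" "I v \<noteq> {\<one>\<^bsub>\<Gamma>\<^esub>}" for v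
    unfolding k_def by (rule someI_ex[OF closed[OF assms(6,7)[OF that(1)] that(2)]])
  interpret padic_coordinates p \<Gamma> c by (rule c)
  interpret serre_graph X bar by (rule assms(3))
  interpret ramified_tower p \<Gamma> c X bar \<alpha> I k
    by unfold_locales (use assms(5) k in blast)+
  have ne: "verts X \<noteq> {}"
    using assms(4) by (auto simp: Digraph_Component.connected_def strongly_connected_def mk_symmetric_def)
  have "(\<Sum>v\<in>verts X - trivial_verts \<Gamma> X I. int (card (rcosets\<^bsub>\<Gamma>\<^esub> (I v)))) =
    (\<Sum>v\<in>verts X - trivial_verts \<Gamma> X I. int (p ^ k v))"
  proof (rule sum.cong[OF refl])
    fix v assume "v \<in> verts X - trivial_verts \<Gamma> X I"
    then have "I v = power_subgroup p \<Gamma> (k v)" using k[of v] by (auto simp: trivial_verts_def)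
    then show "int (card (rcosets\<^bsub>\<Gamma>\<^esub> (I v))) = int (p ^ k v)" by (simp only: card_rcosets_power_subgroup)
  qed
  then show ?thesis using iwasawa_lambda_parity[OF ne assms(8)] by simp
qed

end
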